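(* Let $K$ be an imaginary quadratic number field, let $k\in\mathbb{Z}^+$, and assume the $abc$ conjecture holds in $K$. Let $a\in\mathcal{O}_K$ with $a$ not in the set $$\left\{0,\pm1,\pm i,\pm1\pm i,\pm\sqrt{-2},\pm1\pm\sqrt{-2},\tfrac{\pm1\pm\sqrt{-3}}{2},\tfrac{\pm3\pm\sqrt{-3}}{2},\tfrac{\pm1\pm\sqrt{-7}}{2},\tfrac{\pm1\pm\sqrt{-11}}{2}\right\}.$$ Then the number of non-Wieferich places $\mathfrak{p}$ base $a$ with $\mathrm{Nm}(\mathfrak{p})\le x$ and $\mathrm{Nm}(\mathfrak{p})\equiv1\pmod{k}$ is $\gg_{K,a,k}\log x$.
   Context: $\mathcal{O}_K$ is the ring of integers of $K$; $\mathrm{Nm}(\mathfrak{p})$ is the absolute norm of a prime ideal $\mathfrak{p}$; $v_{\mathfrak{p}}(x)$ is the exponent of $\mathfrak{p}$ in the ideal $(x)$. For $a\in\mathcal{O}_K\setminus\{0\}$ and a prime ideal $\mathfrak{p}$ with $q=\mathrm{Nm}(\mathfrak{p})$: $\mathfrak{p}$ is a Wieferich place base $a$ if $v_{\mathfrak{p}}(a^{q-1}-1)>1$, and a non-Wieferich place base $a$ if $v_{\mathfrak{p}}(a^{q-1}-1)=1$. The $abc$ conjecture for $K$: for $a_1,a_2,a_3\in K^\times$ define $H(a_1,a_2,a_3)=\prod_v \max(\|a_1\|_v,\|a_2\|_v,\|a_3\|_v)$, the product over the infinite places $v$ of $K$ with $\|a\|_v=|v(a)|^{1/[K:\mathbb{Q}]}$,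 and $N(a_1,a_2,a_3)=\prod_{\mathfrak{p}\in I}\mathrm{Nm}(\mathfrak{p})^{1/[K:\mathbb{Q}]}$, where $I$ is the finite set of finite places $\mathfrak{p}$ at which $\|a_1\|_{\mathfrak{p}},\|a_2\|_{\mathfrak{p}},\|a_3\|_{\mathfrak{p}}$ are not all equal to $1$. The conjecture asserts: for every $\epsilon>0$ there is $C(\epsilon,K)$ with $H(\alpha,\beta,\alpha+\beta)\le C(\epsilon,K)N(\alpha,\beta,\alpha+\beta)^{1+\epsilon}$ for all $\alpha,\beta\in K$ with $\alpha,\beta,\alpha+\beta\ne0$. Notation: $f(x)\gg_S g(x)$ means $f(x)\ge c\,g(x)$ for all sufficiently large $x$, with $c>0$ depending only on $S$.
   Formalization: The abc height is taken over all places, finite ones included, with the usual normalisation at the complex place; with infinite places only, as stated, the conjecture fails for α = β = 2^n and the theorem would be empty. *)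

theory Defs
  imports
    "HOL-Analysis.Analysis"
    "HOL-Algebra.Algebraic_Closure_Type"
    "HOL-Algebra.Ideal_Product"
    "HOL-Algebra.QuotRing"
    "HOL-Algebra.Divisibility"
    "HOL-Number_Theory.Cong"
begin

section \<open>Number fields inside the complex numbers\<close>

abbreviation complex_ring :: "complex ring" where
  "complex_ring \<equiv> ring_of_type_algebra"

definition field_degree :: "complex set \<Rightarrow> nat" where
  "field_degree K = vector_space.dim (\<lambda>(q::rat) z. of_rat q * z) K"

text \<open>The dimension of an infinite-dimensional space is 0 by convention, so degree 2
  really means a two-dimensional rational vector space.\<close>

definition imaginary_quadratic_field :: "complex set \<Rightarrow> bool" where
  "imaginary_quadratic_field K \<longleftrightarrow>
     subfield K complex_ring \<and> field_degree K = 2 \<and> \<not> K \<subseteq> \<real>"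

definition ring_of_integers :: "complex set \<Rightarrow> complex ring" where
  "ring_of_integers K = complex_ring \<lparr>carrier := {z \<in> K. algebraic_int z}\<rparr>"

definition finite_places :: "complex set \<Rightarrow> complex set set" where
  "finite_places K = {P. primeideal P (ring_of_integers K) \<and> P \<noteq> {0}}"

definition ideal_norm :: "complex set \<Rightarrow> complex set \<Rightarrow> nat" where
  "ideal_norm K P = card (carrier (ring_of_integers K Quot P))"

text \<open>The exponent of \<open>P\<close> in the principal ideal \<open>(x)\<close>, for \<open>x\<close> in the ring of integers;
  divisibility and powers are taken in the multiplicative monoid of ideals.
  The exponent in the zero ideal is \<open>\<infinity>\<close>.\<close>

definition int_val :: "complex set \<Rightarrow> complex set \<Rightarrow> complex \<Rightarrow> enat" where
  "int_val K P x = (let R = ring_of_integers K in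
     Sup {enat n | n. (P [^]\<^bsub>ideals_set R\<^esub> n) divides\<^bsub>ideals_set R\<^esub> (PIdl\<^bsub>R\<^esub> x)})"

definition non_wieferich_place :: "complex set \<Rightarrow> complex \<Rightarrow> complex set \<Rightarrow> bool" where
  "non_wieferich_place K a P \<longleftrightarrow>
     P \<in> finite_places K \<and> int_val K P (a ^ (ideal_norm K P - 1) - 1) = 1"


section \<open>The abc conjecture for a number field\<close>

text \<open>Extension of the exponent to nonzero \<open>x\<close> in \<open>K\<close>, written as a quotient of integers;
  the value does not depend on the quotient chosen.\<close>

definition field_val :: "complex set \<Rightarrow> complex set \<Rightarrow> complex \<Rightarrow> int" where
  "field_val K P x =
     (THE e. \<exists>b \<in> carrier (ring_of_integers K) - {0}. \<exists>c \<in> carrier (ring_of_integers K) - {0}.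
        x = b / c \<and> e = int (the_enat (int_val K P b)) - int (the_enat (int_val K P c)))"

definition finite_abs :: "complex set \<Rightarrow> complex set \<Rightarrow> complex \<Rightarrow> real" where
  "finite_abs K P x =
     real (ideal_norm K P) powr (- of_int (field_val K P x) / real (field_degree K))"

text \<open>The archimedean factors are indexed by the embeddings of \<open>K\<close> into the complex numbers,
  each with \<open>|v(x)|\<close> to the power \<open>1/[K:\<rat>]\<close>. A complex place thus
  contributes once for each of its two conjugate embeddings, which is the normalisation that
  makes the product formula hold. The condition \<open>extensional\<close> only fixes the irrelevant
  values outside \<open>K\<close>.\<close>

definition embeddings :: "complex set \<Rightarrow> (complex \<Rightarrow> complex) set" where
  "embeddings K = ring_hom (complex_ring \<lparr>carrier := K\<rparr>) complex_ring \<inter> extensional K"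

definition infinite_abs :: "complex set \<Rightarrow> (complex \<Rightarrow> complex) \<Rightarrow> complex \<Rightarrow> real" where
  "infinite_abs K v x = norm (v x) powr (1 / real (field_degree K))"

definition infinite_height :: "complex set \<Rightarrow> complex \<Rightarrow> complex \<Rightarrow> complex \<Rightarrow> real" where
  "infinite_height K a1 a2 a3 =
     (\<Prod>v\<in>embeddings K. Max {infinite_abs K v a1, infinite_abs K v a2, infinite_abs K v a3})"

text \<open>All but finitely many factors at the finite places are 1; only the others are multiplied.\<close>

definition finite_height :: "complex set \<Rightarrow> complex \<Rightarrow> complex \<Rightarrow> complex \<Rightarrow> real" where
  "finite_height K a1 a2 a3 =
     (let m = (\<lambda>P. Max {finite_abs K P a1, finite_abs K P a2, finite_abs K P a3})
      in \<Prod>P\<in>{P \<in> finite_places K. m P \<noteq> 1}. m P)"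

text \<open>The height runs over all places. With the infinite places alone the conjecture below
  would be false for arbitrary \<open>\<alpha>, \<beta>\<close> in \<open>K\<close>: take \<open>\<alpha> = \<beta> = 2 ^ n\<close>, for which the archimedean
  product is unbounded while the radical stays constant. When \<open>\<alpha>\<close> and \<open>\<beta>\<close> are coprime integers
  the finite factor is 1, so the height is then the archimedean product.\<close>

definition abc_height :: "complex set \<Rightarrow> complex \<Rightarrow> complex \<Rightarrow> complex \<Rightarrow> real" where
  "abc_height K a1 a2 a3 = infinite_height K a1 a2 a3 * finite_height K a1 a2 a3"

definition abc_radical :: "complex set \<Rightarrow> complex \<Rightarrow> complex \<Rightarrow> complex \<Rightarrow> real" where
  "abc_radical K a1 a2 a3 =
     (\<Prod>P\<in>{P \<in> finite_places K.
            \<not> (finite_abs K P a1 = 1 \<and> finite_abs K P a2 = 1 \<and> finite_abs K P a3 = 1)}.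
        real (ideal_norm K P) powr (1 / real (field_degree K)))"

definition abc_conjecture :: "complex set \<Rightarrow> bool" where
  "abc_conjecture K \<longleftrightarrow>
     (\<forall>\<epsilon>>0. \<exists>C::real. \<forall>\<alpha>\<in>K. \<forall>\<beta>\<in>K. \<alpha> \<noteq> 0 \<longrightarrow> \<beta> \<noteq> 0 \<longrightarrow> \<alpha> + \<beta> \<noteq> 0 \<longrightarrow>
        abc_height K \<alpha> \<beta> (\<alpha> + \<beta>) \<le> C * abc_radical K \<alpha> \<beta> (\<alpha> + \<beta>) powr (1 + \<epsilon>))"


section \<open>The excluded bases\<close>

text \<open>\<open>s\<close> and \<open>t\<close> range over independent signs.\<close>

definition exceptional_bases :: "complex set" where
  "exceptional_bases =
     {0, 1, -1, \<i>, -\<i>, csqrt (-2), - csqrt (-2)} \<union>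
     (\<Union>s\<in>{1,-1}. \<Union>t\<in>{1,-1}.
       {s + t * \<i>,
        s + t * csqrt (-2),
        (s + t * csqrt (-3)) / 2,
        (s * 3 + t * csqrt (-3)) / 2,
        (s + t * csqrt (-7)) / 2,
        (s + t * csqrt (-11)) / 2})"

end

theory Submission
  imports Defs "HOL-Number_Theory.Totient" "HOL-Computational_Algebra.Fundamental_Theorem_Algebra"
    "HOL-Real_Asymp.Real_Asymp" "Jordan_Normal_Form.Char_Poly"
begin

text \<open>
  Since \<open>a\<close> is neither zero nor a unit, \<open>|a|\<^sup>2 \<ge> 2\<close>; put \<open>b = a ^ 4\<close>, so that \<open>|b| \<ge> 4\<close>. A place that is
  non-Wieferich base \<open>b\<close> is non-Wieferich base \<open>a\<close>. The \<open>abc\<close> conjecture for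
  \<open>(b ^ m - 1) + 1 = b ^ m\<close> shows that the powerful part of \<open>b ^ m - 1\<close> is at most
  \<open>C * |b| ^ (\<epsilon> * m)\<close>, whereas the value \<open>\<Phi>\<close> of the \<open>m\<close>-th cyclotomic polynomial at \<open>b\<close> has modulus at
  least \<open>(|b| - 1) ^ totient m\<close>. If \<open>totient m\<close> is at least a fixed multiple of \<open>m\<close> and \<open>m\<close> is large, some
  prime \<open>P\<close> not containing \<open>m\<close> therefore divides \<open>\<Phi>\<close> and divides \<open>b ^ m - 1\<close> exactly once. For such
  \<open>P\<close> the order of \<open>b\<close> modulo \<open>P\<close> is \<open>m\<close>, so \<open>m\<close> divides \<open>Nm P - 1\<close>, different \<open>m\<close> give different \<open>P\<close>,
  and \<open>P\<close> is non-Wieferich. Taking \<open>m = k * n\<close> with \<open>totient n \<ge> n / 16\<close>, which holds for a positive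
  proportion of the \<open>n\<close>, gives the logarithmic count.

  The ideal theory of the quadratic field rests on the fact that \<open>I * cnj I\<close> is generated by a natural
  number for every ideal \<open>I\<close>: this makes nonzero ideals cancellable and yields unique factorization.
\<close>


section \<open>Algebraic integers form a ring\<close>

text \<open>The exponent \<open>\<epsilon>\<close> of the \<open>abc\<close> conjecture is fixed
  before \<open>m\<close>, so the cyclotomic value must grow like a fixed power of |b|^m. Its size
  is governed by \<open>totient m\<close>, and \<open>totient m / m\<close> has no positive lower
  bound; hence the restriction to m \<le> l * totient m with a fixed l. Since totient n \<le>
  totient (k * n), a bound n \<le> 16 * totient n passes to m = k * n with l = 16 * k, and the same
  multiplication delivers the congruence modulo k. The fourth power is there because |a| may be as
  small as sqrt 2, where (|a| - 1)^(totient m) tends to 0; from |b| \<ge> 4 follows (|b| - 1)^2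
  \<ge> |b|. Primes containing m, at which the order of b may be smaller than m, cost little: those
  that divide b^m - 1 only once contribute at most the norm m^2 of the ideal (m), polynomial against
  exponential growth. A place found for m has norm at most 4 * |b|^(2 * m), so all large admissible
  m up to a constant multiple of log x yield distinct places of norm at most x.\<close>

lemma algebraic_int_if_stable_vector:
  fixes x :: complex and v :: "nat \<Rightarrow> complex" and a :: "nat \<Rightarrow> nat \<Rightarrow> int"
  assumes stable: "\<And>i. i < n \<Longrightarrow> x * v i = (\<Sum>j<n. of_int (a i j) * v j)"
    and nz: "i0 < n" "v i0 \<noteq> 0"
  shows "algebraic_int x"
proof -
  define A where "A = mat n n (\<lambda>(i,j). a i j)"
  define B :: "complex mat" where "B = map_mat of_int A"
  have A: "A \<in> carrier_mat n n" and B: "B \<in> carrier_mat n n"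
    by (auto simp: A_def B_def)
  \<comment> \<open>The relations say that \<open>v\<close> is an eigenvector of the integer matrix
    \<open>A\<close> with eigenvalue \<open>x\<close>; the characteristic polynomial of
    \<open>A\<close> is then a monic integer polynomial with root \<open>x\<close>.\<close>
  have "eigenvector B (vec n v) x"
    unfolding eigenvector_def
  proof (intro conjI)
    show "vec n v \<in> carrier_vec (dim_row B)" using B by auto
    show "vec n v \<noteq> 0\<^sub>v (dim_row B)"
    proof
      assume "vec n v = 0\<^sub>v (dim_row B)"
      then have "vec_index (vec n v) i0 = vec_index (0\<^sub>v n) i0" using B by auto
      then show False using nz by simp
    qed
    show "B *\<^sub>v vec n v = x \<cdot>\<^sub>v vec n v"
    proof (rule eq_vecI)
      fix i assume i: "i < dim_vec (x \<cdot>\<^sub>v vec n v)"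
      then have "vec_index (B *\<^sub>v vec n v) i = (\<Sum>j\<in>{0..<n}. of_int (a i j) * v j)"
        using B by (auto simp: B_def A_def scalar_prod_def intro!: sum.cong)
      also have "\<dots> = x * v i" using stable i by (simp add: atLeast0LessThan)
      finally show "vec_index (B *\<^sub>v vec n v) i = vec_index (x \<cdot>\<^sub>v vec n v) i" using i by simp
    qed (use B in auto)
  qed
  then have "poly (char_poly B) x = 0"
    using eigenvalue_root_char_poly[OF B] by (auto simp: eigenvalue_def)
  also have "char_poly B = map_poly of_int (char_poly A)"
    unfolding B_def by (rule of_int_hom.char_poly_hom[OF A])
  finally show ?thesis
    using degree_monic_char_poly[OF A] by (auto simp: algebraic_int_altdef_ipoly)
qed

interpretation Zmod: Modules.module "\<lambda>(n::int) (z::complex). of_int n * z"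
  by unfold_locales (auto simp: algebra_simps)

lemma span_mult:
  assumes "z \<in> Zmod.span A"
  shows "z * w \<in> Zmod.span ((\<lambda>u. u * w) ` A)"
  using assms
proof (induction rule: Zmod.span_induct_alt)
  case base
  then show ?case by (simp add: Zmod.span_zero)
next
  case (step c x y)
  have "(of_int c * x + y) * w = of_int c * (x * w) + y * w" by (simp add: algebra_simps)
  moreover have "x * w \<in> Zmod.span ((\<lambda>u. u * w) ` A)"
    using step.hyps by (intro Zmod.span_base) auto
  ultimately show ?case
    using step.IH by (simp only: Zmod.span_add Zmod.span_scale)
qed

text \<open>The generators in \<open>S\<close> may be linearly dependent: any choice of coefficients
  gives an integer matrix to which the eigenvalue argument applies.\<close>

lemma algebraic_int_if_stable_span:
  fixes x :: complex
  assumes "finite S" "s0 \<in> S" "s0 \<noteq> 0" and st: "\<And>s. s \<in> S \<Longrightarrow> x * s \<in> Zmod.span S"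
  shows "algebraic_int x"
proof -
  obtain f where f: "bij_betw f {0..<card S} S"
    using ex_bij_betw_nat_finite[OF assms(1)] by blast
  define n where "n = card S"
  have fin: "f i \<in> S" if "i < n" for i
    using bij_betwE[OF f] that by (auto simp: n_def)
  have "\<exists>u. x * s = (\<Sum>v\<in>S. of_int (u v) * v)" if "s \<in> S" for s
    using st[OF that] unfolding Zmod.span_finite[OF assms(1)] by (simp add: image_iff)
  then obtain u where u: "x * s = (\<Sum>v\<in>S. of_int (u s v) * v)" if "s \<in> S" for s
    by metis
  have "x * f i = (\<Sum>j<n. of_int (u (f i) (f j)) * f j)" if "i < n" for i
    unfolding u[OF fin[OF that]] lessThan_atLeast0 n_def
    by (rule sum.reindex_bij_betw[OF f, symmetric])
  moreover obtain i0 where "i0 < n" "f i0 = s0"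
    using f assms(2) unfolding bij_betw_def n_def by (metis atLeastLessThan_iff imageE)
  ultimately show ?thesis
    using assms(3) by (intro algebraic_int_if_stable_vector[of n x f "\<lambda>i j. u (f i) (f j)" i0]) auto
qed

lemma algebraic_int_power_in_span:
  fixes x :: complex
  assumes "algebraic_int x"
  obtains n where "n > 0" "x ^ n \<in> Zmod.span ((^) x ` {..<n})"
proof -
  obtain p where p: "poly (map_poly of_int p) x = 0" "Polynomial.lead_coeff p = 1"
    using assms by (auto simp: algebraic_int_altdef_ipoly)
  define n where "n = Polynomial.degree p"
  have "0 = (\<Sum>i\<le>n. of_int (Polynomial.coeff p i) * x ^ i)"
    using p(1) by (simp add: poly_altdef n_def coeff_map_poly degree_map_poly)
  also have "\<dots> = (\<Sum>i<n. of_int (Polynomial.coeff p i) * x ^ i) + x ^ n"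
    using p(2) by (simp add: lessThan_Suc_atMost[symmetric] n_def)
  finally have eq: "x ^ n = - (\<Sum>i<n. of_int (Polynomial.coeff p i) * x ^ i)"
    by (simp add: eq_neg_iff_add_eq_0 add.commute)
  have "x ^ n \<in> Zmod.span ((^) x ` {..<n})"
    unfolding eq by (intro Zmod.span_neg Zmod.span_sum Zmod.span_scale Zmod.span_base) auto
  moreover have "n > 0"
    using eq by (cases "n = 0") auto
  ultimately show ?thesis by (rule that[rotated])
qed

text \<open>A single finitely generated group stable under both numbers makes sum and product
  integral at once. It is spanned by the monomials \<open>x ^ i * y ^ j\<close> with bounded
  exponents, since the monic equations reduce higher powers.\<close>

lemma algebraic_int_common_module:
  fixes x y :: complex
  assumes "algebraic_int x" "algebraic_int y"
  obtains S where "finite S" "1 \<in> S" "\<And>s. s \<in> S \<Longrightarrow> x * s \<in> Zmod.span S"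
    "\<And>s. s \<in> S \<Longrightarrow> y * s \<in> Zmod.span S"
proof -
  obtain m where m: "m > 0" "x ^ m \<in> Zmod.span ((^) x ` {..<m})"
    using algebraic_int_power_in_span[OF assms(1)] by blast
  obtain n where n: "n > 0" "y ^ n \<in> Zmod.span ((^) y ` {..<n})"
    using algebraic_int_power_in_span[OF assms(2)] by blast
  define S where "S = (\<lambda>(i,j). x ^ i * y ^ j) ` ({..<m} \<times> {..<n})"
  have S: "x ^ i * y ^ j \<in> S" if "i < m" "j < n" for i j
    using that by (force simp: S_def)
  show ?thesis
  proof
    show "finite S" by (simp add: S_def)
    show "1 \<in> S" using S[of 0 0] m n by simp
  next
    fix s assume "s \<in> S"
    then obtain i j where ij: "i < m" "j < n" "s = x ^ i * y ^ j" by (auto simp: S_def)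
    have "x ^ Suc i * y ^ j \<in> Zmod.span S"
    proof (cases "Suc i = m")
      case True
      have "x ^ m * y ^ j \<in> Zmod.span ((\<lambda>u. u * y ^ j) ` (^) x ` {..<m})"
        by (rule span_mult[OF m(2)])
      also have "\<dots> \<subseteq> Zmod.span S" by (rule Zmod.span_mono) (use S ij in auto)
      finally show ?thesis using True by simp
    next
      case False
      then show ?thesis using S[of "Suc i" j] ij by (intro Zmod.span_base) auto
    qed
    then show "x * s \<in> Zmod.span S" by (simp add: ij mult.assoc)
    have "x ^ i * y ^ Suc j \<in> Zmod.span S"
    proof (cases "Suc j = n")
      case True
      have "y ^ n * x ^ i \<in> Zmod.span ((\<lambda>u. u * x ^ i) ` (^) y ` {..<n})"
        by (rule span_mult[OF n(2)])
      also have "\<dots> \<subseteq> Zmod.span S"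
        by (rule Zmod.span_mono) (use S ij in \<open>auto simp: mult.commute\<close>)
      finally show ?thesis using True by (simp add: mult.commute)
    next
      case False
      then show ?thesis using S[of i "Suc j"] ij by (intro Zmod.span_base) auto
    qed
    then show "y * s \<in> Zmod.span S" by (simp add: ij mult_ac)
  qed
qed

lemma algebraic_int_add [intro]:
  fixes x y :: complex
  assumes "algebraic_int x" "algebraic_int y"
  shows "algebraic_int (x + y)"
proof -
  obtain S where S: "finite S" "1 \<in> S" "\<And>s. s \<in> S \<Longrightarrow> x * s \<in> Zmod.span S"
    "\<And>s. s \<in> S \<Longrightarrow> y * s \<in> Zmod.span S"
    using algebraic_int_common_module[OF assms] by metis
  show ?thesis
    by (rule algebraic_int_if_stable_span[OF S(1,2)])
      (use S(3,4) in \<open>auto simp: distrib_right intro: Zmod.span_add\<close>)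
qed

lemma algebraic_int_mult [intro]:
  fixes x y :: complex
  assumes "algebraic_int x" "algebraic_int y"
  shows "algebraic_int (x * y)"
proof -
  obtain S where S: "finite S" "1 \<in> S" "\<And>s. s \<in> S \<Longrightarrow> x * s \<in> Zmod.span S"
    "\<And>s. s \<in> S \<Longrightarrow> y * s \<in> Zmod.span S"
    using algebraic_int_common_module[OF assms] by metis
  \<comment> \<open>\<open>y * s\<close> lies only in the span, so stability under \<open>x\<close>
    has to be extended from the generators to the span.\<close>
  have "x * t \<in> Zmod.span S" if "t \<in> Zmod.span S" for t
  proof -
    have "t * x \<in> Zmod.span ((\<lambda>u. u * x) ` S)" by (rule span_mult[OF that])
    also have "\<dots> \<subseteq> Zmod.span S"
      using S(3) by (intro Zmod.span_minimal Zmod.subspace_span) (auto simp: mult.commute[of _ x])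
    finally show ?thesis by (simp add: mult.commute)
  qed
  then show ?thesis
    using S by (intro algebraic_int_if_stable_span[OF S(1,2)]) (auto simp: mult.assoc)
qed

lemma algebraic_int_prod:
  fixes f :: "'i \<Rightarrow> complex"
  assumes "\<And>i. i \<in> I \<Longrightarrow> algebraic_int (f i)"
  shows "algebraic_int (prod f I)"
  using assms by (induction I rule: infinite_finite_induct) auto


section \<open>The ring of integers of an imaginary quadratic field\<close>

lemma complex_ring_simps [simp]:
  "carrier complex_ring = UNIV" "x \<otimes>\<^bsub>complex_ring\<^esub> y = x * y" "x \<oplus>\<^bsub>complex_ring\<^esub> y = x + y"
  "\<one>\<^bsub>complex_ring\<^esub> = 1" "\<zero>\<^bsub>complex_ring\<^esub> = 0"
  by (simp_all add: ring_of_type_algebra_def)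

lemma complex_ring_inv: "x \<noteq> 0 \<Longrightarrow> inv\<^bsub>complex_ring\<^esub> x = inverse x"
proof -
  interpret field complex_ring by (rule field_from_type_algebra)
  show "x \<noteq> 0 \<Longrightarrow> inv\<^bsub>complex_ring\<^esub> x = inverse x"
    by (rule comm_inv_char) auto
qed

lemma complex_ring_a_inv [simp]: "\<ominus>\<^bsub>complex_ring\<^esub> x = - x"
proof -
  interpret field complex_ring by (rule field_from_type_algebra)
  show ?thesis by (rule minus_equality) auto
qed

interpretation Qvec: vector_space "\<lambda>(q::rat) (z::complex). of_rat q * z"
  by unfold_locales (auto simp: algebra_simps of_rat_add of_rat_mult)

lemma Rats_complex_iff: "(z::complex) \<in> \<rat> \<longleftrightarrow> (\<exists>q. z = of_rat q)"
  by (auto simp: Rats_def)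

lemma Rats_subset_Reals: "(\<rat> :: complex set) \<subseteq> \<real>"
proof
  fix z :: complex assume "z \<in> \<rat>"
  then obtain a b :: int where "z = of_int a / of_int b" by (auto elim: Rats_cases')
  then show "z \<in> \<real>" by simp
qed

lemma Rats_imp_cnj_eq: "z \<in> \<rat> \<Longrightarrow> cnj z = z"
  by (metis Rats_subset_Reals Reals_cnj_iff subsetD)

locale imag_quad =
  fixes K :: "complex set"
  assumes imag_quad: "imaginary_quadratic_field K"
begin

lemma subfield_K: "subfield K complex_ring"
  using imag_quad by (simp add: imaginary_quadratic_field_def)

lemma
  shows K_0 [simp]: "0 \<in> K" and K_1 [simp]: "1 \<in> K"
    and K_add: "x \<in> K \<Longrightarrow> y \<in> K \<Longrightarrow> x + y \<in> K"
    and K_mult: "x \<in> K \<Longrightarrow> y \<in> K \<Longrightarrow> x * y \<in> K"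
    and K_minus: "x \<in> K \<Longrightarrow> - x \<in> K"
proof -
  have sr: "subring K complex_ring"
    using subfield_K by (simp add: subfieldE(1))
  show "0 \<in> K" "1 \<in> K" "x \<in> K \<Longrightarrow> y \<in> K \<Longrightarrow> x + y \<in> K" "x \<in> K \<Longrightarrow> y \<in> K \<Longrightarrow> x * y \<in> K"
    "x \<in> K \<Longrightarrow> - x \<in> K"
    using subringE(2,3,5,6,7)[OF sr] by auto
qed

lemma K_diff: "x \<in> K \<Longrightarrow> y \<in> K \<Longrightarrow> x - y \<in> K"
  using K_add[OF _ K_minus] by fastforce

lemma K_inverse:
  assumes "x \<in> K"
  shows "inverse x \<in> K"
proof (cases "x = 0")
  case False
  then show ?thesis
    using ring.subfield_m_inv(1)[OF ring_from_type_algebra subfield_K, of x] assms complex_ring_inv[of x] by auto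
qed auto

lemma K_divide: "x \<in> K \<Longrightarrow> y \<in> K \<Longrightarrow> x / y \<in> K"
  by (simp add: divide_inverse K_mult K_inverse)

lemma K_of_nat [simp]: "of_nat n \<in> K"
  by (induction n) (auto intro: K_add)

lemma K_of_int [simp]: "of_int n \<in> K"
  by (cases n rule: int_cases2) (auto intro: K_minus)

lemma K_of_rat [simp]: "of_rat q \<in> K"
  by (cases q) (auto simp: of_rat_rat intro!: K_divide)

lemma K_power: "x \<in> K \<Longrightarrow> x ^ n \<in> K"
  by (induction n) (auto intro: K_mult)

text \<open>A nonreal \<open>w\<close> is no rational multiple of 1, so \<open>w\<close> and 1 are
  independent; a third independent element would exceed the dimension 2.\<close>

lemma quadratic_basis:
  assumes "w \<in> K" "w \<notin> \<real>" "z \<in> K"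
  obtains r s where "z = of_rat r + of_rat s * w"
proof -
  have nr: "of_rat r \<noteq> w" for r
    using assms(2) Rats_subset_Reals Rats_of_rat by blast
  have dim: "Qvec.dim K = 2"
    using imag_quad by (simp add: imaginary_quadratic_field_def field_degree_def)
  obtain B where B: "B \<subseteq> K" "Qvec.independent B" "K \<subseteq> Qvec.span B" "card B = 2"
    using Qvec.basis_exists[of K] dim by metis
  then have finB: "finite B" using card.infinite by fastforce
  have span1: "Qvec.span {1} = range of_rat"
    by (auto simp: Qvec.span_singleton)
  have indep: "Qvec.independent {w, 1}"
    using assms(2) nr by (subst Qvec.independent_insert) (auto simp: span1)
  have "z \<in> Qvec.span {w, 1}"
  proof (rule ccontr)
    assume z: "z \<notin> Qvec.span {w, 1}"
    then have "Qvec.independent {z, w, 1}"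
      using indep by (subst Qvec.independent_insert) auto
    moreover have "{z, w, 1} \<subseteq> Qvec.span B"
      using assms B by auto
    ultimately have "card {z, w, 1} \<le> 2"
      using Qvec.independent_span_bound[OF finB] B(4) by metis
    moreover have "z \<noteq> w" "z \<noteq> 1" "w \<noteq> 1"
      using z assms(2) Qvec.span_base[of _ "{w, 1}"] by auto
    ultimately show False by auto
  qed
  then obtain k where "z - of_rat k * w \<in> Qvec.span {1}"
    by (metis Qvec.span_breakdown_eq)
  then obtain r where "z - of_rat k * w = of_rat r"
    unfolding span1 by auto
  then have "z = of_rat r + of_rat k * w"
    by (simp add: algebra_simps)
  then show ?thesis by (rule that)
qed

lemma K_nonreal_generator:
  obtains w where "w \<in> K" "w \<notin> \<real>"
  using imag_quad by (auto simp: imaginary_quadratic_field_def)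

text \<open>The quadratic equation of \<open>w\<close> has rational coefficients, so the conjugate
  satisfies it too; being distinct from \<open>w\<close>, it is the second root, and Vieta gives sum
  and product.\<close>

lemma rational_trace_norm_of_generator:
  assumes w: "w \<in> K" "w \<notin> \<real>"
  shows "w + cnj w \<in> \<rat>" "w * cnj w \<in> \<rat>"
proof -
  obtain r s where rs: "w * w = of_rat r + of_rat s * w"
    using quadratic_basis[OF w] K_mult[OF w(1) w(1)] by blast
  have rs': "cnj w * cnj w = of_rat r + of_rat s * cnj w"
    using arg_cong[OF rs, of cnj] Rats_imp_cnj_eq[OF Rats_of_rat] by simp
  have ne: "w - cnj w \<noteq> 0" using w(2) Reals_cnj_iff by force
  have "(w - cnj w) * (w + cnj w - of_rat s) = 0"
    using rs rs' by (simp add: algebra_simps)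
  then have s: "w + cnj w = of_rat s" using ne by simp
  then show "w + cnj w \<in> \<rat>" by simp
  have "w * w = of_rat r + (w + cnj w) * w" using rs s by simp
  then have "w * cnj w = - of_rat r" by (simp add: algebra_simps add_eq_0_iff)
  then show "w * cnj w \<in> \<rat>" by simp
qed

text \<open>The conjugate of a nonreal generator is its rational trace minus the generator: the
  field is Galois over the rationals.\<close>

lemma K_cnj:
  assumes "z \<in> K"
  shows "cnj z \<in> K"
proof -
  obtain w where w: "w \<in> K" "w \<notin> \<real>" by (rule K_nonreal_generator)
  obtain r s where z: "z = of_rat r + of_rat s * w" using quadratic_basis[OF w assms] .
  obtain t where "w + cnj w = of_rat t"
    using rational_trace_norm_of_generator(1)[OF w] by (auto simp: Rats_complex_iff)
  then have "cnj w = of_rat t - w" by (simp add: algebra_simps)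
  then have "cnj w \<in> K" using w by (simp add: K_diff)
  then show ?thesis
    using Rats_imp_cnj_eq[OF Rats_of_rat] by (simp add: z K_add K_mult)
qed

lemma K_real_imp_rational:
  assumes "z \<in> K" "z \<in> \<real>"
  shows "z \<in> \<rat>"
proof -
  obtain w where w: "w \<in> K" "w \<notin> \<real>" by (rule K_nonreal_generator)
  obtain r s where z: "z = of_rat r + of_rat s * w" using quadratic_basis[OF w assms(1)] .
  have rat_real: "of_rat q \<in> (\<real> :: complex set)" for q
    using Rats_subset_Reals Rats_of_rat by blast
  have "s = 0"
  proof (rule ccontr)
    assume "s \<noteq> 0"
    then have "w = (z - of_rat r) / of_rat s" using z by (simp add: field_simps)
    then show False using w(2) assms(2) rat_real by (metis Reals_diff Reals_divide)
  qed
  then show ?thesis using z by simp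
qed

lemma K_trace_norm_rational:
  assumes "z \<in> K"
  shows "z + cnj z \<in> \<rat>" "z * cnj z \<in> \<rat>"
proof -
  have "z + cnj z \<in> \<real>" "z * cnj z \<in> \<real>" by (auto simp: complex_is_Real_iff)
  then show "z + cnj z \<in> \<rat>" "z * cnj z \<in> \<rat>"
    using assms by (auto intro!: K_real_imp_rational K_add K_mult K_cnj)
qed

section \<open>Integers of the field: trace, norm and an integral basis\<close>

definition OK :: "complex set" where "OK = {z \<in> K. algebraic_int z}"

text \<open>Trace and norm of an integer are rational algebraic integers; conversely
  \<open>z\<close> is a root of X^2 - (z + cnj z) * X + z * cnj z. The direction from right to left
  is what recognises a quotient as an integer in \<open>idl_prod_cnj_principal\<close>.\<close>

lemma OK_iff:
  "z \<in> OK \<longleftrightarrow> z \<in> K \<and> z + cnj z \<in> \<int> \<and> z * cnj z \<in> \<int>"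
proof
  assume "z \<in> OK"
  then show "z \<in> K \<and> z + cnj z \<in> \<int> \<and> z * cnj z \<in> \<int>"
    unfolding OK_def
    by (auto intro!: rational_algebraic_int_is_int algebraic_int_add algebraic_int_mult
        algebraic_int_cnj intro: K_trace_norm_rational)
next
  assume *: "z \<in> K \<and> z + cnj z \<in> \<int> \<and> z * cnj z \<in> \<int>"
  define p where "p = [:z * cnj z, - (z + cnj z), 1:]"
  have "poly p z = 0" by (simp add: p_def algebra_simps)
  moreover have "\<forall>i. Polynomial.coeff p i \<in> \<int>"
  proof
    fix i :: nat
    consider "i = 0" | "i = 1" | "i = 2" | "i > 2" by linarith
    then show "Polynomial.coeff p i \<in> \<int>"
    proof cases
      case 4
      then show ?thesis
        by (subst Polynomial.coeff_eq_0) (auto simp: p_def)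
    qed (use * in \<open>auto simp: p_def numeral_2_eq_2 simp del: minus_add_distrib\<close>)
  qed
  ultimately have "algebraic_int z"
    by (intro algebraic_int.intros[of p]) (auto simp: p_def)
  then show "z \<in> OK" using * by (simp add: OK_def)
qed

lemma
  shows OK_0 [simp]: "0 \<in> OK" and OK_1 [simp]: "1 \<in> OK"
    and OK_add: "x \<in> OK \<Longrightarrow> y \<in> OK \<Longrightarrow> x + y \<in> OK"
    and OK_mult: "x \<in> OK \<Longrightarrow> y \<in> OK \<Longrightarrow> x * y \<in> OK"
    and OK_minus: "x \<in> OK \<Longrightarrow> - x \<in> OK"
    and OK_cnj: "x \<in> OK \<Longrightarrow> cnj x \<in> OK"
    and OK_of_int [simp]: "of_int n \<in> OK"
    and OK_of_nat [simp]: "of_nat m \<in> OK"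
  by (auto simp: OK_def intro: K_add K_mult K_minus K_cnj int_imp_algebraic_int)

lemma OK_diff: "x \<in> OK \<Longrightarrow> y \<in> OK \<Longrightarrow> x - y \<in> OK"
  using OK_add[OF _ OK_minus] by fastforce

lemma OK_power: "x \<in> OK \<Longrightarrow> x ^ n \<in> OK"
  by (induction n) (auto intro: OK_mult)

lemma OK_sum: "(\<And>i. i \<in> I \<Longrightarrow> f i \<in> OK) \<Longrightarrow> sum f I \<in> OK"
  by (induction I rule: infinite_finite_induct) (auto intro: OK_add)

lemma OK_subset_K: "OK \<subseteq> K"
  by (auto simp: OK_def)

text \<open>On \<open>OK\<close> the floor is only a cast to the natural numbers: the squared
  modulus is there the field norm z * cnj z, an integer.\<close>

definition abs_norm :: "complex \<Rightarrow> nat" where "abs_norm z = nat \<lfloor>(cmod z)\<^sup>2\<rfloor>"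

lemma real_abs_norm:
  assumes "z \<in> OK"
  shows "real (abs_norm z) = (cmod z)\<^sup>2"
proof -
  have "complex_of_real ((cmod z)\<^sup>2) \<in> \<int>"
    using assms by (simp add: OK_iff complex_norm_square del: of_real_power)
  then obtain n where "(cmod z)\<^sup>2 = real_of_int n"
    by (metis Ints_cases of_real_eq_iff of_real_of_int_eq)
  moreover from this have "n \<ge> 0" by (metis of_int_0_le_iff zero_le_power2)
  ultimately show ?thesis by (simp add: abs_norm_def)
qed

lemma of_nat_abs_norm: "z \<in> OK \<Longrightarrow> of_nat (abs_norm z) = z * cnj z"
  by (metis complex_norm_square of_real_of_nat_eq real_abs_norm)

lemma abs_norm_mult:
  assumes "x \<in> OK" "y \<in> OK"
  shows "abs_norm (x * y) = abs_norm x * abs_norm y"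
proof -
  have "real (abs_norm (x * y)) = real (abs_norm x * abs_norm y)"
    using assms by (simp add: real_abs_norm OK_mult norm_mult power_mult_distrib)
  then show ?thesis by linarith
qed

lemma abs_norm_0_iff: "z \<in> OK \<Longrightarrow> abs_norm z = 0 \<longleftrightarrow> z = 0"
  using real_abs_norm[of z] by auto

lemma OK_real_imp_int:
  assumes "z \<in> OK" "z \<in> \<real>"
  obtains i :: int where "z = of_int i"
  using assms rational_algebraic_int_is_int[of z] K_real_imp_rational[of z]
  by (auto simp: OK_def elim: Ints_cases)

text \<open>The number is 4 * norm - trace^2, minus the discriminant of the quadratic equation of
  \<open>z\<close>. Its integrality makes the imaginary parts of integers discrete, so that
  \<open>integral_basis\<close> can minimise.\<close>

lemma OK_four_Im_square:
  assumes "z \<in> OK"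
  shows "4 * (Im z)\<^sup>2 \<in> \<int>"
proof -
  have "complex_of_real (4 * (Im z)\<^sup>2) = 4 * (z * cnj z) - (z + cnj z) * (z + cnj z)"
    by (simp add: complex_eq_iff power2_eq_square algebra_simps)
  also have "\<dots> \<in> \<int>" using assms by (simp add: OK_iff del: complex_cnj_mult)
  finally obtain n where "complex_of_real (4 * (Im z)\<^sup>2) = complex_of_real (of_int n)"
    by (auto elim: Ints_cases)
  then have "4 * (Im z)\<^sup>2 = of_int n" by (simp only: of_real_eq_iff)
  then show ?thesis by simp
qed

lemma OK_nonreal:
  obtains z where "z \<in> OK" "Im z > 0"
proof -
  obtain w where w: "w \<in> K" "w \<notin> \<real>" by (rule K_nonreal_generator)
  obtain p where p: "w + cnj w = of_rat p"
    using rational_trace_norm_of_generator(1)[OF w] by (auto simp: Rats_complex_iff)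
  obtain q where q: "w * cnj w = of_rat q"
    using rational_trace_norm_of_generator(2)[OF w] by (auto simp: Rats_complex_iff)
  obtain a b where ab: "p = Rat.Fract a b" "b > 0" by (cases p) auto
  obtain c d where cd: "q = Rat.Fract c d" "d > 0" by (cases q) auto
  \<comment> \<open>\<open>b\<close> and \<open>d\<close> are the denominators of trace and norm of
    \<open>w\<close>; the scaling multiplies the trace by b * d and the norm by its square, which
    clears both.\<close>
  define z where "z = of_int (b * d) * w"
  have "z + cnj z = of_int (b * d) * (w + cnj w)"
    by (simp add: z_def algebra_simps)
  also have "\<dots> = of_int (a * d)" 
    unfolding p ab(1) using ab(2) by (simp add: of_rat_rat)
  finally have 1: "z + cnj z \<in> \<int>" by simp
  have "z * cnj z = of_int (b * d) * of_int (b * d) * (w * cnj w)"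
    unfolding z_def by (simp only: complex_cnj_mult complex_cnj_of_int mult_ac)
  also have "\<dots> = of_int (b * b * d * c)" 
    unfolding q cd(1) using cd(2) by (simp add: of_rat_rat)
  finally have 2: "z * cnj z \<in> \<int>" by simp
  have z: "z \<in> OK" using 1 2 w by (simp add: OK_iff z_def K_mult)
  have "Im z = of_int (b * d) * Im w" unfolding z_def by (simp del: of_int_mult)
  moreover have "Im w \<noteq> 0" using w(2) by (simp add: complex_is_Real_iff)
  ultimately have "Im z \<noteq> 0" using ab cd by simp
  then show ?thesis
    using that[OF z] that[OF OK_minus[OF z]] by (cases "Im z > 0") auto
qed

text \<open>\<open>\<omega>\<close> has the least positive imaginary part among the integers of
  \<open>K\<close>. Subtracting a suitable integer multiple of it brings the imaginary part of
  \<open>z\<close> below that minimum, hence to 0, and a rational integer remains.\<close>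

lemma integral_basis:
  obtains \<omega> where "\<omega> \<in> OK" "Im \<omega> > 0"
    "\<And>z. z \<in> OK \<Longrightarrow> \<exists>i j :: int. z = of_int i + of_int j * \<omega>"
proof -
  define P where "P = (\<lambda>z. z \<in> OK \<and> Im z > 0)"
  obtain z0 where "P z0" using OK_nonreal by (auto simp: P_def)
  from ex_has_least_nat[of P z0 "\<lambda>z. nat \<lfloor>4 * (Im z)\<^sup>2\<rfloor>", OF this]
  obtain \<omega> where \<omega>: "P \<omega>"
    and least: "\<And>z. P z \<Longrightarrow> nat \<lfloor>4 * (Im \<omega>)\<^sup>2\<rfloor> \<le> nat \<lfloor>4 * (Im z)\<^sup>2\<rfloor>" by blast
  have Im_least: "Im \<omega> \<le> Im z" if Pz: "P z" for z
  proof -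
    have "\<lfloor>4 * (Im \<omega>)\<^sup>2\<rfloor> \<le> int (nat \<lfloor>4 * (Im z)\<^sup>2\<rfloor>)"
      using least[OF Pz] by (simp only: nat_le_iff)
    also have "\<dots> = \<lfloor>4 * (Im z)\<^sup>2\<rfloor>" by (rule nat_0_le) simp
    finally have "\<lfloor>4 * (Im \<omega>)\<^sup>2\<rfloor> \<le> \<lfloor>4 * (Im z)\<^sup>2\<rfloor>" .
    moreover obtain m n where "4 * (Im \<omega>)\<^sup>2 = of_int m" "4 * (Im z)\<^sup>2 = of_int n"
      using OK_four_Im_square[of \<omega>] OK_four_Im_square[of z] \<omega> Pz
      by (auto simp: P_def elim!: Ints_cases)
    ultimately have "4 * (Im \<omega>)\<^sup>2 \<le> 4 * (Im z)\<^sup>2"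
      by (simp only: floor_of_int of_int_le_iff)
    then have "(Im \<omega>)\<^sup>2 \<le> (Im z)\<^sup>2" by linarith
    then show ?thesis using Pz by (auto simp: P_def intro: power2_le_imp_le)
  qed
  show ?thesis
  proof
    show "\<omega> \<in> OK" "Im \<omega> > 0" using \<omega> by (auto simp: P_def)
    fix z assume z: "z \<in> OK"
    define j where "j = \<lfloor>Im z / Im \<omega>\<rfloor>"
    define z' where "z' = z - of_int j * \<omega>"
    have z': "z' \<in> OK" using z \<open>\<omega> \<in> OK\<close> by (simp add: z'_def OK_diff OK_mult)
    have "of_int j \<le> Im z / Im \<omega>" "Im z / Im \<omega> < of_int j + 1"
      by (auto simp: j_def)
    then have "0 \<le> Im z'" "Im z' < Im \<omega>"
      using \<open>Im \<omega> > 0\<close> by (auto simp: z'_def field_simps)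
    then have "Im z' = 0" using Im_least[of z'] z' by (force simp: P_def)
    then obtain i where "z' = of_int i"
      using OK_real_imp_int[OF z'] by (auto simp: complex_is_Real_iff)
    then show "\<exists>i j :: int. z = of_int i + of_int j * \<omega>"
      by (intro exI[of _ i] exI[of _ j]) (simp add: z'_def algebra_simps)
  qed
qed


section \<open>Ideals\<close>

abbreviation R :: "complex ring" where "R \<equiv> ring_of_integers K"

lemma R_simps [simp]:
  "carrier R = OK" "x \<otimes>\<^bsub>R\<^esub> y = x * y" "x \<oplus>\<^bsub>R\<^esub> y = x + y"
  "\<one>\<^bsub>R\<^esub> = 1" "\<zero>\<^bsub>R\<^esub> = 0"
  by (simp_all add: ring_of_integers_def OK_def ring_of_type_algebra_def)

lemma cring_R: "cring R"
proof (rule cringI)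
  show "abelian_group R"
  proof (rule abelian_groupI)
    fix x assume "x \<in> carrier R"
    then show "\<exists>y\<in>carrier R. y \<oplus>\<^bsub>R\<^esub> x = \<zero>\<^bsub>R\<^esub>"
      by (intro bexI[of _ "- x"]) (auto intro: OK_minus)
  qed (auto intro: OK_add)
  show "comm_monoid R"
    by (rule comm_monoidI) (auto intro: OK_mult)
qed (auto simp: algebra_simps)

interpretation R: cring R by (rule cring_R)

lemma R_a_inv [simp]: "x \<in> OK \<Longrightarrow> \<ominus>\<^bsub>R\<^esub> x = - x"
  by (rule R.minus_equality) (auto intro: OK_minus)

abbreviation idl :: "complex set \<Rightarrow> bool" where "idl I \<equiv> ideal I R"

abbreviation idl_prod :: "complex set \<Rightarrow> complex set \<Rightarrow> complex set" where "idl_prod \<equiv> ideal_prod R"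

lemma idlI:
  assumes "I \<subseteq> OK" "0 \<in> I" "\<And>x y. x \<in> I \<Longrightarrow> y \<in> I \<Longrightarrow> x + y \<in> I"
    "\<And>x r. x \<in> I \<Longrightarrow> r \<in> OK \<Longrightarrow> r * x \<in> I"
  shows "idl I"
proof (rule idealI)
  show "ring R" ..
  have "- x \<in> I" if "x \<in> I" for x
    using assms(4)[OF that, of "-1"] OK_minus[OF OK_1] by simp
  then show "subgroup I (add_monoid R)"
    using assms by (intro R.add.subgroupI) (auto simp flip: a_inv_def)
qed (use assms in \<open>auto simp: mult.commute\<close>)

lemma idl_subset: "idl I \<Longrightarrow> I \<subseteq> OK"
  using additive_subgroup.a_subset[OF ideal.axioms(1)] by fastforce

lemma idl_OK_mem: "idl I \<Longrightarrow> x \<in> I \<Longrightarrow> x \<in> OK"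
  using idl_subset by blast

lemma idl_0: "idl I \<Longrightarrow> 0 \<in> I"
  using additive_subgroup.zero_closed[OF ideal.axioms(1)] by fastforce

lemma idl_add: "idl I \<Longrightarrow> x \<in> I \<Longrightarrow> y \<in> I \<Longrightarrow> x + y \<in> I"
  using additive_subgroup.a_closed[OF ideal.axioms(1)] by fastforce

lemma idl_mult: "idl I \<Longrightarrow> x \<in> I \<Longrightarrow> r \<in> OK \<Longrightarrow> r * x \<in> I"
  using ideal.I_l_closed by fastforce

lemma idl_mult2: "idl I \<Longrightarrow> x \<in> I \<Longrightarrow> r \<in> OK \<Longrightarrow> x * r \<in> I"
  using idl_mult[of I x r] by (simp add: mult.commute)

lemma idl_minus: "idl I \<Longrightarrow> x \<in> I \<Longrightarrow> - x \<in> I"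
  using idl_mult[of I x "-1"] OK_minus[OF OK_1] by simp

lemma idl_diff: "idl I \<Longrightarrow> x \<in> I \<Longrightarrow> y \<in> I \<Longrightarrow> x - y \<in> I"
  using idl_add[OF _ _ idl_minus] by fastforce

lemma idl_eq_OK: "idl I \<Longrightarrow> 1 \<in> I \<Longrightarrow> I = OK"
  using idl_subset idl_mult[of I 1] by fastforce

lemma idl_OK [simp]: "idl OK"
  using R.oneideal by simp

lemma idl_prod_mem: "x \<in> I \<Longrightarrow> y \<in> J \<Longrightarrow> x * y \<in> idl_prod I J"
  using ideal_prod.prod[of x I y J R] by simp

lemma idl_prod_least:
  assumes "idl L" "\<And>x y. x \<in> I \<Longrightarrow> y \<in> J \<Longrightarrow> x * y \<in> L"
  shows "idl_prod I J \<subseteq> L"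
proof
  fix s assume "s \<in> idl_prod I J"
  then show "s \<in> L"
    by (induction rule: ideal_prod.induct) (use assms idl_add in auto)
qed

lemma idl_prod_idl [simp]: "idl I \<Longrightarrow> idl J \<Longrightarrow> idl (idl_prod I J)"
  by (rule R.ideal_prod_is_ideal)

lemma idl_prod_commute: "idl I \<Longrightarrow> idl J \<Longrightarrow> idl_prod I J = idl_prod J I"
  by (rule R.ideal_prod_commute)

lemma idl_prod_assoc: "idl I \<Longrightarrow> idl J \<Longrightarrow> idl L \<Longrightarrow> idl_prod (idl_prod I J) L = idl_prod I (idl_prod J L)"
  by (rule R.ideal_prod_assoc)

lemma idl_prod_left_commute:
  "idl I \<Longrightarrow> idl J \<Longrightarrow> idl L \<Longrightarrow> idl_prod I (idl_prod J L) = idl_prod J (idl_prod I L)"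
  by (metis idl_prod_assoc idl_prod_commute)

lemma idl_prod_OK: "idl I \<Longrightarrow> idl_prod I OK = I" and idl_prod_OK_left: "idl I \<Longrightarrow> idl_prod OK I = I"
  using R.ideal_prod_one[of I] idl_prod_commute[of I OK] by auto

lemma idl_prod_subset: "idl I \<Longrightarrow> idl J \<Longrightarrow> idl_prod I J \<subseteq> I" "idl I \<Longrightarrow> idl J \<Longrightarrow> idl_prod I J \<subseteq> J"
  using R.ideal_prod_inter by blast+

lemma idl_prod_mono: "I \<subseteq> I' \<Longrightarrow> J \<subseteq> J' \<Longrightarrow> idl I' \<Longrightarrow> idl J' \<Longrightarrow> idl_prod I J \<subseteq> idl_prod I' J'"
  by (rule idl_prod_least) (auto intro: idl_prod_mem)

definition principal :: "complex \<Rightarrow> complex set" where "principal x = (\<lambda>r. r * x) ` OK"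

lemma PIdl_eq_principal: "PIdl\<^bsub>R\<^esub> x = principal x"
  by (auto simp: cgenideal_def principal_def)

lemma principal_self [simp]: "x \<in> principal x"
  unfolding principal_def by (rule image_eqI[of _ _ 1]) auto

lemma idl_principal [simp]: "x \<in> OK \<Longrightarrow> idl (principal x)"
  using R.cgenideal_ideal[of x] by (simp add: PIdl_eq_principal)

lemma principal_subset_iff: "idl I \<Longrightarrow> x \<in> OK \<Longrightarrow> principal x \<subseteq> I \<longleftrightarrow> x \<in> I"
  using principal_self[of x] by (auto simp: principal_def intro: idl_mult)

lemma principal_1 [simp]: "principal 1 = OK" by (simp add: principal_def)

lemma principal_eq_zero_iff: "principal x = {0} \<longleftrightarrow> x = 0"
proof
  assume "principal x = {0}"
  then show "x = 0" using principal_self[of x] by simp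
next
  assume "x = 0"
  then show "principal x = {0}" using OK_1 by (auto simp: principal_def simp del: OK_1)
qed

lemma idl_prod_principal:
  assumes "idl I" "x \<in> OK"
  shows "idl_prod (principal x) I = (\<lambda>z. x * z) ` I"
proof
  have "idl ((\<lambda>z. x * z) ` I)"
  proof (rule idlI)
    show "(*) x ` I \<subseteq> OK" using assms by (auto intro: OK_mult idl_OK_mem)
    show "0 \<in> (*) x ` I" using idl_0[OF assms(1)] by force
    fix u assume "u \<in> (*) x ` I"
    then obtain a where a: "a \<in> I" "u = x * a" by auto
    {
      fix v assume "v \<in> (*) x ` I"
      then obtain b where "b \<in> I" "v = x * b" by auto
      then show "u + v \<in> (*) x ` I" using a idl_add[OF assms(1)]
        by (auto simp flip: distrib_left)
    }
    fix r assume "r \<in> OK"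
    then have "r * u = x * (r * a)" "r * a \<in> I" using a idl_mult[OF assms(1)] by auto
    then show "r * u \<in> (*) x ` I" by blast
  qed
  then show "idl_prod (principal x) I \<subseteq> (\<lambda>z. x * z) ` I"
  proof (rule idl_prod_least)
    fix a b assume "a \<in> principal x" "b \<in> I"
    then obtain r where "r \<in> OK" "a * b = x * (r * b)" by (auto simp: principal_def)
    then show "a * b \<in> (*) x ` I" using idl_mult[OF assms(1) \<open>b \<in> I\<close>] by auto
  qed
  show "(\<lambda>z. x * z) ` I \<subseteq> idl_prod (principal x) I"
    using idl_prod_mem[OF principal_self] by auto
qed

lemma idl_prod_principal_principal: "x \<in> OK \<Longrightarrow> y \<in> OK \<Longrightarrow> idl_prod (principal x) (principal y) = principal (x * y)"
  by (simp add: idl_prod_principal) (auto simp: principal_def image_image mult_ac)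

lemma idl_prod_principal_cancel:
  assumes "idl I" "idl J" "x \<in> OK" "x \<noteq> 0" "idl_prod (principal x) I = idl_prod (principal x) J"
  shows "I = J"
proof -
  have "inj ((*) x)" using assms(4) by (auto simp: inj_on_def)
  then show ?thesis using assms by (simp add: idl_prod_principal inj_image_eq_iff)
qed

lemma idl_cnj [simp]:
  assumes "idl I"
  shows "idl (cnj ` I)"
proof (rule idlI)
  show "cnj ` I \<subseteq> OK" using assms by (auto intro: OK_cnj idl_OK_mem)
  show "0 \<in> cnj ` I" using idl_0[OF assms] by force
  fix u assume "u \<in> cnj ` I"
  then obtain a where a: "a \<in> I" "u = cnj a" by auto
  {
    fix v assume "v \<in> cnj ` I"
    then obtain b where "b \<in> I" "v = cnj b" by auto
    then show "u + v \<in> cnj ` I" using a idl_add[OF assms]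
      by (auto simp flip: complex_cnj_add)
  }
  fix r assume "r \<in> OK"
  then have "r * u = cnj (cnj r * a)" "cnj r * a \<in> I" using a idl_mult[OF assms] OK_cnj by auto
  then show "r * u \<in> cnj ` I" by blast
qed

lemma cnj_idl_prod:
  assumes "idl I" "idl J"
  shows "cnj ` idl_prod I J = idl_prod (cnj ` I) (cnj ` J)"
proof
  have *: "cnj ` idl_prod I J \<subseteq> idl_prod (cnj ` I) (cnj ` J)" if "idl I" "idl J" for I J
  proof -
    have "idl_prod I J \<subseteq> cnj ` idl_prod (cnj ` I) (cnj ` J)"
    proof (rule idl_prod_least)
      fix x y assume "x \<in> I" "y \<in> J"
      then have "cnj x * cnj y \<in> idl_prod (cnj ` I) (cnj ` J)" by (intro idl_prod_mem) auto
      then show "x * y \<in> cnj ` idl_prod (cnj ` I) (cnj ` J)"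
        by (intro image_eqI[of _ _ "cnj x * cnj y"]) auto
    qed (use that in simp)
    then have "cnj ` idl_prod I J \<subseteq> cnj ` cnj ` idl_prod (cnj ` I) (cnj ` J)" by blast
    then show ?thesis by (simp add: image_image)
  qed
  show "cnj ` idl_prod I J \<subseteq> idl_prod (cnj ` I) (cnj ` J)" using *[OF assms] .
  have "cnj ` idl_prod (cnj ` I) (cnj ` J) \<subseteq> idl_prod I J"
    using *[of "cnj ` I" "cnj ` J"] assms by (simp add: image_image)
  then have "cnj ` cnj ` idl_prod (cnj ` I) (cnj ` J) \<subseteq> cnj ` idl_prod I J" by blast
  then show "idl_prod (cnj ` I) (cnj ` J) \<subseteq> cnj ` idl_prod I J" by (simp add: image_image)
qed

lemma cnj_principal: "cnj ` principal x = principal (cnj x)"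
proof -
  have *: "cnj ` principal x \<subseteq> principal (cnj x)" for x
    by (auto simp: principal_def intro: OK_cnj)
  have "cnj ` cnj ` principal (cnj x) \<subseteq> cnj ` principal x" using *[of "cnj x"] by (intro image_mono) simp
  then show ?thesis using *[of x] by (auto simp: image_image)
qed

section \<open>Conjugate ideals, cancellation and divisibility\<close>

lemma int_ideal_generator:
  fixes S :: "int set"
  assumes "k0 \<in> S" "k0 \<noteq> 0" and diff: "\<And>x y. x \<in> S \<Longrightarrow> y \<in> S \<Longrightarrow> x - y \<in> S"
    and mult: "\<And>x c. x \<in> S \<Longrightarrow> c * x \<in> S"
  obtains n :: nat where "n > 0" "int n \<in> S" "\<And>k. k \<in> S \<Longrightarrow> int n dvd k"
proof -
  define P where "P = (\<lambda>n::nat. n > 0 \<and> int n \<in> S)"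
  have "P (nat \<bar>k0\<bar>)"
    using assms(1,2) mult[of k0 "-1"] by (auto simp: P_def abs_if)
  then have n: "P (Least P)" by (rule LeastI)
  show ?thesis
  proof
    show "Least P > 0" "int (Least P) \<in> S" using n by (auto simp: P_def)
    fix k assume k: "k \<in> S"
    define r where "r = k mod int (Least P)"
    have "r = k - k div int (Least P) * int (Least P)" by (simp add: r_def minus_div_mult_eq_mod)
    then have "r \<in> S" using k diff mult \<open>int (Least P) \<in> S\<close> by simp
    moreover have "0 \<le> r" "r < int (Least P)" using \<open>Least P > 0\<close> by (auto simp: r_def)
    ultimately have "r = 0" using not_less_Least[of "nat r" P] by (force simp: P_def)
    then show "int (Least P) dvd k" by (simp add: r_def dvd_eq_mod_eq_0)
  qed
qed

text \<open>For \<open>n\<close> generating the rational integers of \<open>I * cnj I\<close>, the quotient \<open>x * cnj y / n\<close> has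
  integral trace and norm for all \<open>x, y\<close> in \<open>I\<close>.\<close>

lemma idl_prod_cnj_principal:
  assumes I: "idl I"
  shows "\<exists>n::nat. idl_prod I (cnj ` I) = principal (of_nat n) \<and> (n = 0 \<longleftrightarrow> I = {0})"
proof (cases "I = {0}")
  case True
  have "idl_prod {0} {0} = {0}"
    using R.ideal_prod_zero[of "{0}"] I True by simp
  then show ?thesis using True principal_eq_zero_iff by (intro exI[of _ 0]) auto
next
  case False
  then obtain x0 where x0: "x0 \<in> I" "x0 \<noteq> 0" using idl_0[OF I] by blast
  define S where "S = {k::int. of_int k \<in> idl_prod I (cnj ` I)}"
  have norm_mem: "int (abs_norm x) \<in> S" if "x \<in> I" for x
    using of_nat_abs_norm[OF idl_OK_mem[OF I that]] idl_prod_mem[of x I "cnj x" "cnj ` I"] that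
    by (auto simp: S_def)
  have idl: "idl (idl_prod I (cnj ` I))" using I by simp
  obtain n where n: "n > 0" "int n \<in> S" "\<And>k. k \<in> S \<Longrightarrow> int n dvd k"
  proof (rule int_ideal_generator[of "int (abs_norm x0)" S])
    show "int (abs_norm x0) \<in> S" "int (abs_norm x0) \<noteq> 0"
      using norm_mem[OF x0(1)] abs_norm_0_iff idl_OK_mem[OF I x0(1)] x0(2) by auto
    show "x - y \<in> S" if "x \<in> S" "y \<in> S" for x y
      using that idl_diff[OF idl] by (auto simp: S_def)
    show "c * x \<in> S" if "x \<in> S" for x c
      using that idl_mult[OF idl, of "of_int x" "of_int c"] by (auto simp: S_def)
  qed blast
  have "idl_prod I (cnj ` I) \<subseteq> principal (of_nat n)"
  proof (rule idl_prod_least)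
    fix x y' assume "x \<in> I" "y' \<in> cnj ` I"
    then obtain y where xy: "x \<in> I" "y \<in> I" "y' = cnj y" by auto
    have OK: "x \<in> OK" "y \<in> OK" using xy idl_OK_mem[OF I] by auto
    define g where "g = x * cnj y / of_nat n"
    have "x * cnj y \<in> OK" using OK by (auto intro: OK_mult OK_cnj)
    then obtain t where t: "x * cnj y + cnj (x * cnj y) = of_int t"
      by (auto simp: OK_iff elim: Ints_cases)
    \<comment> \<open>The trace of x * cnj y is a rational integer lying in the product ideal, so
      \<open>n\<close> divides it and \<open>g\<close> has integral trace.\<close>
    have "x * cnj y + y * cnj x \<in> idl_prod I (cnj ` I)"
      using xy by (intro idl_add[OF idl] idl_prod_mem) auto
    then have "t \<in> S" using t by (simp add: S_def mult.commute)
    then obtain u where u: "t = int n * u" using n(3) by blast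
    obtain c where c: "int (abs_norm x) = int n * c" using n(3) norm_mem xy by blast
    obtain d where d: "int (abs_norm y) = int n * d" using n(3) norm_mem xy by blast
    have "g + cnj g = of_int t / of_nat n"
      by (simp add: g_def t[symmetric] add_divide_distrib)
    then have "g + cnj g \<in> \<int>" using n(1) by (simp add: u)
    \<comment> \<open>The norm of \<open>g\<close> is the product of N(x) / n and N(y) / n, both
      integers because N(x) = x * cnj x and N(y) = y * cnj y lie in the product ideal.\<close>
    moreover have "g * cnj g = (x * cnj x) * (y * cnj y) / (of_nat n * of_nat n)"
      by (simp add: g_def)
    then have "g * cnj g = of_int (int (abs_norm x)) * of_int (int (abs_norm y)) / (of_nat n * of_nat n)"
      using of_nat_abs_norm[OF OK(1)] of_nat_abs_norm[OF OK(2)] by simp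
    then have "g * cnj g = of_int (c * d)"
      using n(1) by (simp only: c d) simp
    then have "g * cnj g \<in> \<int>" by (metis Ints_of_int)
    moreover have "g \<in> K"
      using OK OK_subset_K by (auto simp: g_def intro!: K_divide K_mult K_cnj)
    ultimately have "g \<in> OK" by (simp add: OK_iff)
    then show "x * y' \<in> principal (of_nat n)"
      unfolding principal_def using n(1) by (intro image_eqI[of _ _ g]) (auto simp: g_def xy)
  qed simp
  moreover have "principal (of_nat n) \<subseteq> idl_prod I (cnj ` I)"
    using n(2) idl by (subst principal_subset_iff) (auto simp: S_def)
  ultimately show ?thesis using False n(1) by (intro exI[of _ n]) auto
qed

lemma abs_norm_of_nat: "abs_norm (of_nat n) = n\<^sup>2"
proof -
  have "real (abs_norm (of_nat n)) = real (n\<^sup>2)" by (simp add: real_abs_norm)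
  then show ?thesis by linarith
qed

lemma principal_eq_imp_abs_norm_eq:
  assumes "x \<in> OK" "y \<in> OK" "principal x = principal y"
  shows "abs_norm x = abs_norm y"
proof -
  have "x \<in> principal y" "y \<in> principal x" using principal_self[of x] principal_self[of y] assms(3) by simp_all
  then obtain r s where rs: "r \<in> OK" "x = r * y" "s \<in> OK" "y = s * x"
    unfolding principal_def by blast
  have "abs_norm x = abs_norm r * abs_norm y" using abs_norm_mult[OF rs(1) assms(2)] rs(2) by simp
  moreover have "abs_norm y = abs_norm s * abs_norm x" using abs_norm_mult[OF rs(3) assms(1)] rs(4) by simp
  ultimately show ?thesis by (metis dvd_antisym dvd_triv_right)
qed

text \<open>For prime ideals this is the absolute norm, see \<open>ideal_norm_eq_conj_norm\<close>.\<close>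

definition conj_norm :: "complex set \<Rightarrow> nat" where
  "conj_norm I = (THE n. idl_prod I (cnj ` I) = principal (of_nat n))"

text \<open>Natural numbers that generate the same ideal have equal norms, hence equal squares, so
  the \<open>THE\<close> is determined by any one generator.\<close>

lemma conj_norm_eqI: "idl_prod I (cnj ` I) = principal (of_nat n) \<Longrightarrow> conj_norm I = n"
  unfolding conj_norm_def
proof (rule the_equality)
  fix m assume "idl_prod I (cnj ` I) = principal (of_nat n)" "idl_prod I (cnj ` I) = principal (of_nat m)"
  then have "abs_norm (of_nat m) = abs_norm (of_nat n)" by (intro principal_eq_imp_abs_norm_eq) auto
  then show "m = n" by (simp add: abs_norm_of_nat)
qed

lemma idl_prod_cnj: "idl I \<Longrightarrow> idl_prod I (cnj ` I) = principal (of_nat (conj_norm I))"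
  using idl_prod_cnj_principal conj_norm_eqI by metis

lemma conj_norm_eq_0_iff: "idl I \<Longrightarrow> conj_norm I = 0 \<longleftrightarrow> I = {0}"
  using idl_prod_cnj_principal conj_norm_eqI by metis

lemma conj_norm_OK [simp]: "conj_norm OK = 1"
proof (rule conj_norm_eqI)
  have "cnj ` OK = OK" using cnj_principal[of 1] by simp
  then show "idl_prod OK (cnj ` OK) = principal (of_nat 1)" by (simp add: idl_prod_OK)
qed

lemma conj_norm_principal: "x \<in> OK \<Longrightarrow> conj_norm (principal x) = abs_norm x"
  by (rule conj_norm_eqI) (simp add: cnj_principal idl_prod_principal_principal OK_cnj of_nat_abs_norm)

lemma conj_norm_idl_prod:
  assumes "idl I" "idl J"
  shows "conj_norm (idl_prod I J) = conj_norm I * conj_norm J"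
proof (rule conj_norm_eqI)
  have "idl_prod (idl_prod I J) (cnj ` idl_prod I J) = idl_prod (idl_prod I (cnj ` I)) (idl_prod J (cnj ` J))"
    using assms by (simp add: cnj_idl_prod idl_prod_assoc idl_prod_left_commute[of J])
  then show "idl_prod (idl_prod I J) (cnj ` idl_prod I J) = principal (of_nat (conj_norm I * conj_norm J))"
    using assms by (simp add: idl_prod_cnj idl_prod_principal_principal)
qed

lemma conj_norm_mem: "idl I \<Longrightarrow> of_nat (conj_norm I) \<in> I"
  using idl_prod_cnj principal_self idl_prod_subset(1)[of I "cnj ` I"] by fastforce

lemma conj_norm_eq_1: "idl I \<Longrightarrow> conj_norm I = 1 \<Longrightarrow> I = OK"
  using conj_norm_mem idl_eq_OK by fastforce

text \<open>Multiplying by the conjugate of \<open>L\<close> replaces \<open>L\<close> by a nonzero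
  principal ideal, and multiplication by a nonzero number is injective.\<close>

lemma idl_prod_cancel:
  assumes "idl I" "idl J" "idl L" "L \<noteq> {0}" "idl_prod L I = idl_prod L J"
  shows "I = J"
proof (rule idl_prod_principal_cancel[of _ _ "of_nat (conj_norm L)"])
  have "idl_prod (principal (of_nat (conj_norm L))) Y = idl_prod (cnj ` L) (idl_prod L Y)" if "idl Y" for Y
    using assms(3) that by (metis idl_prod_cnj idl_prod_commute idl_prod_assoc idl_cnj)
  then show "idl_prod (principal (of_nat (conj_norm L))) I = idl_prod (principal (of_nat (conj_norm L))) J"
    using assms by simp
qed (use assms in \<open>auto simp: conj_norm_eq_0_iff\<close>)

text \<open>The cofactor is I * cnj J / n with \<open>n = conj_norm J\<close>; it consists of
  integers because I * cnj J is contained in J * cnj J, which is generated by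
  \<open>n\<close>.\<close>

lemma contains_imp_divides:
  assumes I: "idl I" and J: "idl J" "J \<noteq> {0}" and "I \<subseteq> J"
  obtains L where "idl L" "I = idl_prod J L"
proof
  define n where "n = conj_norm J"
  have n: "n > 0" using conj_norm_eq_0_iff[OF J(1)] J(2) by (simp add: n_def)
  define L where "L = {z \<in> OK. of_nat n * z \<in> idl_prod I (cnj ` J)}"
  have idl: "idl (idl_prod I (cnj ` J))" using assms by simp
  show L: "idl L"
  proof (rule idlI)
    fix x y assume "x \<in> L" "y \<in> L"
    then show "x + y \<in> L"
      using idl_add[OF idl, of "of_nat n * x" "of_nat n * y"]
      by (simp add: L_def distrib_left OK_add)
  next
    fix x r assume "x \<in> L" "r \<in> OK"
    then show "r * x \<in> L"
      using idl_mult[OF idl, of "of_nat n * x" r]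
      by (simp add: L_def mult.left_commute OK_mult)
  qed (use idl_0[OF idl] in \<open>auto simp: L_def\<close>)
  have "idl_prod I (cnj ` J) \<subseteq> idl_prod J (cnj ` J)" using assms by (intro idl_prod_mono) auto
  then have sub: "idl_prod I (cnj ` J) \<subseteq> principal (of_nat n)" using idl_prod_cnj[OF J(1)] by (simp add: n_def)
  have "idl_prod I (cnj ` J) = (\<lambda>z. of_nat n * z) ` L"
  proof
    show "idl_prod I (cnj ` J) \<subseteq> (\<lambda>z. of_nat n * z) ` L"
    proof
      fix u assume u: "u \<in> idl_prod I (cnj ` J)"
      then obtain r where "r \<in> OK" "u = of_nat n * r"
        using sub unfolding principal_def by (metis (no_types) imageE mult.commute subsetD)
      then show "u \<in> (\<lambda>z. of_nat n * z) ` L" using u by (auto simp: L_def)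
    qed
  qed (use L_def in blast)
  then have "idl_prod I (cnj ` J) = idl_prod (principal (of_nat n)) L" using L by (simp add: idl_prod_principal)
  then have "idl_prod (principal (of_nat n)) (idl_prod J L) = idl_prod J (idl_prod I (cnj ` J))"
    using idl_prod_left_commute[of "principal (of_nat n)" J L] J(1) L by simp
  also have "\<dots> = idl_prod I (idl_prod J (cnj ` J))"
    using I J(1) by (intro idl_prod_left_commute) auto
  also have "\<dots> = idl_prod (principal (of_nat n)) I"
    unfolding idl_prod_cnj[OF J(1)] n_def using I by (intro idl_prod_commute) auto
  finally show "I = idl_prod J L"
    using n I J(1) L by (intro idl_prod_principal_cancel[of I "idl_prod J L" "of_nat n"]) auto
qed

text \<open>The cofactor of \<open>I\<close> over \<open>J\<close> is a proper ideal, so its norm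
  exceeds 1. This makes \<open>conj_norm\<close> a well-founded measure for ascending chains of
  ideals.\<close>

lemma conj_norm_less:
  assumes "idl I" "idl J" "I \<subset> J" "I \<noteq> {0}"
  shows "conj_norm J < conj_norm I"
proof -
  have "J \<noteq> {0}" using assms idl_0 by blast
  then obtain L where L: "idl L" "I = idl_prod J L"
    using contains_imp_divides[of I J] assms by blast
  have "L \<noteq> OK" using idl_prod_OK[OF assms(2)] L(2) assms(3) by blast
  then have "conj_norm L \<noteq> 1" using conj_norm_eq_1[OF L(1)] by blast
  moreover have eq: "conj_norm I = conj_norm J * conj_norm L" unfolding L(2) by (rule conj_norm_idl_prod[OF assms(2) L(1)])
  moreover have "conj_norm I \<noteq> 0" using conj_norm_eq_0_iff assms by blast
  ultimately have "conj_norm J * 1 < conj_norm J * conj_norm L" by (intro mult_strict_left_mono) auto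
  then show ?thesis using eq by simp
qed


section \<open>Prime ideals and valuations\<close>

abbreviation place :: "complex set \<Rightarrow> bool" where "place P \<equiv> P \<in> finite_places K"

lemma place_idl: "place P \<Longrightarrow> idl P"
  by (simp add: finite_places_def primeideal.axioms(1))

lemma place_nonzero: "place P \<Longrightarrow> P \<noteq> {0}"
  by (simp add: finite_places_def)

lemma place_neq_OK: "place P \<Longrightarrow> P \<noteq> OK"
  using primeideal.I_notcarr[of P R] by (auto simp: finite_places_def)

lemma place_not_1: "place P \<Longrightarrow> 1 \<notin> P"
  using idl_eq_OK place_idl place_neq_OK by blast

lemma place_cases: "place P \<Longrightarrow> x \<in> OK \<Longrightarrow> y \<in> OK \<Longrightarrow> x * y \<in> P \<Longrightarrow> x \<in> P \<or> y \<in> P"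
  using primeideal.I_prime[of P R x y] by (auto simp: finite_places_def)

lemma placeI:
  assumes "idl P" "P \<noteq> {0}" "P \<noteq> OK"
    "\<And>x y. x \<in> OK \<Longrightarrow> y \<in> OK \<Longrightarrow> x * y \<in> P \<Longrightarrow> x \<in> P \<or> y \<in> P"
  shows "place P"
proof -
  have "primeideal P R"
    by (rule primeidealI) (use assms cring_R in auto)
  then show ?thesis using assms(2) by (simp add: finite_places_def)
qed

lemma place_power_mem: "place P \<Longrightarrow> x \<in> OK \<Longrightarrow> x ^ n \<in> P \<Longrightarrow> x \<in> P"
  by (induction n) (auto simp: place_not_1 dest: place_cases intro: OK_power)

lemma place_contains_idl_prod:
  assumes P: "place P" and IJ: "idl I" "idl J" and "idl_prod I J \<subseteq> P"
  shows "I \<subseteq> P \<or> J \<subseteq> P"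
proof (rule ccontr)
  assume "\<not> ?thesis"
  then obtain x y where "x \<in> I" "x \<notin> P" "y \<in> J" "y \<notin> P" by blast
  moreover from this have "x * y \<in> P" using idl_prod_mem assms(4) by blast
  ultimately show False using place_cases[OF P] IJ idl_OK_mem by metis
qed

lemma place_contains_idl_prod_iff:
  assumes P: "place P" and IJ: "idl I" "idl J"
  shows "idl_prod I J \<subseteq> P \<longleftrightarrow> I \<subseteq> P \<or> J \<subseteq> P"
  using place_contains_idl_prod[OF assms] idl_prod_subset[OF IJ] by blast

lemma idl_prod_nonzero:
  assumes "idl I" "idl J" "I \<noteq> {0}" "J \<noteq> {0}"
  shows "idl_prod I J \<noteq> {0}"
  using conj_norm_idl_prod[OF assms(1,2)] conj_norm_eq_0_iff assms idl_prod_idl by (metis mult_is_0)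

text \<open>Write \<open>P\<close> as the product of \<open>J\<close> and \<open>L\<close>. If
  \<open>J\<close> is not inside \<open>P\<close>, then \<open>L\<close> is, so L = P, and
  cancelling \<open>P\<close> leaves J = OK.\<close>

lemma place_maximal:
  assumes P: "place P" and J: "idl J" "P \<subseteq> J"
  shows "J = P \<or> J = OK"
proof -
  have nz: "J \<noteq> {0}" using place_nonzero[OF P] idl_0[OF place_idl[OF P]] J(2) by blast
  obtain L where L: "idl L" "P = idl_prod J L"
    by (rule contains_imp_divides[OF place_idl[OF P] J(1) nz J(2)])
  then have "J \<subseteq> P \<or> L \<subseteq> P" using place_contains_idl_prod[OF P J(1) L(1)] by blast
  then show ?thesis
  proof
    assume "L \<subseteq> P"
    moreover have "P \<subseteq> L" using L idl_prod_subset[OF J(1) L(1)] by blast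
    ultimately have "L = P" by blast
    then have "idl_prod P J = idl_prod P OK"
      using L idl_prod_commute[OF J(1) L(1)] idl_prod_OK[OF L(1)] by metis
    then have "J = OK" using idl_prod_cancel[OF J(1) idl_OK place_idl[OF P] place_nonzero[OF P]] by blast
    then show ?thesis ..
  qed (use J in blast)
qed

lemma place_subset_imp_eq: "place P \<Longrightarrow> place Q \<Longrightarrow> P \<subseteq> Q \<Longrightarrow> P = Q"
  using place_maximal place_idl place_neq_OK by metis

text \<open>Among the proper ideals containing \<open>I\<close>, one of least
  \<open>conj_norm\<close> is maximal by \<open>conj_norm_less\<close>, and maximal ideals are
  prime.\<close>

lemma exists_place_containing:
  assumes I: "idl I" "I \<noteq> {0}" "I \<noteq> OK"
  obtains P where "place P" "I \<subseteq> P"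
proof -
  define Q where "Q = (\<lambda>J. idl J \<and> I \<subseteq> J \<and> J \<noteq> OK)"
  have "Q I" using I by (simp add: Q_def)
  from ex_has_least_nat[of Q I conj_norm, OF this]
  obtain P where P: "Q P" and least: "\<And>J. Q J \<Longrightarrow> conj_norm P \<le> conj_norm J" by blast
  have idP: "idl P" and IP: "I \<subseteq> P" and neOK: "P \<noteq> OK" using P by (auto simp: Q_def)
  have nz: "P \<noteq> {0}" using IP I idl_0[OF I(1)] by blast
  have "place P"
  proof (rule placeI[OF idP nz neOK])
    fix x y assume xy: "x \<in> OK" "y \<in> OK" "x * y \<in> P"
    show "x \<in> P \<or> y \<in> P"
    proof (rule disjCI)
      assume "y \<notin> P"
      \<comment> \<open>The ideal generated by \<open>P\<close> and \<open>y\<close>: being strictly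
        larger than \<open>P\<close> it must be \<open>OK\<close>, and the resulting expression for
        1, multiplied by \<open>x\<close>, puts \<open>x\<close> into \<open>P\<close>.\<close>
      define J where "J = {p + r * y | p r. p \<in> P \<and> r \<in> OK}"
      have J: "idl J"
      proof (rule idlI)
        show "J \<subseteq> OK" using xy idl_OK_mem[OF idP] by (auto simp: J_def intro!: OK_add OK_mult)
        show "0 \<in> J" using idl_0[OF idP] by (force simp: J_def)
      next
        fix u v assume "u \<in> J" "v \<in> J"
        then obtain p r p' r' where "p \<in> P" "r \<in> OK" "u = p + r * y" "p' \<in> P" "r' \<in> OK" "v = p' + r' * y"
          by (auto simp: J_def)
        then have "u + v = (p + p') + (r + r') * y" "p + p' \<in> P" "r + r' \<in> OK"
          using idl_add[OF idP] OK_add by (auto simp: algebra_simps)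
        then show "u + v \<in> J" unfolding J_def by blast
      next
        fix u s assume "u \<in> J" "s \<in> OK"
        then obtain p r where "p \<in> P" "r \<in> OK" "u = p + r * y"
          by (auto simp: J_def)
        then have "s * u = s * p + (s * r) * y" "s * p \<in> P" "s * r \<in> OK"
          using idl_mult[OF idP] OK_mult \<open>s \<in> OK\<close> by (auto simp: algebra_simps)
        then show "s * u \<in> J" unfolding J_def by blast
      qed
      have sub: "P \<subseteq> J" by (force simp: J_def)
      moreover have "y \<in> J" using idl_0[OF idP] by (force simp: J_def)
      ultimately have "P \<subset> J" using \<open>y \<notin> P\<close> by blast
      then have "conj_norm J < conj_norm P" using conj_norm_less[OF idP J _ nz] by blast
      then have "\<not> Q J" using least[of J] by auto
      then have "J = OK" using J sub IP by (auto simp: Q_def)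
      then obtain p r where pr: "p \<in> P" "r \<in> OK" "1 = p + r * y"
        using OK_1 unfolding J_def by (smt (verit) mem_Collect_eq)
      have "x * p + r * (x * y) = x * (p + r * y)" by (simp add: algebra_simps)
      also have "\<dots> = x" using pr(3) by simp
      finally have "x = x * p + r * (x * y)" by simp
      moreover have "x * p + r * (x * y) \<in> P"
        using idl_add[OF idP idl_mult[OF idP pr(1) xy(1)] idl_mult[OF idP xy(3) pr(2)]] .
      ultimately show "x \<in> P" by simp
    qed
  qed
  then show ?thesis using IP that by blast
qed

section \<open>Powers of a place, exponents and unique factorization\<close>

definition idl_pow :: "complex set \<Rightarrow> nat \<Rightarrow> complex set" where
  "idl_pow P n = P [^]\<^bsub>ideals_set R\<^esub> n"

lemma idl_pow_0 [simp]: "idl_pow P 0 = OK"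
  by (simp add: idl_pow_def nat_pow_def ideals_set_def)

lemma idl_pow_Suc: "idl_pow P (Suc n) = idl_prod (idl_pow P n) P"
  by (simp add: idl_pow_def nat_pow_def ideals_set_def)

lemma idl_pow_idl [simp]: "idl P \<Longrightarrow> idl (idl_pow P n)"
  by (induction n) (auto simp: idl_pow_Suc)

lemma idl_pow_1: "idl P \<Longrightarrow> idl_pow P (Suc 0) = P"
  by (simp add: idl_pow_Suc idl_prod_OK_left)

lemma idl_pow_add: "idl P \<Longrightarrow> idl_pow P (m + n) = idl_prod (idl_pow P m) (idl_pow P n)"
  by (induction n) (simp_all add: idl_pow_Suc idl_prod_OK idl_prod_assoc)

lemma idl_pow_nonzero: "idl P \<Longrightarrow> P \<noteq> {0} \<Longrightarrow> idl_pow P n \<noteq> {0}"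
proof (induction n)
  case 0
  have "OK \<noteq> {0}" using OK_1 one_neq_zero by blast
  then show ?case by simp
qed (auto simp: idl_pow_Suc idl_prod_nonzero)

lemma idl_pow_antimono:
  assumes "idl P" "m \<le> n"
  shows "idl_pow P n \<subseteq> idl_pow P m"
  using idl_prod_subset(1)[of "idl_pow P m" "idl_pow P (n - m)"] idl_pow_add[OF assms(1), of m "n - m"] assms by simp

lemma place_conj_norm_gt_1: "place P \<Longrightarrow> conj_norm P > 1"
  using conj_norm_eq_0_iff[OF place_idl, of P] conj_norm_eq_1[OF place_idl, of P] place_nonzero[of P] place_neq_OK[of P]
  by fastforce

text \<open>To contain is to divide, so exponents are read off from inclusions (junk for \<open>I = {0}\<close>).\<close>

definition idl_val :: "complex set \<Rightarrow> complex set \<Rightarrow> nat" where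
  "idl_val P I = (GREATEST n. I \<subseteq> idl_pow P n)"

text \<open>Factors \<open>P\<close> are split off as long as \<open>P\<close> contains what is
  left; each of them divides \<open>conj_norm\<close> by a number greater than 1, so the process
  stops.\<close>

lemma prime_power_decomposition:
  assumes P: "place P" and "idl I" "I \<noteq> {0}"
  shows "\<exists>n L. idl L \<and> I = idl_prod (idl_pow P n) L \<and> \<not> L \<subseteq> P"
  using assms(2,3)
proof (induction "conj_norm I" arbitrary: I rule: less_induct)
  case less
  show ?case
  proof (cases "I \<subseteq> P")
    case False
    then show ?thesis using less.prems by (intro exI[of _ 0] exI[of _ I]) (auto simp: idl_prod_OK_left)
  next
    case True
    obtain L where L: "idl L" "I = idl_prod P L"
      by (rule contains_imp_divides[OF less.prems(1) place_idl[OF P] place_nonzero[OF P] True])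
    have Lnz: "L \<noteq> {0}"
    proof
      assume "L = {0}"
      then have "conj_norm I = 0" using conj_norm_idl_prod[OF place_idl[OF P] L(1)] L conj_norm_eq_0_iff[OF L(1)] by simp
      then show False using conj_norm_eq_0_iff less.prems by blast
    qed
    have "conj_norm I = conj_norm P * conj_norm L" unfolding L(2) by (rule conj_norm_idl_prod[OF place_idl[OF P] L(1)])
    moreover have "conj_norm L > 0" using Lnz conj_norm_eq_0_iff[OF L(1)] by blast
    ultimately have "conj_norm L < conj_norm I" using place_conj_norm_gt_1[OF P] by simp
    then obtain n L' where n: "idl L'" "L = idl_prod (idl_pow P n) L'" "\<not> L' \<subseteq> P"
      using less.hyps[OF _ L(1) Lnz] by blast
    have "I = idl_prod (idl_pow P (Suc n)) L'"
      unfolding L(2) n(2) idl_pow_Suc using n(1) place_idl[OF P] by (metis idl_prod_assoc idl_prod_commute idl_pow_idl)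
    then show ?thesis using n by blast
  qed
qed

text \<open>If the product were inside the power n + 1 of \<open>P\<close>, that power would divide
  it; cancelling the n-th power would make \<open>L\<close> a multiple of \<open>P\<close>. So
  inclusions alone determine the exponent of a decomposition.\<close>

lemma subset_idl_pow_iff:
  assumes P: "place P" and L: "idl L" "\<not> L \<subseteq> P"
  shows "idl_prod (idl_pow P n) L \<subseteq> idl_pow P k \<longleftrightarrow> k \<le> n"
proof
  have idP: "idl P" by (rule place_idl[OF P])
  show "idl_prod (idl_pow P n) L \<subseteq> idl_pow P k" if "k \<le> n"
    using idl_prod_subset(1)[of "idl_pow P n" L] idl_pow_antimono[OF idP that] L idP by auto
  show "k \<le> n" if "idl_prod (idl_pow P n) L \<subseteq> idl_pow P k"
  proof (rule ccontr)
    assume "\<not> k \<le> n"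
    then have "idl_pow P k \<subseteq> idl_pow P (Suc n)" by (intro idl_pow_antimono[OF idP]) simp
    then have sub: "idl_prod (idl_pow P n) L \<subseteq> idl_pow P (Suc n)" using that by blast
    obtain L' where L': "idl L'" "idl_prod (idl_pow P n) L = idl_prod (idl_pow P (Suc n)) L'"
      by (rule contains_imp_divides[OF _ _ _ sub])
        (use L idP idl_pow_nonzero[OF idP place_nonzero[OF P]] in auto)
    then have "idl_prod (idl_pow P n) L = idl_prod (idl_pow P n) (idl_prod P L')"
      using idP by (simp add: idl_pow_Suc idl_prod_assoc)
    then have "L = idl_prod P L'"
      using idl_prod_cancel[of L "idl_prod P L'" "idl_pow P n"] L L' idP idl_pow_nonzero[OF idP place_nonzero[OF P]]
      by simp
    then have "L \<subseteq> P" using idl_prod_subset(1)[OF idP L'(1)] by blast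
    then show False using L by blast
  qed
qed

lemma idl_val_idl_prod_idl_pow:
  assumes "place P" "idl L" "\<not> L \<subseteq> P"
  shows "idl_val P (idl_prod (idl_pow P n) L) = n"
  unfolding idl_val_def by (rule Greatest_equality) (use subset_idl_pow_iff[OF assms] in auto)

lemma le_idl_val_iff:
  assumes "place P" "idl I" "I \<noteq> {0}"
  shows "k \<le> idl_val P I \<longleftrightarrow> I \<subseteq> idl_pow P k"
proof -
  obtain n L where L: "idl L" "I = idl_prod (idl_pow P n) L" "\<not> L \<subseteq> P"
    using prime_power_decomposition[OF assms] by blast
  show ?thesis unfolding L(2) idl_val_idl_prod_idl_pow[OF assms(1) L(1,3)] subset_idl_pow_iff[OF assms(1) L(1,3)] ..
qed

text \<open>Primeness enters here: the cofactors of the two ideals that are not inside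
  \<open>P\<close> have a product that is again not inside \<open>P\<close>.\<close>

lemma idl_val_idl_prod:
  assumes P: "place P" and I: "idl I" "I \<noteq> {0}" and J: "idl J" "J \<noteq> {0}"
  shows "idl_val P (idl_prod I J) = idl_val P I + idl_val P J"
proof -
  obtain n L where L: "idl L" "I = idl_prod (idl_pow P n) L" "\<not> L \<subseteq> P"
    using prime_power_decomposition[OF P I] by blast
  obtain m N where N: "idl N" "J = idl_prod (idl_pow P m) N" "\<not> N \<subseteq> P"
    using prime_power_decomposition[OF P J] by blast
  have idP: "idl P" by (rule place_idl[OF P])
  have "idl_prod I J = idl_prod (idl_pow P (n + m)) (idl_prod L N)"
    unfolding L(2) N(2) idl_pow_add[OF idP] using L(1) N(1) idP
    by (simp add: idl_prod_assoc idl_prod_left_commute[of L])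
  moreover have "\<not> idl_prod L N \<subseteq> P" using place_contains_idl_prod[OF P L(1) N(1)] L N by blast
  ultimately have "idl_val P (idl_prod I J) = n + m"
    using idl_val_idl_prod_idl_pow[OF P] L(1) N(1) by simp
  moreover have "idl_val P I = n" unfolding L(2) by (rule idl_val_idl_prod_idl_pow[OF P L(1,3)])
  moreover have "idl_val P J = m" unfolding N(2) by (rule idl_val_idl_prod_idl_pow[OF P N(1,3)])
  ultimately show ?thesis by simp
qed

lemma idl_val_pos_iff: "place P \<Longrightarrow> idl I \<Longrightarrow> I \<noteq> {0} \<Longrightarrow> idl_val P I > 0 \<longleftrightarrow> I \<subseteq> P"
  using le_idl_val_iff[of P I "Suc 0"] by (simp add: idl_pow_1 place_idl Suc_le_eq)

lemma idl_val_self: "place P \<Longrightarrow> idl_val P P = 1"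
  using idl_val_idl_prod_idl_pow[of P OK "Suc 0"] place_neq_OK[of P] place_idl[of P] idl_subset[of P]
  by (simp add: idl_pow_1 idl_prod_OK)

lemma idl_val_place_neq:
  assumes "place P" "place Q" "P \<noteq> Q"
  shows "idl_val P Q = 0"
  using idl_val_pos_iff[OF assms(1) place_idl[OF assms(2)] place_nonzero[OF assms(2)]] 
    place_subset_imp_eq[OF assms(2,1)] assms(3) by auto

definition supp :: "complex set \<Rightarrow> complex set set" where
  "supp I = {P. place P \<and> I \<subseteq> P}"

text \<open>Splitting off one place \<open>Q\<close> multiplies both sides by
  \<open>conj_norm Q\<close>: the exponent at \<open>Q\<close> grows by 1 and all others
  stay.\<close>

theorem ideal_factorization:
  assumes "idl I" "I \<noteq> {0}"
  shows "finite (supp I) \<and> conj_norm I = (\<Prod>P\<in>supp I. conj_norm P ^ idl_val P I)"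
  using assms
proof (induction "conj_norm I" arbitrary: I rule: less_induct)
  case less
  show ?case
  proof (cases "I = OK")
    case True
    have "supp OK = {}"
      using place_neq_OK place_idl idl_subset by (fastforce simp: supp_def)
    then show ?thesis using True by simp
  next
    case False
    obtain Q where Q: "place Q" "I \<subseteq> Q"
      by (rule exists_place_containing[OF less.prems False])
    have idQ: "idl Q" and Qnz: "Q \<noteq> {0}" using Q place_idl place_nonzero by auto
    obtain L where L: "idl L" "I = idl_prod Q L"
      by (rule contains_imp_divides[OF less.prems(1) idQ Qnz Q(2)])
    have MI: "conj_norm I = conj_norm Q * conj_norm L" unfolding L(2) by (rule conj_norm_idl_prod[OF idQ L(1)])
    have Lnz: "L \<noteq> {0}"
      using MI conj_norm_eq_0_iff[OF L(1)] conj_norm_eq_0_iff[OF less.prems(1)] less.prems(2) by auto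
    then have "conj_norm L > 0" using conj_norm_eq_0_iff[OF L(1)] by blast
    then have "conj_norm L < conj_norm I" using place_conj_norm_gt_1[OF Q(1)] MI by simp
    from less.hyps[OF this L(1) Lnz]
    have fin: "finite (supp L)" and eqL: "conj_norm L = (\<Prod>P\<in>supp L. conj_norm P ^ idl_val P L)" by auto
    have "I \<subseteq> P \<longleftrightarrow> P = Q \<or> L \<subseteq> P" if "place P" for P
      unfolding L(2) place_contains_idl_prod_iff[OF that idQ L(1)]
      using place_subset_imp_eq[OF Q(1) that] by blast
    then have supp: "supp I = insert Q (supp L)"
      using Q by (auto simp: supp_def)
    have v: "idl_val P I = idl_val P Q + idl_val P L" if "place P" for P
      unfolding L(2) by (rule idl_val_idl_prod[OF that idQ Qnz L(1) Lnz])
    have "(\<Prod>P\<in>supp I. conj_norm P ^ idl_val P I) = (\<Prod>P\<in>supp I. conj_norm P ^ idl_val P Q * conj_norm P ^ idl_val P L)"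
      by (rule prod.cong) (auto simp: v supp_def power_add)
    also have "\<dots> = (\<Prod>P\<in>supp I. conj_norm P ^ idl_val P Q) * (\<Prod>P\<in>supp I. conj_norm P ^ idl_val P L)"
      by (rule prod.distrib)
    also have "(\<Prod>P\<in>supp I. conj_norm P ^ idl_val P Q) = (\<Prod>P\<in>supp I. if P = Q then conj_norm Q else 1)"
      by (rule prod.cong) (use Q idl_val_self idl_val_place_neq in \<open>auto simp: supp_def\<close>)
    also have "\<dots> = conj_norm Q" using fin supp by simp
    \<comment> \<open>\<open>Q\<close> may be missing from \<open>supp L\<close>; its exponent in
      \<open>L\<close> is then 0 and the extra factor is 1.\<close>
    also have "(\<Prod>P\<in>supp I. conj_norm P ^ idl_val P L) = (\<Prod>P\<in>supp L. conj_norm P ^ idl_val P L)"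
      by (rule prod.mono_neutral_right)
        (use fin supp Q idl_val_pos_iff[OF Q(1) L(1) Lnz] in \<open>auto simp: supp_def\<close>)
    finally show ?thesis using fin supp MI eqL by simp
  qed
qed


section \<open>Residue fields\<close>

definition coset :: "complex set \<Rightarrow> complex \<Rightarrow> complex set" where
  "coset P x = (\<lambda>h. h + x) ` P"

lemma coset_eq_rcos: "P +>\<^bsub>R\<^esub> x = coset P x"
  by (auto simp: a_r_coset_def' coset_def)

lemma carrier_Quot: "carrier (R Quot P) = coset P ` OK"
  by (auto simp: FactRing_def A_RCOSETS_def' coset_eq_rcos)

lemma coset_eq_iff:
  assumes P: "idl P"
  shows "coset P x = coset P y \<longleftrightarrow> x - y \<in> P"
proof
  assume eq: "coset P x = coset P y"
  have "0 + x \<in> coset P x" using idl_0[OF P] unfolding coset_def by blast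
  then have "0 + x \<in> coset P y" using eq by simp
  then obtain h where "h \<in> P" "x = h + y" by (auto simp: coset_def)
  then show "x - y \<in> P" by simp
next
  assume d: "x - y \<in> P"
  show "coset P x = coset P y"
  proof
    show "coset P x \<subseteq> coset P y"
    proof
      fix u assume "u \<in> coset P x"
      then obtain h where "h \<in> P" "u = h + x" by (auto simp: coset_def)
      then have "u = (h + (x - y)) + y" "h + (x - y) \<in> P" using idl_add[OF P _ d] by auto
      then show "u \<in> coset P y" unfolding coset_def by blast
    qed
    show "coset P y \<subseteq> coset P x"
    proof
      fix u assume "u \<in> coset P y"
      then obtain h where "h \<in> P" "u = h + y" by (auto simp: coset_def)
      then have "u = (h - (x - y)) + x" "h - (x - y) \<in> P" using idl_diff[OF P _ d] by auto
      then show "u \<in> coset P x" unfolding coset_def by blast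
    qed
  qed
qed

text \<open>The least positive integer in \<open>P\<close> has a prime factor \<open>p\<close>;
  primeness puts \<open>p\<close> or the cofactor into \<open>P\<close>, and the cofactor is too
  small.\<close>

lemma place_contains_prime_number:
  assumes P: "place P"
  obtains p :: nat where "Factorial_Ring.prime p" "of_nat p \<in> P"
proof -
  define Q where "Q = (\<lambda>n::nat. n > 0 \<and> of_nat n \<in> P)"
  have "Q (conj_norm P)" using conj_norm_mem[OF place_idl[OF P]] place_conj_norm_gt_1[OF P] by (simp add: Q_def)
  then have Q: "Q (Least Q)" by (rule LeastI)
  have "Least Q \<noteq> 1" using Q place_not_1[OF P] by (auto simp: Q_def)
  then obtain p where p: "Factorial_Ring.prime p" "p dvd Least Q" using prime_factor_nat by blast
  then obtain c where c: "Least Q = p * c" by blast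
  have "(of_nat p :: complex) * of_nat c \<in> P" using Q c by (simp add: Q_def)
  then have "of_nat p \<in> P \<or> of_nat c \<in> P" by (intro place_cases[OF P]) auto
  moreover have "of_nat c \<notin> P"
  proof
    assume "of_nat c \<in> P"
    moreover have "c > 0" "c < Least Q"
    proof -
      have "p * c > 0" using Q by (simp add: Q_def flip: c)
      then show "c > 0" by simp
      then show "c < Least Q" unfolding c using prime_gt_1_nat[OF p(1)] by simp
    qed
    ultimately show False using not_less_Least[of c Q] by (simp add: Q_def)
  qed
  ultimately show ?thesis using that p(1) by blast
qed

lemma basis_mem_principal_iff:
  assumes \<omega>: "\<omega> \<in> OK" "Im \<omega> > 0" "\<And>z. z \<in> OK \<Longrightarrow> \<exists>i j :: int. z = of_int i + of_int j * \<omega>"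
    and p: "p > 0"
  shows "of_int i + of_int j * \<omega> \<in> principal (of_nat p) \<longleftrightarrow> int p dvd i \<and> int p dvd j"
proof
  assume "of_int i + of_int j * \<omega> \<in> principal (of_nat p)"
  then obtain r where r: "r \<in> OK" "of_int i + of_int j * \<omega> = r * of_nat p" by (auto simp: principal_def)
  obtain a b where ab: "r = of_int a + of_int b * \<omega>" using \<omega>(3)[OF r(1)] by blast
  have "of_int j * Im \<omega> = (of_int b * of_nat p) * Im \<omega>"
    using arg_cong[OF r(2), of Im] by (simp add: ab algebra_simps)
  then have "real_of_int j = of_int (b * int p)" using \<omega>(2) by simp
  then have j: "j = b * int p" by (simp only: of_int_eq_iff)
  have "complex_of_int i = of_int (a * int p)" using r(2) by (simp add: ab j algebra_simps)
  then have "i = a * int p" by (simp only: of_int_eq_iff)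
  with j show "int p dvd i \<and> int p dvd j" by simp
next
  assume "int p dvd i \<and> int p dvd j"
  then obtain a b where "i = int p * a" "j = int p * b" by blast
  then have "of_int i + of_int j * \<omega> = (of_int a + of_int b * \<omega>) * of_nat p"
    by (simp add: algebra_simps)
  moreover have "of_int a + of_int b * \<omega> \<in> OK" using \<omega>(1) by (intro OK_add OK_mult) auto
  ultimately show "of_int i + of_int j * \<omega> \<in> principal (of_nat p)" unfolding principal_def by blast
qed

text \<open>By Bezout an integer in \<open>P\<close> that is prime to \<open>p\<close> would put 1
  into \<open>P\<close>.\<close>

lemma of_int_mem_place_iff:
  assumes P: "place P" and p: "Factorial_Ring.prime p" "of_nat p \<in> P"
  shows "of_int i \<in> P \<longleftrightarrow> int p dvd i"
proof
  assume i: "of_int i \<in> P"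
  show "int p dvd i"
  proof (rule ccontr)
    assume "\<not> int p dvd i"
    then have "coprime (int p) i" using p(1) by (simp add: prime_imp_coprime)
    then obtain u v where "u * int p + v * i = 1"
      using bezout_int[of "int p" i] by auto
    then have "(1::complex) = of_int u * of_nat p + of_int v * of_int i"
      by (metis of_int_1 of_int_add of_int_mult of_int_of_nat_eq)
    also have "\<dots> \<in> P"
      using i p(2) place_idl[OF P] by (intro idl_add idl_mult) auto
    finally show False using place_not_1[OF P] by blast
  qed
next
  assume "int p dvd i"
  then obtain k where "i = int p * k" by blast
  then show "of_int i \<in> P"
    using idl_mult[OF place_idl[OF P] p(2), of "of_int k"] by (simp add: mult.commute)
qed

lemma mod_diff_eq_imp_eq:
  fixes i k :: int and p :: nat
  assumes "i \<in> {0..<int p}" "k \<in> {0..<int p}" "int p dvd i - k"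
  shows "i = k"
  using assms by (metis atLeastLessThan_iff mod_eq_dvd_iff mod_pos_pos_trivial)

text \<open>The ideal (p) is a multiple of \<open>P\<close> and has norm p^2, so
  \<open>conj_norm P\<close> is p or p^2. In the first case 0, ..., p - 1 represent the cosets; in
  the second P = (p), and both coordinates in the integral basis run through 0, ..., p - 1.\<close>

lemma ideal_norm_eq_conj_norm:
  assumes P: "place P"
  shows "ideal_norm K P = conj_norm P"
proof -
  have idP: "idl P" by (rule place_idl[OF P])
  have card: "ideal_norm K P = card (coset P ` OK)"
    by (simp add: ideal_norm_def carrier_Quot)
  obtain p where p: "Factorial_Ring.prime p" "of_nat p \<in> P" by (rule place_contains_prime_number[OF P])
  have p0: "p > 0" using prime_gt_0_nat[OF p(1)] .
  obtain \<omega> where \<omega>: "\<omega> \<in> OK" "Im \<omega> > 0"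
    "\<And>z. z \<in> OK \<Longrightarrow> \<exists>i j :: int. z = of_int i + of_int j * \<omega>"
    using integral_basis by blast
  have "principal (of_nat p) \<subseteq> P" using p(2) idP by (simp add: principal_subset_iff)
  then obtain J where J: "idl J" "principal (of_nat p) = idl_prod P J"
    using contains_imp_divides[of "principal (of_nat p)" P] idP place_nonzero[OF P] by (metis OK_of_nat idl_principal)
  have Mp: "conj_norm (principal (of_nat p)) = p\<^sup>2" by (simp add: conj_norm_principal abs_norm_of_nat)
  then have MJ: "conj_norm P * conj_norm J = p\<^sup>2" unfolding J(2) conj_norm_idl_prod[OF idP J(1)] .
  then have "conj_norm P dvd p ^ 2" by (metis dvd_triv_left)
  then obtain k where k: "k \<le> 2" "conj_norm P = p ^ k"
    using divides_primepow_nat[OF p(1)] by blast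
  moreover have "k \<noteq> 0" using k(2) place_conj_norm_gt_1[OF P] by (intro notI) simp
  ultimately consider "conj_norm P = p" | "conj_norm P = p\<^sup>2" by (cases k) (auto simp: le_Suc_eq numeral_2_eq_2)
  then show ?thesis
  proof cases
    case 1
    \<comment> \<open>An element \<open>x\<close> of \<open>P\<close> outside (p) is needed: it
      provides a relation that expresses \<open>\<omega>\<close> modulo \<open>P\<close> by a
      rational integer.\<close>
    have "P \<noteq> principal (of_nat p)"
    proof
      assume eq: "P = principal (of_nat p)"
      have "p\<^sup>2 = p" using Mp 1 unfolding eq[symmetric] by simp
      then show False using prime_gt_1_nat[OF p(1)] by (simp add: power2_eq_square)
    qed
    then obtain x where x: "x \<in> P" "x \<notin> principal (of_nat p)" using \<open>principal (of_nat p) \<subseteq> P\<close> by blast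
    obtain i j where ij: "x = of_int i + of_int j * \<omega>" using \<omega>(3) idl_OK_mem[OF idP x(1)] by blast
    have "\<not> int p dvd j"
    proof
      assume j: "int p dvd j"
      then have "of_int j * \<omega> \<in> P"
        using idl_mult2[OF idP _ \<omega>(1)] of_int_mem_place_iff[OF P p] by blast
      then have "of_int i \<in> P" using idl_diff[OF idP x(1)] ij by (metis add_diff_cancel_right')
      then have "int p dvd i" using of_int_mem_place_iff[OF P p] by blast
      then show False using x(2) ij basis_mem_principal_iff[OF \<omega> p0] j by blast
    qed
    then have "coprime (int p) j" using p(1) by (simp add: prime_imp_coprime)
    then obtain u v where uv: "u * int p + v * j = 1"
      using bezout_int[of "int p" j] by auto
    \<comment> \<open>\<open>v\<close> inverts \<open>j\<close> modulo \<open>p\<close>, so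
      multiplying x = i + j * \<omega> by \<open>v\<close> gives \<omega> congruent to - v * i
      modulo \<open>P\<close>.\<close>
    have \<omega>_eq: "\<omega> + of_int (v * i) \<in> P"
    proof -
      have "(of_int u * of_nat p + of_int v * of_int j) * \<omega> = \<omega>"
        using arg_cong[OF uv, of complex_of_int] by simp
      then have "\<omega> + of_int (v * i) = of_int u * \<omega> * of_nat p + of_int v * x"
        by (simp add: ij algebra_simps)
      also have "\<dots> \<in> P" using \<omega>(1) x(1) p(2) idP
        by (intro idl_add idl_mult) (auto intro: OK_mult)
      finally show ?thesis .
    qed
    define f where "f = (\<lambda>n::int. coset P (of_int n))"
    have "coset P ` OK = f ` {0..<int p}"
    proof
      show "f ` {0..<int p} \<subseteq> coset P ` OK" by (auto simp: f_def)
      show "coset P ` OK \<subseteq> f ` {0..<int p}"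
      proof
        fix c assume "c \<in> coset P ` OK"
        then obtain z where z: "z \<in> OK" "c = coset P z" by auto
        obtain s t where st: "z = of_int s + of_int t * \<omega>" using \<omega>(3)[OF z(1)] by blast
        define n where "n = (s - t * (v * i)) mod int p"
        have q: "int p dvd s - t * (v * i) - n"
          unfolding n_def by (rule dvd_minus_mod)
        have "z - of_int n = of_int t * (\<omega> + of_int (v * i)) + of_int (s - t * (v * i) - n)"
          by (simp add: st distrib_left)
        also have "\<dots> \<in> P"
        proof (rule idl_add[OF idP])
          show "of_int t * (\<omega> + of_int (v * i)) \<in> P" by (rule idl_mult[OF idP \<omega>_eq]) simp
          show "of_int (s - t * (v * i) - n) \<in> P"
            unfolding of_int_mem_place_iff[OF P p] by (rule q)
        qed
        finally have "c = f n" using z coset_eq_iff[OF idP] by (simp add: f_def)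
        moreover have "n \<in> {0..<int p}" using p0 by (simp add: n_def)
        ultimately show "c \<in> f ` {0..<int p}" by blast
      qed
    qed
    moreover have "inj_on f {0..<int p}"
    proof (rule inj_onI)
      fix n m assume *: "n \<in> {0..<int p}" "m \<in> {0..<int p}" "f n = f m"
      then have "of_int (n - m) \<in> P" using coset_eq_iff[OF idP] by (simp add: f_def)
      then have "int p dvd n - m" using of_int_mem_place_iff[OF P p] by blast
      then show "n = m" using mod_diff_eq_imp_eq * by blast
    qed
    ultimately show ?thesis using 1 by (simp add: card card_image)
  next
    case 2
    have "conj_norm J = 1" using MJ 2 p0 by simp
    then have "J = OK" using conj_norm_eq_1[OF J(1)] by blast
    then have Pp: "P = principal (of_nat p)" using J(2) idl_prod_OK[OF idP] by simp
    define f where "f = (\<lambda>(n::int, m::int). coset P (of_int n + of_int m * \<omega>))"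
    define B where "B = {0..<int p} \<times> {0..<int p}"
    have f_eq: "f (n, m) = f (n', m') \<longleftrightarrow> int p dvd n - n' \<and> int p dvd m - m'" for n m n' m'
    proof -
      have "f (n, m) = f (n', m') \<longleftrightarrow> of_int (n - n') + of_int (m - m') * \<omega> \<in> P"
        using coset_eq_iff[OF idP] by (simp add: f_def algebra_simps)
      also have "\<dots> \<longleftrightarrow> of_int (n - n') + of_int (m - m') * \<omega> \<in> principal (of_nat p)"
        by (subst Pp) (rule refl)
      also have "\<dots> \<longleftrightarrow> int p dvd n - n' \<and> int p dvd m - m'"
        by (rule basis_mem_principal_iff[OF \<omega> p0])
      finally show ?thesis .
    qed
    have "coset P ` OK = f ` B"
    proof
      show "f ` B \<subseteq> coset P ` OK"
        using \<omega>(1) by (auto simp: f_def intro!: imageI OK_add OK_mult)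
      show "coset P ` OK \<subseteq> f ` B"
      proof
        fix c assume "c \<in> coset P ` OK"
        then obtain z where z: "z \<in> OK" "c = coset P z" by auto
        obtain s t where st: "z = of_int s + of_int t * \<omega>" using \<omega>(3)[OF z(1)] by blast
        have "f (s, t) = f (s mod int p, t mod int p)"
          unfolding f_eq by (simp add: dvd_minus_mod)
        moreover have "(s mod int p, t mod int p) \<in> B" using p0 by (simp add: B_def)
        moreover have "c = f (s, t)" by (simp add: f_def z st)
        ultimately show "c \<in> f ` B" by simp
      qed
    qed
    moreover have "inj_on f B"
    proof (rule inj_onI)
      fix x y assume *: "x \<in> B" "y \<in> B" "f x = f y"
      obtain n m n' m' where xy: "x = (n, m)" "y = (n', m')" by (cases x, cases y) auto
      have "int p dvd n - n'" "int p dvd m - m'" using *(3) f_eq xy by auto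
      then show "x = y" using *(1,2) mod_diff_eq_imp_eq unfolding xy B_def by blast
    qed
    moreover have "card B = p\<^sup>2" by (simp add: B_def power2_eq_square)
    ultimately show ?thesis using 2 by (simp add: card card_image)
  qed
qed

text \<open>Lagrange's theorem in the unit group of the residue ring, which is a field because
  places are maximal; the order of the group is \<open>conj_norm P - 1\<close>.\<close>

lemma fermat_place:
  assumes P: "place P" and x: "x \<in> OK" "x \<notin> P"
  shows "x ^ (conj_norm P - 1) - 1 \<in> P"
proof -
  have idP: "idl P" by (rule place_idl[OF P])
  interpret P: ideal P R by (rule idP)
  have prime: "primeideal P R" using P by (simp add: finite_places_def)
  have "maximalideal P R"
  proof (rule maximalidealI[OF idP])
    show "carrier R \<noteq> P" using place_neq_OK[OF P] by simp
    fix J assume "ideal J R" "P \<subseteq> J" "J \<subseteq> carrier R"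
    then show "J = P \<or> J = carrier R" using place_maximal[OF P] by simp
  qed
  then have "field (R Quot P)" by (rule maximalideal.quotient_is_field) (rule cring_R)
  then interpret F: field "R Quot P" .
  interpret G: group "Multiplicative_Group.mult_of (R Quot P)"
    by (rule F.field_mult_group)
  have card: "card (carrier (R Quot P)) = conj_norm P"
    using ideal_norm_eq_conj_norm[OF P] by (simp add: ideal_norm_def)
  have fin: "finite (carrier (R Quot P))"
    using card place_conj_norm_gt_1[OF P] by (intro card_ge_0_finite) simp
  interpret H: ring_hom_ring R "R Quot P" "coset P"
    using P.rcos_ring_hom_ring by (simp add: coset_eq_rcos[abs_def])
  have pow: "coset P x [^]\<^bsub>R Quot P\<^esub> n = coset P (x ^ n)" for n :: nat
  proof (induction n)
    case 0
    show ?case using H.hom_one by simp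
  next
    case (Suc n)
    then show ?case using H.hom_mult[of "x ^ n" x] x by (simp add: OK_power mult.commute)
  qed
  have zero: "\<zero>\<^bsub>R Quot P\<^esub> = coset P 0" using H.hom_zero by simp
  have "coset P x \<noteq> \<zero>\<^bsub>R Quot P\<^esub>" using x by (simp add: zero coset_eq_iff[OF idP])
  then have mem: "coset P x \<in> carrier (Multiplicative_Group.mult_of (R Quot P))"
    using x by (simp add: carrier_Quot Multiplicative_Group.mult_of_simps)
  have "order (Multiplicative_Group.mult_of (R Quot P)) = conj_norm P - 1"
    using card F.order_mult_of[OF fin] by (simp add: Coset.order_def)
  then have "coset P x [^]\<^bsub>R Quot P\<^esub> (conj_norm P - 1) = \<one>\<^bsub>R Quot P\<^esub>"
    using G.pow_order_eq_1[OF mem] by (simp add: Multiplicative_Group.mult_of_simps)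
  then have "coset P (x ^ (conj_norm P - 1)) = coset P 1" using pow H.hom_one by simp
  then show ?thesis by (simp add: coset_eq_iff[OF idP])
qed


section \<open>Valuations and heights\<close>

definition val :: "complex set \<Rightarrow> complex \<Rightarrow> nat" where "val P x = idl_val P (principal x)"

definition primes_of :: "complex \<Rightarrow> complex set set" where
  "primes_of x = {P. place P \<and> x \<in> P}"

lemma supp_principal: "x \<in> OK \<Longrightarrow> supp (principal x) = primes_of x"
  using principal_subset_iff place_idl by (auto simp: supp_def primes_of_def)

lemma finite_primes_of: "x \<in> OK \<Longrightarrow> x \<noteq> 0 \<Longrightarrow> finite (primes_of x)"
  using ideal_factorization[of "principal x"] by (simp add: supp_principal principal_eq_zero_iff)

lemma abs_norm_eq_prod: "x \<in> OK \<Longrightarrow> x \<noteq> 0 \<Longrightarrow> abs_norm x = (\<Prod>P\<in>primes_of x. conj_norm P ^ val P x)"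
  using ideal_factorization[of "principal x"] by (simp add: supp_principal principal_eq_zero_iff conj_norm_principal val_def)

lemma val_mult:
  "place P \<Longrightarrow> x \<in> OK \<Longrightarrow> y \<in> OK \<Longrightarrow> x \<noteq> 0 \<Longrightarrow> y \<noteq> 0 \<Longrightarrow> val P (x * y) = val P x + val P y"
  by (simp add: val_def idl_prod_principal_principal[symmetric] idl_val_idl_prod principal_eq_zero_iff)

lemma val_pos_iff: "place P \<Longrightarrow> x \<in> OK \<Longrightarrow> x \<noteq> 0 \<Longrightarrow> val P x > 0 \<longleftrightarrow> x \<in> P"
  by (simp add: val_def idl_val_pos_iff principal_eq_zero_iff principal_subset_iff place_idl)

lemma val_eq_0: "place P \<Longrightarrow> x \<in> OK \<Longrightarrow> x \<notin> P \<Longrightarrow> val P x = 0"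
  using val_pos_iff[of P x] idl_0[OF place_idl, of P] by force

lemma Sup_enat_atMost: "Sup {enat n | n. n \<le> k} = enat k"
proof (rule antisym)
  show "Sup {enat n | n. n \<le> k} \<le> enat k" by (rule Sup_least) auto
  show "enat k \<le> Sup {enat n | n. n \<le> k}" by (rule Sup_upper) auto
qed

text \<open>Divisibility of ideals is inclusion, so the exponents in question are exactly those up
  to \<open>val P x\<close>, and for nonzero \<open>x\<close> the supremum is finite.\<close>

lemma int_val_eq:
  assumes P: "place P" and x: "x \<in> OK" "x \<noteq> 0"
  shows "int_val K P x = enat (val P x)"
proof -
  have nz: "principal x \<noteq> {0}" using x by (simp add: principal_eq_zero_iff)
  have idP: "idl P" by (rule place_idl[OF P])
  have "(P [^]\<^bsub>ideals_set R\<^esub> n divides\<^bsub>ideals_set R\<^esub> PIdl\<^bsub>R\<^esub> x) \<longleftrightarrow> n \<le> val P x" for n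
  proof -
    have "(P [^]\<^bsub>ideals_set R\<^esub> n divides\<^bsub>ideals_set R\<^esub> PIdl\<^bsub>R\<^esub> x) \<longleftrightarrow>
        (\<exists>L. idl L \<and> principal x = idl_prod (idl_pow P n) L)"
      by (auto simp: factor_def PIdl_eq_principal idl_pow_def ideals_set_def)
    also have "\<dots> \<longleftrightarrow> principal x \<subseteq> idl_pow P n"
    proof
      assume "\<exists>L. idl L \<and> principal x = idl_prod (idl_pow P n) L"
      then obtain L where "idl L" "principal x = idl_prod (idl_pow P n) L" by blast
      then show "principal x \<subseteq> idl_pow P n" using idl_prod_subset(1)[of "idl_pow P n" L] idP by simp
    next
      assume sub: "principal x \<subseteq> idl_pow P n"
      obtain L where "idl L" "principal x = idl_prod (idl_pow P n) L"
        by (rule contains_imp_divides[OF _ _ _ sub])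
          (use x idP idl_pow_nonzero[OF idP place_nonzero[OF P]] in auto)
      then show "\<exists>L. idl L \<and> principal x = idl_prod (idl_pow P n) L" by blast
    qed
    also have "\<dots> \<longleftrightarrow> n \<le> val P x"
      unfolding val_def using le_idl_val_iff[OF P _ nz] x by simp
    finally show ?thesis .
  qed
  then show ?thesis by (simp add: int_val_def Sup_enat_atMost)
qed

text \<open>The representation x / 1 supplies a value, and multiplicativity of \<open>val\<close>
  shows that every other quotient gives the same one.\<close>

lemma field_val_eq:
  assumes P: "place P" and x: "x \<in> OK" "x \<noteq> 0"
  shows "field_val K P x = int (val P x)"
  unfolding field_val_def R_simps
proof (rule the_equality)
  have "val P 1 = 0" by (rule val_eq_0[OF P]) (use place_not_1[OF P] in auto)
  then show "\<exists>b\<in>OK - {0}. \<exists>c\<in>OK - {0}. x = b / c \<and>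
      int (val P x) = int (the_enat (int_val K P b)) - int (the_enat (int_val K P c))"
    using x by (intro bexI[of _ x] bexI[of _ 1]) (auto simp: int_val_eq[OF P])
next
  fix e assume "\<exists>b\<in>OK - {0}. \<exists>c\<in>OK - {0}. x = b / c \<and>
      e = int (the_enat (int_val K P b)) - int (the_enat (int_val K P c))"
  then obtain b c where bc: "b \<in> OK" "b \<noteq> 0" "c \<in> OK" "c \<noteq> 0" "x = b / c"
    "e = int (the_enat (int_val K P b)) - int (the_enat (int_val K P c))" by blast
  have "b = x * c" using bc(4,5) by simp
  then have "val P b = val P x + val P c" using val_mult[OF P x(1) bc(3) x(2) bc(4)] by simp
  then show "e = int (val P x)" using bc(6) int_val_eq[OF P] bc(1-4) by simp
qed

section \<open>Absolute values, heights and radicals of integers\<close>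

lemma field_degree_K: "field_degree K = 2"
  using imag_quad by (simp add: imaginary_quadratic_field_def)

lemma finite_abs_eq:
  assumes "place P" "x \<in> OK" "x \<noteq> 0"
  shows "finite_abs K P x = real (conj_norm P) powr (- real (val P x) / 2)"
  using assms by (simp add: finite_abs_def field_val_eq ideal_norm_eq_conj_norm field_degree_K)

lemma finite_abs_le_1:
  assumes "place P" "x \<in> OK" "x \<noteq> 0"
  shows "finite_abs K P x \<le> 1"
proof -
  have "real (conj_norm P) powr (- real (val P x) / 2) \<le> real (conj_norm P) powr 0"
    using place_conj_norm_gt_1[OF assms(1)] by (intro powr_mono) auto
  then show ?thesis using place_conj_norm_gt_1[OF assms(1)] finite_abs_eq[OF assms] by simp
qed

lemma finite_abs_eq_1_iff:
  assumes "place P" "x \<in> OK" "x \<noteq> 0"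
  shows "finite_abs K P x = 1 \<longleftrightarrow> x \<notin> P"
proof -
  have "finite_abs K P x = 1 \<longleftrightarrow> val P x = 0"
    using place_conj_norm_gt_1[OF assms(1)] by (auto simp: finite_abs_eq[OF assms] powr_eq_one_iff_gen)
  then show ?thesis using val_pos_iff[OF assms] by auto
qed

text \<open>A ring homomorphism on \<open>K\<close> fixes the rationals, hence sends a nonreal
  \<open>w\<close> to a root of its rational quadratic equation, that is to \<open>w\<close> or its
  conjugate; the value at \<open>w\<close> determines it on \<open>K\<close>.\<close>

lemma embeddings_K:
  "embeddings K = {restrict (\<lambda>z. z) K, restrict cnj K}"
proof
  show "{restrict (\<lambda>z. z) K, restrict cnj K} \<subseteq> embeddings K"
    by (auto simp: embeddings_def Ring.ring_hom_def ring_of_type_algebra_def K_add K_mult)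
  show "embeddings K \<subseteq> {restrict (\<lambda>z. z) K, restrict cnj K}"
  proof
    fix f assume "f \<in> embeddings K"
    then have add: "f (x + y) = f x + f y" and mult: "f (x * y) = f x * f y" and one: "f 1 = 1"
      and ext: "f \<in> extensional K" if "x \<in> K" "y \<in> K" for x y
      using that by (auto simp: embeddings_def Ring.ring_hom_def ring_of_type_algebra_def)
    note one = one[OF K_0 K_0] and ext = ext[OF K_0 K_0]
    have zero: "f 0 = 0" using add[of 0 0] by simp
    have nat: "f (of_nat n) = of_nat n" for n
      by (induction n) (auto simp: zero one add)
    have minus: "f (- x) = - f x" if "x \<in> K" for x
      using add[OF that K_minus[OF that]] zero by (simp add: eq_neg_iff_add_eq_0 add.commute)
    have int: "f (of_int n) = of_int n" for n
      by (cases n rule: int_cases2) (auto simp: nat minus)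
    have rat: "f (of_rat q) = of_rat q" for q
    proof (cases q)
      case (Fract a b)
      then have "of_rat q * of_int b = (of_int a :: complex)" by (simp add: of_rat_rat)
      then have "f (of_rat q) * of_int b = of_int a"
        using mult[of "of_rat q" "of_int b"] int by simp
      then show ?thesis using \<open>of_rat q * of_int b = (of_int a :: complex)\<close> Fract
        by (metis mult_right_cancel of_int_eq_0_iff less_irrefl)
    qed
    obtain w where w: "w \<in> K" "w \<notin> \<real>" by (rule K_nonreal_generator)
    obtain t n where tn: "w + cnj w = of_rat t" "w * cnj w = of_rat n"
      using rational_trace_norm_of_generator[OF w] by (auto simp: Rats_complex_iff)
    have ww: "w * w + of_rat n = of_rat t * w"
      unfolding tn[symmetric] by (simp add: algebra_simps)
    have "f w * f w + of_rat n = of_rat t * f w"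
      using arg_cong[OF ww, of f] w by (simp add: add mult rat K_mult)
    then have "f w * f w + w * cnj w = (w + cnj w) * f w" unfolding tn .
    then have "(f w - w) * (f w - cnj w) = 0" by (simp add: algebra_simps)
    then have fw: "f w = w \<or> f w = cnj w" by auto
    have f_eq: "f z = g z" if z: "z \<in> K" and "f w = g w"
      and g: "\<And>r s. g (of_rat r + of_rat s * w) = of_rat r + of_rat s * g w" for z g
    proof -
      obtain r s where "z = of_rat r + of_rat s * w" using quadratic_basis[OF w z] .
      then show ?thesis using that(2) g w by (simp add: add mult rat K_mult)
    qed
    have cnj_rat: "cnj (of_rat r) = of_rat r" for r
      by (rule Rats_imp_cnj_eq) simp
    from fw show "f \<in> {restrict (\<lambda>z. z) K, restrict cnj K}"
    proof
      assume "f w = w"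
      then have "f z = restrict (\<lambda>z. z) K z" if "z \<in> K" for z
        using f_eq[of z "\<lambda>z. z"] that by simp
      then have "f = restrict (\<lambda>z. z) K"
        by (intro extensionalityI[OF ext]) auto
      then show ?thesis by simp
    next
      assume "f w = cnj w"
      then have "f z = restrict cnj K z" if "z \<in> K" for z
        using f_eq[of z cnj] that cnj_rat by simp
      then have "f = restrict cnj K"
        by (intro extensionalityI[OF ext]) auto
      then show ?thesis by simp
    qed
  qed
qed

text \<open>The identity and conjugation are different embeddings, and each contributes at least the
  square root of \<open>cmod z\<close>.\<close>

lemma infinite_height_ge:
  assumes "x \<in> K" "y \<in> K" "z \<in> K"
  shows "infinite_height K x y z \<ge> cmod z"
proof -
  obtain w where w: "w \<in> K" "w \<notin> \<real>" by (rule K_nonreal_generator)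
  have neq: "restrict (\<lambda>z. z) K \<noteq> restrict cnj K"
  proof
    assume "restrict (\<lambda>z. z) K = restrict cnj K"
    then have "restrict (\<lambda>z. z) K w = restrict cnj K w" by simp
    then show False using w Reals_cnj_iff by simp
  qed
  have "cmod z = cmod z powr (1/2) * cmod z powr (1/2)"
    by (simp add: powr_half_sqrt)
  also have "\<dots> = (\<Prod>v\<in>embeddings K. cmod z powr (1/2))"
    unfolding embeddings_K using neq by simp
  also have "\<dots> \<le> infinite_height K x y z"
    unfolding infinite_height_def
  proof (rule prod_mono)
    fix v assume v: "v \<in> embeddings K"
    have "cmod (v z) = cmod z" using v assms(3) unfolding embeddings_K by auto
    then have "cmod z powr (1/2) = infinite_abs K v z" by (simp add: infinite_abs_def field_degree_K)
    then show "0 \<le> cmod z powr (1/2) \<and>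
        cmod z powr (1/2) \<le> Max {infinite_abs K v x, infinite_abs K v y, infinite_abs K v z}"
      by (simp add: infinite_abs_def)
  qed
  finally show ?thesis .
qed

text \<open>Integers have finite absolute values at most 1, and the entry 1 attains this bound at
  every place.\<close>

lemma finite_height_eq_1:
  assumes "x \<in> OK" "x \<noteq> 0" "z \<in> OK" "z \<noteq> 0"
  shows "finite_height K x 1 z = 1"
proof -
  have "Max {finite_abs K P x, finite_abs K P 1, finite_abs K P z} = 1" if "place P" for P
  proof -
    have "finite_abs K P 1 = 1" using finite_abs_eq_1_iff[OF that] place_not_1[OF that] by simp
    then show ?thesis using finite_abs_le_1[OF that] assms by (simp add: max_absorb1)
  qed
  then have "{P \<in> finite_places K. Max {finite_abs K P x, finite_abs K P 1, finite_abs K P z} \<noteq> 1} = {}"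
    by blast
  then show ?thesis unfolding finite_height_def Let_def by (simp only: prod.empty)
qed

definition rad :: "complex \<Rightarrow> nat" where "rad x = (\<Prod>P\<in>primes_of x. conj_norm P)"

lemma abc_radical_eq:
  assumes "x \<in> OK" "x \<noteq> 0" "z \<in> OK" "z \<noteq> 0"
  shows "abc_radical K x 1 z = (\<Prod>P\<in>primes_of x \<union> primes_of z. sqrt (conj_norm P))"
  unfolding abc_radical_def
proof (rule prod.cong)
  show "{P \<in> finite_places K. \<not> (finite_abs K P x = 1 \<and> finite_abs K P 1 = 1 \<and> finite_abs K P z = 1)} =
      primes_of x \<union> primes_of z"
    using assms finite_abs_eq_1_iff place_not_1 by (auto simp: primes_of_def)
  show "real (ideal_norm K P) powr (1 / real (field_degree K)) = sqrt (conj_norm P)"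
    if "P \<in> primes_of x \<union> primes_of z" for P
    using that by (auto simp: ideal_norm_eq_conj_norm field_degree_K powr_half_sqrt primes_of_def)
qed

text \<open>The factors of the common primes, each at least 1, are inserted to turn the product over
  a union into two separate products. The square root is the exponent 1 / [K:Q].\<close>

lemma abc_radical_le:
  assumes "x \<in> OK" "x \<noteq> 0" "z \<in> OK" "z \<noteq> 0"
  shows "abc_radical K x 1 z \<le> sqrt (rad x * rad z)"
proof -
  have fin: "finite (primes_of x)" "finite (primes_of z)" using assms finite_primes_of by auto
  have sq: "(\<Prod>P\<in>A. sqrt (conj_norm P)) = sqrt (\<Prod>P\<in>A. conj_norm P)" for A
    by (induction A rule: infinite_finite_induct) (auto simp: real_sqrt_mult)
  have ge1: "sqrt (conj_norm P) \<ge> 1" if "place P" for P using place_conj_norm_gt_1[OF that] by simp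
  have "abc_radical K x 1 z * 1 \<le> (\<Prod>P\<in>primes_of x \<union> primes_of z. sqrt (conj_norm P)) *
      (\<Prod>P\<in>primes_of x \<inter> primes_of z. sqrt (conj_norm P))"
    unfolding abc_radical_eq[OF assms]
    by (intro mult_left_mono prod_ge_1 prod_nonneg) (use ge1 in \<open>auto simp: primes_of_def\<close>)
  also have "\<dots> = (\<Prod>P\<in>primes_of x. sqrt (conj_norm P)) * (\<Prod>P\<in>primes_of z. sqrt (conj_norm P))"
    by (rule prod.union_inter[OF fin])
  also have "\<dots> = sqrt (rad x * rad z)"
    by (simp add: rad_def real_sqrt_mult sq)
  finally show ?thesis by simp
qed

text \<open>The conjecture is applied to (z - 1) + 1 = z, where the height is at least
  \<open>cmod z\<close>. Its constant comes without a sign and is therefore enlarged to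
  \<open>max C 1\<close>.\<close>

lemma abc_bound:
  assumes "abc_conjecture K" "\<epsilon> > 0"
  obtains C :: real where "C > 0"
    "\<And>z. z \<in> OK \<Longrightarrow> z \<noteq> 0 \<Longrightarrow> z \<noteq> 1 \<Longrightarrow> cmod z \<le> C * sqrt (rad (z - 1) * rad z) powr (1 + \<epsilon>)"
proof -
  obtain C where C: "\<And>\<alpha> \<beta>. \<alpha> \<in> K \<Longrightarrow> \<beta> \<in> K \<Longrightarrow> \<alpha> \<noteq> 0 \<Longrightarrow> \<beta> \<noteq> 0 \<Longrightarrow> \<alpha> + \<beta> \<noteq> 0 \<Longrightarrow>
        abc_height K \<alpha> \<beta> (\<alpha> + \<beta>) \<le> C * abc_radical K \<alpha> \<beta> (\<alpha> + \<beta>) powr (1 + \<epsilon>)"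
    using assms unfolding abc_conjecture_def by meson
  show ?thesis
  proof
    show "max C 1 > 0" by simp
    fix z assume z: "z \<in> OK" "z \<noteq> 0" "z \<noteq> 1"
    have z1: "z - 1 \<in> OK" "z - 1 \<noteq> 0" using z by (auto intro: OK_diff)
    have inK: "z \<in> K" "z - 1 \<in> K" using z z1 OK_subset_K by auto
    have "cmod z \<le> infinite_height K (z - 1) 1 z" by (rule infinite_height_ge) (use inK in auto)
    also have "\<dots> = abc_height K (z - 1) 1 (z - 1 + 1)"
      using finite_height_eq_1[OF z1 z(1,2)] by (simp add: abc_height_def)
    also have "\<dots> \<le> C * abc_radical K (z - 1) 1 (z - 1 + 1) powr (1 + \<epsilon>)"
      using z z1 inK by (intro C) auto
    also have "\<dots> \<le> max C 1 * abc_radical K (z - 1) 1 z powr (1 + \<epsilon>)"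
      by (simp add: mult_right_mono)
    also have "\<dots> \<le> max C 1 * sqrt (rad (z - 1) * rad z) powr (1 + \<epsilon>)"
    proof -
      have "abc_radical K (z - 1) 1 z \<ge> 0"
        unfolding abc_radical_eq[OF z1 z(1,2)] by (rule prod_nonneg) simp
      then show ?thesis
        using abc_radical_le[OF z1 z(1,2)] assms(2) by (intro mult_left_mono powr_mono2) auto
    qed
    finally show "cmod z \<le> max C 1 * sqrt (rad (z - 1) * rad z) powr (1 + \<epsilon>)" .
  qed
qed

end


section \<open>Integers with large totient\<close>

lemma card_multiples_le: "card {a \<in> {1..N}. d dvd a} \<le> N div d" if "d > 0" for d N :: nat
proof -
  have "inj_on (\<lambda>a. a div d) {a \<in> {1..N}. d dvd a}"
    by (intro inj_onI) (metis (no_types, lifting) dvd_div_mult_self mem_Collect_eq)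
  moreover have "(\<lambda>a. a div d) ` {a \<in> {1..N}. d dvd a} \<subseteq> {1..N div d}"
    using that by (auto intro!: div_le_mono simp: Suc_le_eq div_greater_zero_iff dvd_imp_le)
  ultimately show ?thesis
    using card_inj_on_le[of "\<lambda>a. a div d" _ "{1..N div d}"] by simp
qed

text \<open>The term - 1 / N makes the induction telescope through 1 / (n + 1)^2 \<le> 1 / n - 1 /
  (n + 1); the constant 3 / 4 is exact for N = 2. What matters for the count is a bound less than
  1.\<close>

lemma sum_inverse_squares_le: "N \<ge> 2 \<Longrightarrow> (\<Sum>d = 2..N. 1 / (real d)\<^sup>2) \<le> 3 / 4 - 1 / real N"
proof (induction N rule: dec_induct)
  case base
  show ?case by simp
next
  case (step n)
  have "1 / (real (Suc n))\<^sup>2 \<le> 1 / (real n * real (Suc n))"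
    using step.hyps by (intro divide_left_mono) (auto simp: power2_eq_square intro!: mult_right_mono)
  also have "\<dots> = 1 / real n - 1 / real (Suc n)"
    using step.hyps by (simp add: field_simps)
  finally show ?case using step by simp
qed

text \<open>A pair with a common factor is caught by some \<open>d\<close> from 2 to
  \<open>N\<close>, and at most (N / d)^2 pairs are divisible by \<open>d\<close>. These add up to
  at most 3 / 4 of all pairs and leave a quarter.\<close>

lemma card_coprime_pairs_ge:
  "real N ^ 2 / 4 \<le> card {(a, b). a \<in> {1..N} \<and> b \<in> {1..N} \<and> coprime a b}"
proof -
  define Q where "Q = {1..N} \<times> {1..N}"
  define C where "C = {(a, b). a \<in> {1..N} \<and> b \<in> {1..N} \<and> coprime a b}"
  define D where "D = (\<lambda>d. {a \<in> {1..N}. d dvd a} \<times> {a \<in> {1..N}. d dvd a})"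
  have fin: "finite Q" "finite (D d)" for d by (auto simp: Q_def D_def)
  have CQ: "C \<subseteq> Q" by (auto simp: C_def Q_def)
  have "Q - C \<subseteq> (\<Union>d\<in>{2..N}. D d)"
  proof
    fix x assume "x \<in> Q - C"
    then obtain a b where ab: "x = (a, b)" "a \<in> {1..N}" "b \<in> {1..N}" "\<not> coprime a b"
      by (cases x) (auto simp: Q_def C_def)
    have "gcd a b \<noteq> 0" "gcd a b \<noteq> 1" using ab by (auto simp: coprime_iff_gcd_eq_1)
    then have "2 \<le> gcd a b" by linarith
    moreover have "gcd a b \<le> N" using ab by (auto intro: le_trans[OF gcd_le1_nat])
    ultimately have "gcd a b \<in> {2..N}" by auto
    moreover have "x \<in> D (gcd a b)" using ab by (simp add: D_def)
    ultimately show "x \<in> (\<Union>d\<in>{2..N}. D d)" by blast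
  qed
  then have "card (Q - C) \<le> card (\<Union>d\<in>{2..N}. D d)" by (intro card_mono) (auto simp: fin)
  also have "\<dots> \<le> (\<Sum>d\<in>{2..N}. card (D d))" by (rule card_UN_le) simp
  finally have "real (card (Q - C)) \<le> (\<Sum>d\<in>{2..N}. real (card (D d)))"
    by (metis of_nat_le_iff of_nat_sum)
  also have "\<dots> \<le> (\<Sum>d\<in>{2..N}. (real N)\<^sup>2 * (1 / (real d)\<^sup>2))"
  proof (rule sum_mono)
    fix d assume d: "d \<in> {2..N}"
    have "real (card {a \<in> {1..N}. d dvd a}) \<le> real (N div d)"
      using card_multiples_le[of d N] d by simp
    also have "\<dots> \<le> real N / real d" 
      using d by (simp add: le_divide_eq flip: of_nat_mult)
    finally have "(real (card {a \<in> {1..N}. d dvd a}))\<^sup>2 \<le> (real N / real d)\<^sup>2"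
      by (intro power_mono) auto
    then show "real (card (D d)) \<le> (real N)\<^sup>2 * (1 / (real d)\<^sup>2)"
      by (simp add: D_def card_cartesian_product power2_eq_square)
  qed
  also have "\<dots> = (real N)\<^sup>2 * (\<Sum>d\<in>{2..N}. 1 / (real d)\<^sup>2)" by (simp add: sum_distrib_left)
  also have "(\<Sum>d\<in>{2..N}. 1 / (real d)\<^sup>2) \<le> 3 / 4"
  proof (cases "N \<ge> 2")
    case True
    then have "1 / real N \<ge> 0" by simp
    then show ?thesis using sum_inverse_squares_le[OF True] by linarith
  qed simp
  finally have *: "real (card (Q - C)) \<le> (real N)\<^sup>2 * (3 / 4)"
    by (simp add: mult_left_mono)
  have "card (Q - C) = card Q - card C" by (rule card_Diff_subset) (use CQ fin finite_subset in auto)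
  moreover have "card C \<le> card Q" by (rule card_mono) (use CQ fin in auto)
  moreover have "card Q = N\<^sup>2" by (simp add: Q_def power2_eq_square)
  ultimately have "real (card (Q - C)) = (real N)\<^sup>2 - real (card C)" by (simp add: of_nat_diff)
  then show ?thesis using * unfolding C_def by (simp add: field_simps)
qed

text \<open>For a fixed larger entry the coprime partners are its totatives, so the totients count
  the coprime pairs on one side of the diagonal; swapping covers the other, whence half of 1 /
  4.\<close>

lemma sum_totient_ge: "real N ^ 2 / 8 \<le> (\<Sum>n = 1..N. real (totient n))"
proof -
  define C where "C = {(a, b). a \<in> {1..N} \<and> b \<in> {1..N} \<and> coprime a b}"
  define T where "T = Sigma {1..N} totatives"
  have T: "finite T" "card T = (\<Sum>n = 1..N. totient n)"
    by (auto simp: T_def totient_def)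
  have "C \<subseteq> T \<union> prod.swap ` T"
  proof
    fix x assume "x \<in> C"
    then obtain a b where ab: "x = (a, b)" "a \<in> {1..N}" "b \<in> {1..N}" "coprime a b"
      by (cases x) (auto simp: C_def)
    show "x \<in> T \<union> prod.swap ` T"
    proof (cases "b \<le> a")
      case True
      then have "x \<in> T" using ab by (auto simp: T_def in_totatives_iff coprime_commute)
      then show ?thesis by blast
    next
      case False
      then have "(b, a) \<in> T" using ab by (auto simp: T_def in_totatives_iff)
      then show ?thesis using ab(1) by force
    qed
  qed
  then have "card C \<le> card (T \<union> prod.swap ` T)" using T(1) by (intro card_mono) auto
  also have "\<dots> \<le> card T + card (prod.swap ` T)" by (rule card_Un_le)
  also have "\<dots> \<le> 2 * card T" using card_image_le[OF T(1), of prod.swap] by simp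
  finally have "real (card C) \<le> 2 * (\<Sum>n = 1..N. real (totient n))"
    using T(2) by (metis of_nat_le_iff of_nat_mult of_nat_numeral of_nat_sum)
  then show ?thesis using card_coprime_pairs_ge[of N] unfolding C_def by simp
qed

text \<open>An average: numbers outside the set contribute less than N / 16 each, hence at most N^2
  / 16, half of the guaranteed N^2 / 8. The other half comes from members of the set, each
  contributing at most N.\<close>

lemma card_large_totient_ge:
  "real N / 16 \<le> card {n \<in> {1..N}. n \<le> 16 * totient n}"
proof (cases "N = 0")
  case False
  define G where "G = {n \<in> {1..N}. n \<le> 16 * totient n}"
  have "real N ^ 2 / 8 \<le> (\<Sum>n = 1..N. real (totient n))" by (rule sum_totient_ge)
  also have "\<dots> \<le> (\<Sum>n = 1..N. (if n \<in> G then real N else 0) + real N / 16)"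
  proof (rule sum_mono)
    fix n assume n: "n \<in> {1..N}"
    show "real (totient n) \<le> (if n \<in> G then real N else 0) + real N / 16"
    proof (cases "n \<in> G")
      case True
      have "real (totient n) \<le> real n" using totient_le[of n] by simp
      also have "\<dots> \<le> real N" using n by simp
      finally show ?thesis using True by simp
    next
      case False
      then have "16 * totient n < n" using n by (simp add: G_def)
      then show ?thesis using n False by simp
    qed
  qed
  also have "\<dots> = real (card G) * real N + real N * real N / 16"
    by (simp add: sum.distrib G_def flip: sum.inter_filter)
  finally have "real N * (real N / 16) \<le> real N * real (card G)"
    by (simp add: power2_eq_square algebra_simps)
  then show ?thesis using False unfolding G_def by simp
qed simp


section \<open>Primitive roots of unity\<close>

text \<open>For d = 0 the conditions are void and the set is the whole plane, hence the positivity
  assumptions below.\<close>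

definition prim_roots :: "nat \<Rightarrow> complex set" where
  "prim_roots d = {\<zeta>. \<zeta> ^ d = 1 \<and> (\<forall>e. 0 < e \<and> e < d \<longrightarrow> \<zeta> ^ e \<noteq> 1)}"

lemma finite_prim_roots: "d > 0 \<Longrightarrow> finite (prim_roots d)"
  by (rule finite_subset[OF _ finite_roots_unity[of d]]) (auto simp: prim_roots_def)

lemma roots_unity_eq_UN:
  assumes "m > 0"
  shows "{\<zeta>. \<zeta> ^ m = 1} = (\<Union>d\<in>{d. d dvd m}. prim_roots d)"
proof
  show "{\<zeta>. \<zeta> ^ m = 1} \<subseteq> (\<Union>d\<in>{d. d dvd m}. prim_roots d)"
  proof
    fix \<zeta> :: complex assume "\<zeta> \<in> {\<zeta>. \<zeta> ^ m = 1}"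
    then have \<zeta>: "\<zeta> ^ m = 1" by simp
    define Q where "Q = (\<lambda>e. e > 0 \<and> \<zeta> ^ e = 1)"
    define d where "d = Least Q"
    have "Q m" using \<zeta> assms by (simp add: Q_def)
    then have Qd: "Q d" unfolding d_def by (rule LeastI)
    have least: "\<not> Q e" if "e < d" for e using not_less_Least that by (simp add: d_def)
    have "\<zeta> ^ m = (\<zeta> ^ d) ^ (m div d) * \<zeta> ^ (m mod d)"
      by (simp flip: power_mult power_add)
    then have "\<zeta> ^ (m mod d) = 1" using \<zeta> Qd by (simp add: Q_def)
    moreover have "m mod d < d" using Qd by (simp add: Q_def)
    ultimately have "m mod d = 0" using least by (auto simp: Q_def)
    then have "d dvd m" by auto
    moreover have "\<zeta> \<in> prim_roots d" using Qd least by (auto simp: prim_roots_def Q_def)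
    ultimately show "\<zeta> \<in> (\<Union>d\<in>{d. d dvd m}. prim_roots d)" by blast
  qed
  show "(\<Union>d\<in>{d. d dvd m}. prim_roots d) \<subseteq> {\<zeta>. \<zeta> ^ m = 1}"
    by (auto simp: prim_roots_def power_mult elim!: dvdE)
qed

lemma prim_roots_disjoint:
  assumes "0 < d" "0 < e" "d \<noteq> e"
  shows "prim_roots d \<inter> prim_roots e = {}"
  using assms by (cases d e rule: linorder_cases) (auto simp: prim_roots_def)

text \<open>Summed over the divisors of \<open>m\<close>, both the numbers of roots of exact order
  and the totients give \<open>m\<close>; strong induction cancels the proper divisors.\<close>

lemma card_prim_roots: "m > 0 \<Longrightarrow> card (prim_roots m) = totient m"
proof (induction m rule: less_induct)
  case (less m)
  define D where "D = {d. d dvd m}"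
  have D: "finite D" "m \<in> D" and pos: "\<And>d. d \<in> D \<Longrightarrow> d > 0"
    using less.prems by (auto simp: D_def intro: Nat.gr0I)
  have "m = card {\<zeta>::complex. \<zeta> ^ m = 1}" using card_roots_unity_eq[OF less.prems] by simp
  also have "\<dots> = (\<Sum>d\<in>D. card (prim_roots d))"
    unfolding roots_unity_eq_UN[OF less.prems] D_def[symmetric]
    by (rule card_UN_disjoint) (use D pos finite_prim_roots prim_roots_disjoint in auto)
  also have "\<dots> = card (prim_roots m) + (\<Sum>d\<in>D - {m}. card (prim_roots d))"
    by (rule sum.remove[OF D])
  also have "(\<Sum>d\<in>D - {m}. card (prim_roots d)) = (\<Sum>d\<in>D - {m}. totient d)"
  proof (rule sum.cong)
    fix d assume d: "d \<in> D - {m}"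
    then have "d < m" using less.prems dvd_imp_le[of d m] by (auto simp: D_def)
    then show "card (prim_roots d) = totient d" using less.IH pos d by blast
  qed simp
  finally have "m = card (prim_roots m) + (\<Sum>d\<in>D - {m}. totient d)" .
  moreover have "m = totient m + (\<Sum>d\<in>D - {m}. totient d)"
    using totient_divisor_sum[of m] sum.remove[OF D, of totient] by (simp add: D_def)
  ultimately show ?case by linarith
qed

text \<open>All roots of X^m - 1 are simple, since the derivative m * X^(m - 1) vanishes at no root
  of unity.\<close>

lemma power_minus_1_eq_prod_roots:
  fixes z :: complex
  assumes "m > 0"
  shows "z ^ m - 1 = (\<Prod>\<zeta>\<in>{\<zeta>. \<zeta> ^ m = 1}. z - \<zeta>)"
proof -
  define p :: "complex poly" where "p = Polynomial.monom 1 m - 1"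
  have deg: "Polynomial.degree p = m"
    using assms unfolding p_def
    by (subst diff_conv_add_uminus, subst Polynomial.degree_add_eq_left)
      (auto simp: Polynomial.degree_monom_eq)
  have lc: "Polynomial.coeff p m = 1" using assms by (simp add: p_def)
  have "rsquarefree p"
    unfolding rsquarefree_roots
  proof (intro allI notI)
    fix a assume "poly p a = 0 \<and> poly (Polynomial.pderiv p) a = 0"
    then have "a ^ m = 1" "of_nat m * a ^ (m - 1) = 0"
      by (auto simp: p_def Polynomial.pderiv_diff Polynomial.pderiv_monom Polynomial.poly_monom)
    then show False using assms by (auto simp: power_0_left)
  qed
  then have "p = (\<Prod>\<zeta>|poly p \<zeta> = 0. [:- \<zeta>, 1:])"
    using complex_poly_decompose_rsquarefree[of p] by (simp add: deg lc)
  then have "poly p z = poly (\<Prod>\<zeta>|poly p \<zeta> = 0. [:- \<zeta>, 1:]) z" by simp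
  also have "\<dots> = (\<Prod>\<zeta>|poly p \<zeta> = 0. z - \<zeta>)" by (simp add: poly_prod)
  finally have "poly p z = (\<Prod>\<zeta>|poly p \<zeta> = 0. z - \<zeta>)" .
  then show ?thesis by (simp add: p_def Polynomial.poly_monom)
qed

text \<open>Given by its values: nothing is used about the coefficients of the cyclotomic
  polynomial, and integrality of the value is shown in \<open>cyclotomic_OK\<close>.\<close>

definition cyclotomic :: "nat \<Rightarrow> complex \<Rightarrow> complex" where
  "cyclotomic m z = (\<Prod>\<zeta>\<in>prim_roots m. z - \<zeta>)"

lemma power_minus_1_eq_prod_cyclotomic:
  assumes "m > 0"
  shows "z ^ m - 1 = (\<Prod>d\<in>{d. d dvd m}. cyclotomic d z)"
  unfolding power_minus_1_eq_prod_roots[OF assms] roots_unity_eq_UN[OF assms] cyclotomic_def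
proof (rule prod.UNION_disjoint)
  show "finite {d. d dvd m}" using assms by simp
  have pos: "d > 0" if "d dvd m" for d using assms that by (auto intro: Nat.gr0I)
  show "\<forall>i\<in>{d. d dvd m}. finite (prim_roots i)" using finite_prim_roots pos by blast
  show "\<forall>i\<in>{d. d dvd m}. \<forall>j\<in>{d. d dvd m}. i \<noteq> j \<longrightarrow> prim_roots i \<inter> prim_roots j = {}"
    using prim_roots_disjoint pos by blast
qed

lemma algebraic_int_prim_root:
  assumes "m > 0" "\<zeta> \<in> prim_roots m"
  shows "algebraic_int \<zeta>"
proof (rule algebraic_int_root[of 1 "Polynomial.monom 1 m"])
  show "\<forall>i. Polynomial.coeff (Polynomial.monom 1 m) i \<in> (\<int> :: complex set)" by simp
  show "algebraic_int (1 :: complex)" by (simp add: int_imp_algebraic_int)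
  show "poly (Polynomial.monom 1 m) \<zeta> = 1"
    using assms by (simp add: Polynomial.poly_monom prim_roots_def)
qed (use assms in \<open>auto simp: Polynomial.degree_monom_eq\<close>)

lemma algebraic_int_cyclotomic: "m > 0 \<Longrightarrow> algebraic_int z \<Longrightarrow> algebraic_int (cyclotomic m z)"
  unfolding cyclotomic_def
proof (rule algebraic_int_prod)
  fix \<zeta> assume "m > 0" "algebraic_int z" "\<zeta> \<in> prim_roots m"
  then have "algebraic_int (z + (- \<zeta>))"
    by (intro algebraic_int_add algebraic_int_minus) (auto intro: algebraic_int_prim_root)
  then show "algebraic_int (z - \<zeta>)" by simp
qed

lemma norm_cyclotomic_ge:
  assumes "m > 0" "cmod z \<ge> 1"
  shows "(cmod z - 1) ^ totient m \<le> cmod (cyclotomic m z)"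
proof -
  have "(cmod z - 1) ^ totient m = (\<Prod>\<zeta>\<in>prim_roots m. cmod z - 1)"
    using card_prim_roots[OF assms(1)] by simp
  also have "\<dots> \<le> (\<Prod>\<zeta>\<in>prim_roots m. cmod (z - \<zeta>))"
  proof (rule prod_mono)
    fix \<zeta> assume "\<zeta> \<in> prim_roots m"
    then have "cmod \<zeta> ^ m = 1" by (simp add: prim_roots_def flip: norm_power)
    then have "cmod \<zeta> = 1" 
      by (metis assms(1) norm_ge_zero power_eq_imp_eq_base power_one zero_le_one)
    then show "0 \<le> cmod z - 1 \<and> cmod z - 1 \<le> cmod (z - \<zeta>)"
      using assms(2) norm_triangle_ineq2[of z \<zeta>] by simp
  qed
  finally show ?thesis by (simp add: cyclotomic_def prod_norm)
qed


section \<open>Primitive prime divisors\<close>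

context imag_quad
begin

lemma power_neq_1:
  fixes b :: complex
  assumes "cmod b > 1" "d > 0"
  shows "b ^ d \<noteq> 1"
proof
  assume "b ^ d = 1"
  then have "cmod b ^ d = 1" by (simp flip: norm_power)
  then show False using one_less_power[OF assms] by simp
qed

lemma cyclotomic_nonzero:
  assumes "cmod b > 1" "m > 0"
  shows "cyclotomic m b \<noteq> 0"
proof
  assume "cyclotomic m b = 0"
  then have "(\<Prod>d\<in>{d. d dvd m}. cyclotomic d b) = 0" using assms(2) \<open>cyclotomic m b = 0\<close>
    by (intro prod_zero bexI[of _ m]) auto
  then have "b ^ m - 1 = 0" using power_minus_1_eq_prod_cyclotomic[OF assms(2), of b] by simp
  then show False using power_neq_1[OF assms] by simp
qed

text \<open>As a product of algebraic integers the value is one. It lies in \<open>K\<close> by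
  induction, as the quotient of b^m - 1 by the values at the proper divisors of \<open>m\<close>,
  which do not vanish because |b| > 1.\<close>

lemma cyclotomic_OK:
  assumes b: "b \<in> OK" "cmod b > 1"
  shows "m > 0 \<Longrightarrow> cyclotomic m b \<in> OK"
proof (induction m rule: less_induct)
  case (less m)
  define D where "D = {d. d dvd m} - {m}"
  have fin: "finite {d. d dvd m}" using less.prems by simp
  have eq: "b ^ m - 1 = cyclotomic m b * (\<Prod>d\<in>D. cyclotomic d b)"
    unfolding power_minus_1_eq_prod_cyclotomic[OF less.prems] D_def by (rule prod.remove[OF fin]) simp
  have "cyclotomic d b \<in> OK" if "d \<in> D" for d
  proof -
    have "d > 0" "d < m"
      using that less.prems dvd_imp_le[of d m] by (auto simp: D_def intro: Nat.gr0I)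
    then show ?thesis using less.IH by blast
  qed
  then have "(\<Prod>d\<in>D. cyclotomic d b) \<in> K"
    using OK_subset_K by (induction D rule: infinite_finite_induct) (auto intro: K_mult)
  moreover have "b ^ m - 1 \<in> K" using b(1) OK_subset_K K_diff[OF K_power K_1] by blast
  moreover have "(\<Prod>d\<in>D. cyclotomic d b) \<noteq> 0" using eq power_neq_1[OF b(2) less.prems] by auto
  ultimately have "cyclotomic m b \<in> K" using eq K_divide by (metis nonzero_mult_div_cancel_right)
  then show ?case using algebraic_int_cyclotomic[OF less.prems] b(1) by (simp add: OK_def)
qed

lemma prod_cyclotomic_OK:
  assumes "b \<in> OK" "cmod b > 1" "\<And>d. d \<in> D \<Longrightarrow> d > 0"
  shows "(\<Prod>d\<in>D. cyclotomic d b) \<in> OK"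
  using assms(3) cyclotomic_OK[OF assms(1,2)]
  by (induction D rule: infinite_finite_induct) (auto intro: OK_mult)

text \<open>The quotient of b^m - 1 by b^e - 1 is the product of the values at the divisors of
  \<open>m\<close> that do not divide \<open>e\<close>; \<open>m\<close> itself is one of them since
  e < m.\<close>

lemma power_minus_1_factor:
  assumes b: "b \<in> OK" "cmod b > 1" and e: "e dvd m" "e < m"
  obtains h where "h \<in> OK" "b ^ m - 1 = (b ^ e - 1) * (cyclotomic m b * h)"
proof -
  have m: "m > 0" and e0: "e > 0" using e by (auto intro: Nat.gr0I)
  define A B where "A = {d. d dvd m}" and "B = {d. d dvd e}"
  have fin: "finite A" "finite B" using m e0 by (auto simp: A_def B_def)
  have sub: "B \<subseteq> A" using e(1) dvd_trans by (auto simp: A_def B_def)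
  have mem: "m \<in> A - B" using e e0 dvd_imp_le[of m e] by (auto simp: A_def B_def)
  have "b ^ m - 1 = (\<Prod>d\<in>A - B. cyclotomic d b) * (\<Prod>d\<in>B. cyclotomic d b)"
    unfolding power_minus_1_eq_prod_cyclotomic[OF m] A_def[symmetric]
    by (rule prod.subset_diff[OF sub fin(1)])
  also have "(\<Prod>d\<in>B. cyclotomic d b) = b ^ e - 1"
    unfolding power_minus_1_eq_prod_cyclotomic[OF e0] B_def ..
  also have "(\<Prod>d\<in>A - B. cyclotomic d b) = cyclotomic m b * (\<Prod>d\<in>A - B - {m}. cyclotomic d b)"
    by (rule prod.remove[OF _ mem]) (use fin in simp)
  finally have "b ^ m - 1 = (b ^ e - 1) * (cyclotomic m b * (\<Prod>d\<in>A - B - {m}. cyclotomic d b))"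
    by (simp add: mult_ac)
  moreover have "(\<Prod>d\<in>A - B - {m}. cyclotomic d b) \<in> OK"
    by (rule prod_cyclotomic_OK[OF b]) (use m in \<open>auto simp: A_def intro: Nat.gr0I\<close>)
  ultimately show ?thesis using that by blast
qed

lemma cyclotomic_dvd_power_minus_1:
  assumes b: "b \<in> OK" "cmod b > 1" and m: "m > 0"
  obtains h where "h \<in> OK" "b ^ m - 1 = cyclotomic m b * h"
proof -
  define A where "A = {d. d dvd m}"
  have "b ^ m - 1 = cyclotomic m b * (\<Prod>d\<in>A - {m}. cyclotomic d b)"
    unfolding power_minus_1_eq_prod_cyclotomic[OF m] A_def by (rule prod.remove) (use m in auto)
  moreover have "(\<Prod>d\<in>A - {m}. cyclotomic d b) \<in> OK"
    by (rule prod_cyclotomic_OK[OF b]) (use m in \<open>auto simp: A_def intro: Nat.gr0I\<close>)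
  ultimately show ?thesis using that by blast
qed

section \<open>Orders modulo a place\<close>

lemma power_minus_1_mem_mult:
  assumes P: "place P" and b: "b \<in> OK" "b ^ e - 1 \<in> P"
  shows "b ^ (e * k) - 1 \<in> P"
proof -
  have "b ^ (e * k) - 1 = (b ^ e - 1) * (\<Sum>i<k. (b ^ e) ^ i)"
    by (simp add: power_mult power_diff_1_eq)
  then show ?thesis
    using idl_mult2[OF place_idl[OF P] b(2)] b(1) by (auto intro: OK_sum OK_power)
qed

lemma geometric_sum_mem:
  assumes P: "place P" and b: "b \<in> OK" "b ^ e - 1 \<in> P" and S: "(\<Sum>i<k. (b ^ e) ^ i) \<in> P"
  shows "of_nat k \<in> P"
proof -
  have idP: "idl P" by (rule place_idl[OF P])
  have "(\<Sum>i<j. (b ^ e) ^ i) - of_nat j \<in> P" for j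
  proof (induction j)
    case 0
    then show ?case using idl_0[OF idP] by simp
  next
    case (Suc j)
    have "(b ^ e) ^ j - 1 \<in> P" using power_minus_1_mem_mult[OF P b, of j] by (simp add: power_mult)
    from idl_add[OF idP Suc this] show ?case by (simp add: algebra_simps)
  qed
  from idl_diff[OF idP S this[of k]] show ?thesis by simp
qed

text \<open>Bezout in the form m * x = e * y + gcd m e keeps all exponents natural, so that
  \<open>b\<close> is never inverted modulo \<open>P\<close>.\<close>

lemma power_minus_1_mem_gcd:
  assumes P: "place P" and b: "b \<in> OK" "b ^ m - 1 \<in> P" "b ^ e - 1 \<in> P" and m: "m > 0"
  shows "b ^ gcd m e - 1 \<in> P"
proof -
  obtain x y where xy: "m * x = e * y + gcd m e"
    using bezout_nat[of m e] m by auto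
  have "b ^ gcd m e - 1 = (b ^ (m * x) - 1) - b ^ gcd m e * (b ^ (e * y) - 1)"
    unfolding xy power_add by (simp add: algebra_simps)
  also have "\<dots> \<in> P"
    using idl_diff[OF place_idl[OF P] power_minus_1_mem_mult[OF P b(1,2)]
        idl_mult[OF place_idl[OF P] power_minus_1_mem_mult[OF P b(1,3)] OK_power[OF b(1)]]] .
  finally show ?thesis .
qed

text \<open>If the order of \<open>b\<close> modulo \<open>P\<close> were a proper divisor \<open>g\<close> of \<open>m\<close>, then
  \<open>(b ^ m - 1) / (b ^ g - 1)\<close>, a multiple of \<open>cyclotomic m b\<close>, would be congruent to \<open>m / g\<close>
  modulo \<open>P\<close>.\<close>

lemma cyclotomic_mem_imp_dvd:
  assumes P: "place P" and b: "b \<in> OK" "cmod b > 1" and m: "m > 0"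
    and c: "cyclotomic m b \<in> P" "of_nat m \<notin> P" and e: "b ^ e - 1 \<in> P"
  shows "m dvd e"
proof (rule ccontr)
  assume "\<not> m dvd e"
  have idP: "idl P" by (rule place_idl[OF P])
  \<comment> \<open>\<open>g\<close> need not be the order itself: any proper divisor of
    \<open>m\<close> with b^g - 1 in \<open>P\<close> leads to the contradiction.\<close>
  define g where "g = gcd m e"
  have g: "g dvd m" "g > 0" using m by (auto simp: g_def)
  have "g \<noteq> m" using \<open>\<not> m dvd e\<close> by (metis g_def gcd_dvd2)
  then have "g < m" using g m dvd_imp_le[of g m] by auto
  obtain h where h: "h \<in> OK" "b ^ m - 1 = cyclotomic m b * h"
    by (rule cyclotomic_dvd_power_minus_1[OF b m])
  then have "b ^ m - 1 \<in> P" using idl_mult2[OF idP c(1) h(1)] by simp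
  then have bg: "b ^ g - 1 \<in> P"
    unfolding g_def using power_minus_1_mem_gcd[OF P b(1) _ e m] by blast
  obtain h where h: "h \<in> OK" "b ^ m - 1 = (b ^ g - 1) * (cyclotomic m b * h)"
    by (rule power_minus_1_factor[OF b g(1) \<open>g < m\<close>])
  have "b ^ m = (b ^ g) ^ (m div g)" using g by (simp flip: power_mult)
  then have "b ^ m - 1 = (b ^ g - 1) * (\<Sum>i<m div g. (b ^ g) ^ i)"
    by (simp only: power_diff_1_eq)
  from trans[OF this[symmetric] h(2)]
  have "(b ^ g - 1) * (\<Sum>i<m div g. (b ^ g) ^ i) = (b ^ g - 1) * (cyclotomic m b * h)" .
  then have "(\<Sum>i<m div g. (b ^ g) ^ i) = cyclotomic m b * h"
    using power_neq_1[OF b(2) g(2)] by (metis mult_left_cancel right_minus_eq)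
  then have "(\<Sum>i<m div g. (b ^ g) ^ i) \<in> P" using idl_mult2[OF idP c(1) h(1)] by simp
  then have "of_nat (m div g) \<in> P" by (rule geometric_sum_mem[OF P b(1) bg])
  then have "of_nat g * of_nat (m div g) \<in> P" using idl_mult[OF idP] by simp
  moreover have "of_nat g * of_nat (m div g) = (of_nat m :: complex)"
    using g by (simp flip: of_nat_mult)
  ultimately show False using c(2) by simp
qed

text \<open>Fermat and the lemma on orders give the divisibility. With Nm P - 1 = m * k the quotient
  of the two differences is a geometric sum congruent to \<open>k\<close> modulo \<open>P\<close>.
  Were \<open>k\<close> in \<open>P\<close>, then Nm P - 1 and Nm P would both be, hence 1; so
  passing from \<open>m\<close> to Nm P - 1 leaves the exponent of \<open>P\<close> at 1.\<close>

lemma primitive_prime_props: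
  assumes P: "place P" and b: "b \<in> OK" "cmod b > 1" and m: "m > 0"
    and c: "cyclotomic m b \<in> P" "of_nat m \<notin> P" "val P (b ^ m - 1) = 1"
  shows "m dvd conj_norm P - 1" "val P (b ^ (conj_norm P - 1) - 1) = 1"
proof -
  have idP: "idl P" by (rule place_idl[OF P])
  have OKm: "b ^ m - 1 \<in> OK" "b ^ m - 1 \<noteq> 0"
    using b power_neq_1[OF b(2) m] by (auto intro: OK_diff OK_power)
  have bm: "b ^ m - 1 \<in> P" using val_pos_iff[OF P OKm] c(3) by simp
  have "b \<notin> P"
  proof
    assume "b \<in> P"
    then have "b ^ (m - 1) * b \<in> P" using b(1) by (intro idl_mult[OF idP]) (auto intro: OK_power)
    then have "b ^ m \<in> P" using m by (metis power_minus_mult)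
    from idl_diff[OF idP this bm] show False using place_not_1[OF P] by simp
  qed
  then have F: "b ^ (conj_norm P - 1) - 1 \<in> P" using fermat_place[OF P b(1)] by blast
  then show dvd: "m dvd conj_norm P - 1" by (rule cyclotomic_mem_imp_dvd[OF P b m c(1,2)])
  define k where "k = (conj_norm P - 1) div m"
  have mk: "conj_norm P - 1 = m * k" using dvd by (simp add: k_def)
  define S where "S = (\<Sum>i<k. (b ^ m) ^ i)"
  have eq: "b ^ (conj_norm P - 1) - 1 = (b ^ m - 1) * S"
    unfolding mk S_def by (simp add: power_mult power_diff_1_eq)
  have SOK: "S \<in> OK" using b by (auto simp: S_def intro: OK_sum OK_power)
  have "conj_norm P - 1 > 0" using place_conj_norm_gt_1[OF P] by simp
  then have "S \<noteq> 0" using eq power_neq_1[OF b(2)] by fastforce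
  have "S \<notin> P"
  proof
    assume "S \<in> P"
    then have "of_nat k \<in> P" unfolding S_def by (rule geometric_sum_mem[OF P b(1) bm])
    then have "of_nat m * of_nat k \<in> P" using idl_mult[OF idP] by simp
    then have "of_nat (conj_norm P - 1) \<in> P" unfolding mk of_nat_mult .
    from idl_diff[OF idP conj_norm_mem[OF idP] this] have "1 \<in> P"
      using place_conj_norm_gt_1[OF P] by (simp add: of_nat_diff)
    then show False using place_not_1[OF P] by blast
  qed
  then show "val P (b ^ (conj_norm P - 1) - 1) = 1"
    unfolding eq using val_mult[OF P OKm(1) SOK OKm(2) \<open>S \<noteq> 0\<close>] val_eq_0[OF P SOK] c(3) by simp
qed

text \<open>With n = Nm P - 1, the number a^n - 1 divides (a^r)^n - 1, so \<open>P\<close> occurs in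
  it at most once; Fermat makes it occur.\<close>

lemma non_wieferich_if_power:
  assumes P: "place P" and a: "a \<in> OK" "cmod a > 1" and r: "r > 0"
    and v: "val P ((a ^ r) ^ (conj_norm P - 1) - 1) = 1"
  shows "non_wieferich_place K a P"
proof -
  have idP: "idl P" by (rule place_idl[OF P])
  define n where "n = conj_norm P - 1"
  have n: "n > 0" using place_conj_norm_gt_1[OF P] by (simp add: n_def)
  define S where "S = (\<Sum>i<r. (a ^ n) ^ i)"
  have eq: "(a ^ r) ^ n - 1 = (a ^ n - 1) * S"
    unfolding S_def power_diff_1_eq[symmetric] by (simp add: mult.commute flip: power_mult)
  have x: "a ^ n - 1 \<in> OK" "a ^ n - 1 \<noteq> 0"
    using a power_neq_1[OF a(2) n] by (auto intro: OK_diff OK_power)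
  have S: "S \<in> OK" "S \<noteq> 0"
  proof -
    show "S \<in> OK" using a by (auto simp: S_def intro: OK_sum OK_power)
    have "a ^ (r * n) \<noteq> 1" using r n by (intro power_neq_1[OF a(2)]) simp
    then show "S \<noteq> 0" using eq by (auto simp: power_mult)
  qed
  have "val P (a ^ n - 1) + val P S = 1" using val_mult[OF P x(1) S(1) x(2) S(2)] v eq by (simp add: n_def)
  moreover have "val P (a ^ n - 1) > 0"
  proof -
    have "a \<notin> P"
    proof
      assume "a \<in> P"
      have y: "(a ^ r) ^ n - 1 \<in> OK" "(a ^ r) ^ n - 1 \<noteq> 0"
        using eq x S OK_mult by auto
      then have mem: "(a ^ r) ^ n - 1 \<in> P" using val_pos_iff[OF P y] v by (simp add: n_def)
      have "a ^ (r * n - 1) * a \<in> P" using a(1) \<open>a \<in> P\<close>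
        by (intro idl_mult[OF idP]) (auto intro: OK_power)
      then have "(a ^ r) ^ n \<in> P" using r n
        by (metis power_minus_mult power_mult mult_pos_pos)
      from idl_diff[OF idP this mem] show False using place_not_1[OF P] by simp
    qed
    then have "a ^ n - 1 \<in> P" unfolding n_def by (rule fermat_place[OF P a(1)])
    then show ?thesis using val_pos_iff[OF P x] by blast
  qed
  ultimately have "val P (a ^ n - 1) = 1" by simp
  then show ?thesis
    using P int_val_eq[OF P x] by (simp add: non_wieferich_place_def ideal_norm_eq_conj_norm n_def one_enat_def)
qed


section \<open>The powerful part of \<open>b ^ m - 1\<close>\<close>

definition pow_part :: "complex \<Rightarrow> nat" where
  "pow_part y = (\<Prod>P\<in>{P \<in> primes_of y. val P y \<ge> 2}. conj_norm P ^ val P y)"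

lemma conj_norm_pos: "place P \<Longrightarrow> conj_norm P > 0"
  using place_conj_norm_gt_1[of P] by simp

lemma pow_part_pos: "pow_part y > 0"
  unfolding pow_part_def by (rule prod_pos) (auto simp: primes_of_def conj_norm_pos)

lemma rad_pos: "rad y > 0"
  unfolding rad_def by (rule prod_pos) (auto simp: primes_of_def conj_norm_pos)

text \<open>Prime by prime: an exponent e \<ge> 2 gives 2 + e \<le> 2 * e, the exponent 1 gives 2 on
  both sides. A large powerful part thus forces a small radical, which the conjecture
  forbids.\<close>

lemma rad_square_mult_pow_part_le:
  assumes "y \<in> OK" "y \<noteq> 0"
  shows "(rad y)\<^sup>2 * pow_part y \<le> (abs_norm y)\<^sup>2"
proof -
  define A B where "A = {P \<in> primes_of y. val P y \<ge> 2}" and "B = {P \<in> primes_of y. \<not> val P y \<ge> 2}"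
  have fin: "finite (primes_of y)" by (rule finite_primes_of[OF assms])
  have split: "(\<Prod>P\<in>primes_of y. f P) = (\<Prod>P\<in>A. f P) * (\<Prod>P\<in>B. f P)" for f :: "_ \<Rightarrow> nat"
  proof -
    have "primes_of y = A \<union> B" by (auto simp: A_def B_def)
    moreover have "A \<inter> B = {}" "finite A" "finite B" using fin by (auto simp: A_def B_def)
    ultimately show ?thesis by (simp add: prod.union_disjoint)
  qed
  have "(\<Prod>P\<in>A. conj_norm P)\<^sup>2 \<le> pow_part y"
    unfolding pow_part_def A_def[symmetric] prod_power_distrib
    by (rule prod_mono) (auto simp: A_def primes_of_def conj_norm_pos Suc_le_eq intro!: power_increasing)
  moreover have "(\<Prod>P\<in>B. conj_norm P) \<le> (\<Prod>P\<in>B. conj_norm P ^ val P y)"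
  proof (rule prod_mono)
    fix P assume "P \<in> B"
    then have "conj_norm P > 0" "val P y > 0" using assms val_pos_iff by (auto simp: B_def primes_of_def conj_norm_pos)
    then show "0 \<le> conj_norm P \<and> conj_norm P \<le> conj_norm P ^ val P y" by (simp add: self_le_power Suc_le_eq)
  qed
  ultimately have "((\<Prod>P\<in>A. conj_norm P)\<^sup>2 * (\<Prod>P\<in>B. conj_norm P)\<^sup>2) * pow_part y \<le>
      (pow_part y * (\<Prod>P\<in>B. conj_norm P ^ val P y)\<^sup>2) * pow_part y"
    by (intro mult_right_mono mult_mono power_mono) auto
  also have "\<dots> = (pow_part y * (\<Prod>P\<in>B. conj_norm P ^ val P y))\<^sup>2"
    by (simp add: power2_eq_square mult_ac)
  also have "pow_part y * (\<Prod>P\<in>B. conj_norm P ^ val P y) = abs_norm y"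
    unfolding abs_norm_eq_prod[OF assms] split pow_part_def A_def ..
  finally show ?thesis by (simp add: rad_def split power_mult_distrib)
qed

lemma rad_le_abs_norm:
  assumes "y \<in> OK" "y \<noteq> 0"
  shows "rad y \<le> abs_norm y"
proof -
  have "(rad y)\<^sup>2 * 1 \<le> (rad y)\<^sup>2 * pow_part y"
    by (intro mult_left_mono) (use pow_part_pos[of y] in auto)
  also have "\<dots> \<le> (abs_norm y)\<^sup>2" by (rule rad_square_mult_pow_part_le[OF assms])
  finally show ?thesis by simp
qed

lemma rad_power:
  assumes "b \<in> OK" "m > 0"
  shows "rad (b ^ m) = rad b"
proof -
  have "b ^ m \<in> P \<longleftrightarrow> b \<in> P" if P: "place P" for P
  proof
    assume "b \<in> P"
    then have "b ^ (m - 1) * b \<in> P"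
      using assms by (intro idl_mult[OF place_idl[OF P]]) (auto intro: OK_power)
    then show "b ^ m \<in> P" using assms(2) by (metis power_minus_mult)
  qed (rule place_power_mem[OF P assms(1)])
  then have "primes_of (b ^ m) = primes_of b" by (auto simp: primes_of_def)
  then show ?thesis by (simp add: rad_def)
qed

lemma abs_norm_power_minus_1_le:
  assumes "b \<in> OK" "cmod b > 1"
  shows "real (abs_norm (b ^ m - 1)) \<le> 4 * real (abs_norm b) ^ m"
proof -
  have "cmod (b ^ m - 1) \<le> cmod b ^ m + 1"
    using norm_triangle_ineq4[of "b ^ m" 1] by (simp add: norm_power)
  also have "\<dots> \<le> 2 * cmod b ^ m" using one_le_power[of "cmod b" m] assms by simp
  finally have "(cmod (b ^ m - 1))\<^sup>2 \<le> (2 * cmod b ^ m)\<^sup>2" by (intro power_mono) auto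
  then show ?thesis
    using assms by (simp add: real_abs_norm OK_diff OK_power power_mult_distrib power_even_eq
        flip: power_mult)
qed

text \<open>Let B be the norm of \<open>b\<close>, W the root of the powerful part and r the product
  of the radicals. Then r * W is at most a constant times B^m, while the conjecture bounds B^m by a
  constant times r^(1 + \<epsilon>). Multiplying the latter by W \<le> W^(1 + \<epsilon>) makes r
  and W meet in one power; dividing by B^m leaves a bound on W.\<close>

lemma abc_pow_part:
  assumes abc: "abc_conjecture K" and b: "b \<in> OK" "cmod b > 1" and \<epsilon>: "\<epsilon> > 0"
  obtains C :: real where "C > 0"
    "\<And>m. m > 0 \<Longrightarrow> sqrt (pow_part (b ^ m - 1)) \<le> C * (real (abs_norm b) ^ m) powr \<epsilon>"
proof -
  obtain C :: real where C: "C > 0"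
    "\<And>z. z \<in> OK \<Longrightarrow> z \<noteq> 0 \<Longrightarrow> z \<noteq> 1 \<Longrightarrow> cmod z \<le> C * sqrt (rad (z - 1) * rad z) powr (1 + \<epsilon>)"
    using abc_bound[OF abc \<epsilon>] by blast
  define B where "B = real (abs_norm b)"
  have b0: "b \<noteq> 0" using b by auto
  have B: "B = (cmod b)\<^sup>2" "B > 0" using real_abs_norm[OF b(1)] b0 by (auto simp: B_def)
  \<comment> \<open>4 * B is what r * W may have besides B^m: 4 from squaring |b^m - 1| \<le> 2 *
    |b|^m, and B from the radical of b^m, which is that of \<open>b\<close> and at most its
    norm.\<close>
  define C' where "C' = C\<^sup>2 * (4 * B) powr (1 + \<epsilon>)"
  show ?thesis
  proof
    show "C' > 0" using C(1) B(2) by (simp add: C'_def)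
    fix m :: nat assume m: "m > 0"
    define y where "y = b ^ m - 1"
    define W where "W = sqrt (pow_part y)"
    have y: "y \<in> OK" "y \<noteq> 0"
      using b power_neq_1[OF b(2) m] by (auto simp: y_def intro: OK_diff OK_power)
    have W1: "W \<ge> 1" using pow_part_pos[of y] by (simp add: W_def)
    have Bm: "B ^ m > 0" using B(2) by simp
    have "(rad y * W)\<^sup>2 \<le> (real (abs_norm y))\<^sup>2"
      using rad_square_mult_pow_part_le[OF y]
      by (simp add: W_def power_mult_distrib flip: of_nat_power of_nat_mult)
    then have "rad y * W \<le> real (abs_norm y)" by (rule power2_le_imp_le) simp
    also have "\<dots> \<le> 4 * B ^ m" using abs_norm_power_minus_1_le[OF b] by (simp add: y_def B_def)
    finally have radW: "rad y * W \<le> 4 * B ^ m" .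
    have rz: "real (rad (b ^ m)) \<le> B" using rad_power[OF b(1) m] rad_le_abs_norm[OF b(1) b0] by (simp add: B_def)
    define r where "r = real (rad y) * real (rad (b ^ m))"
    have "r * W = (rad y * W) * rad (b ^ m)" by (simp add: r_def)
    also have "\<dots> \<le> (4 * B ^ m) * B" 
      by (rule mult_mono[OF radW rz]) (use Bm in auto)
    finally have rW: "r * W \<le> 4 * B * B ^ m" by (simp add: mult_ac)
    have r0: "r > 0" using rad_pos by (simp add: r_def)
    have "cmod (b ^ m) \<le> C * sqrt r powr (1 + \<epsilon>)"
      using C(2)[of "b ^ m"] b b0 power_neq_1[OF b(2) m] by (simp add: OK_power r_def y_def)
    then have "(cmod (b ^ m))\<^sup>2 \<le> (C * sqrt r powr (1 + \<epsilon>))\<^sup>2" by (intro power_mono) auto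
    also have "(sqrt r powr (1 + \<epsilon>))\<^sup>2 = r powr (1 + \<epsilon>)"
      using r0 by (simp add: power2_eq_square flip: powr_mult)
    then have "(C * sqrt r powr (1 + \<epsilon>))\<^sup>2 = C\<^sup>2 * r powr (1 + \<epsilon>)" by (simp add: power_mult_distrib)
    also have "(cmod (b ^ m))\<^sup>2 = B ^ m" by (simp add: B(1) norm_power mult.commute flip: power_mult)
    finally have le1: "B ^ m \<le> C\<^sup>2 * r powr (1 + \<epsilon>)" .
    have "B ^ m * W \<le> B ^ m * W powr (1 + \<epsilon>)"
      using W1 \<epsilon> Bm powr_mono[of 1 "1 + \<epsilon>" W] by (intro mult_left_mono) auto
    also have "\<dots> \<le> (C\<^sup>2 * r powr (1 + \<epsilon>)) * W powr (1 + \<epsilon>)"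
      by (rule mult_right_mono[OF le1]) simp
    also have "\<dots> = C\<^sup>2 * (r * W) powr (1 + \<epsilon>)" using r0 W1 by (simp add: powr_mult)
    also have "\<dots> \<le> C\<^sup>2 * (4 * B * B ^ m) powr (1 + \<epsilon>)"
      using rW r0 W1 \<epsilon> by (intro mult_left_mono powr_mono2) auto
    also have "\<dots> = C' * ((B ^ m) powr (1 + \<epsilon>))" using B(2) by (simp add: C'_def powr_mult)
    also have "\<dots> = B ^ m * (C' * (B ^ m) powr \<epsilon>)" using Bm by (simp add: powr_add)
    finally show "sqrt (pow_part (b ^ m - 1)) \<le> C' * (real (abs_norm b) ^ m) powr \<epsilon>"
      using Bm by (simp add: W_def y_def B_def)
  qed
qed

lemma val_le_of_factor:
  assumes P: "place P" and "x \<in> OK" "h \<in> OK" "x * h \<noteq> 0"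
  shows "val P x \<le> val P (x * h)"
  using val_mult[OF P assms(2,3)] assms(4) by simp

text \<open>Primes that divide the cyclotomic value and divide b^m - 1 at least twice are absorbed
  by the powerful part. The others occur once and contain \<open>m\<close> by assumption, so
  together they contribute at most the radical of \<open>m\<close>, which its norm m^2
  bounds.\<close>

lemma abs_norm_cyclotomic_le:
  assumes b: "b \<in> OK" "cmod b > 1" and m: "m > 0"
    and none: "\<And>P. place P \<Longrightarrow> cyclotomic m b \<in> P \<Longrightarrow> val P (b ^ m - 1) = 1 \<Longrightarrow> of_nat m \<in> P"
  shows "abs_norm (cyclotomic m b) \<le> pow_part (b ^ m - 1) * m\<^sup>2"
proof -
  define y where "y = b ^ m - 1"
  define f where "f = cyclotomic m b"
  have f: "f \<in> OK" "f \<noteq> 0" using cyclotomic_OK[OF b m] cyclotomic_nonzero[OF b(2) m] by (auto simp: f_def)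
  have y: "y \<in> OK" "y \<noteq> 0"
    using b power_neq_1[OF b(2) m] by (auto simp: y_def intro: OK_diff OK_power)
  obtain h where h: "h \<in> OK" "y = f * h"
    unfolding y_def f_def by (rule cyclotomic_dvd_power_minus_1[OF b m])
  have mem: "y \<in> P" if "place P" "f \<in> P" for P
    unfolding h(2) using idl_mult2[OF place_idl[OF that(1)] that(2) h(1)] .
  have le: "val P f \<le> val P y" if "place P" for P
    using val_le_of_factor[OF that f(1) h(1)] y(2) h(2) by simp
  define A where "A = {P \<in> primes_of f. val P y \<ge> 2}"
  define B where "B = {P \<in> primes_of f. \<not> val P y \<ge> 2}"
  have fin: "finite (primes_of f)" "finite (primes_of y)" "finite (primes_of (of_nat m))"
    using finite_primes_of f y m by auto
  have "abs_norm f = (\<Prod>P\<in>A. conj_norm P ^ val P f) * (\<Prod>P\<in>B. conj_norm P ^ val P f)"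
    unfolding abs_norm_eq_prod[OF f] A_def B_def
    by (subst prod.union_disjoint[symmetric]) (use fin in \<open>auto intro!: prod.cong\<close>)
  also have "\<dots> \<le> pow_part y * rad (of_nat m)"
  proof (rule mult_mono)
    have "(\<Prod>P\<in>A. conj_norm P ^ val P f) \<le> (\<Prod>P\<in>A. conj_norm P ^ val P y)"
      using le by (intro prod_mono) (auto simp: A_def primes_of_def conj_norm_pos Suc_le_eq intro!: power_increasing)
    also have "\<dots> \<le> pow_part y"
    proof -
      have "A \<subseteq> {P \<in> primes_of y. val P y \<ge> 2}" using mem by (auto simp: A_def primes_of_def)
      then show ?thesis
        using pow_part_pos[of y] fin(2) unfolding pow_part_def
        by (intro dvd_imp_le prod_dvd_prod_subset) auto
    qed
    finally show "(\<Prod>P\<in>A. conj_norm P ^ val P f) \<le> pow_part y" .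
    have B: "P \<in> primes_of (of_nat m) \<and> conj_norm P ^ val P f \<le> conj_norm P" if "P \<in> B" for P
    proof -
      have P: "place P" "f \<in> P" "val P y < 2" using that by (auto simp: B_def primes_of_def)
      have "val P y > 0" using val_pos_iff[OF P(1) y] mem[OF P(1,2)] by blast
      then have v: "val P y = 1" using P(3) by simp
      then have "of_nat m \<in> P" using none[OF P(1)] P(2) by (simp add: f_def y_def)
      moreover have "conj_norm P ^ val P f \<le> conj_norm P ^ 1"
        using le[OF P(1)] v conj_norm_pos[OF P(1)] by (intro power_increasing) auto
      ultimately show ?thesis using P(1) by (simp add: primes_of_def)
    qed
    have "(\<Prod>P\<in>B. conj_norm P ^ val P f) \<le> (\<Prod>P\<in>B. conj_norm P)" using B by (intro prod_mono) auto
    also have "\<dots> \<le> rad (of_nat m)"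
      using rad_pos[of "of_nat m"] B fin unfolding rad_def
      by (intro dvd_imp_le prod_dvd_prod_subset) auto
    finally show "(\<Prod>P\<in>B. conj_norm P ^ val P f) \<le> rad (of_nat m)" .
  qed auto
  also have "\<dots> \<le> pow_part y * m\<^sup>2"
    using rad_le_abs_norm[of "of_nat m"] m by (intro mult_left_mono) (auto simp: abs_norm_of_nat)
  finally show ?thesis by (simp add: f_def y_def)
qed

end


section \<open>Counting non-Wieferich places\<close>

lemma csqrt_neg_three: "csqrt (-3) = \<i> * sqrt 3"
  using csqrt_of_real_nonpos[of "-3"] by simp

lemma exponential_dominates_square:
  fixes r D :: real
  assumes "r > 1"
  shows "\<forall>\<^sub>F m::nat in sequentially. D * (real m)\<^sup>2 < r ^ m"
  using assms by real_asymp

context imag_quad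
begin

text \<open>An integer of norm 1 has a trace \<open>t\<close> with t^2 \<le> 4. The values 2 and -2
  give 1 and -1, the value 0 gives \<i> and - \<i>, and 1 and -1 give the primitive sixth and third
  roots of unity: all of them are excluded.\<close>

lemma cmod_square_ge_2_if_not_exceptional:
  assumes a: "a \<in> OK" and ex: "a \<notin> exceptional_bases"
  shows "(cmod a)\<^sup>2 \<ge> 2"
proof (rule ccontr)
  assume "\<not> (cmod a)\<^sup>2 \<ge> 2"
  then have "real (abs_norm a) < 2" using real_abs_norm[OF a] by simp
  moreover have "abs_norm a \<noteq> 0" using abs_norm_0_iff[OF a] ex by (auto simp: exceptional_bases_def)
  ultimately have "abs_norm a = 1" by linarith
  then have norm: "(Re a)\<^sup>2 + (Im a)\<^sup>2 = 1" using real_abs_norm[OF a] by (simp add: cmod_power2)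
  obtain t where t: "a + cnj a = of_int t" using a by (auto simp: OK_iff elim: Ints_cases)
  have Re: "2 * Re a = of_int t" using arg_cong[OF t, of Re] by simp
  have four: "(of_int t)\<^sup>2 + 4 * (Im a)\<^sup>2 = 4" using norm by (simp flip: Re add: power_mult_distrib)
  then have "(real_of_int t)\<^sup>2 \<le> 4" using zero_le_power2[of "Im a"] by linarith
  then have "real_of_int (t\<^sup>2) \<le> real_of_int 4" by simp
  then have "t\<^sup>2 \<le> 2\<^sup>2" by (simp only: of_int_le_iff) simp
  then have "\<bar>t\<bar> \<le> \<bar>2\<bar>" by (simp only: abs_le_square_iff)
  then consider "t = 2 \<or> t = -2" | "t = 0" | "t = 1 \<or> t = -1" by linarith
  then show False
  proof cases
    case 1
    then have "Im a = 0" "Re a = 1 \<or> Re a = -1" using four Re by auto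
    then have "a = 1 \<or> a = -1" by (auto simp: complex_eq_iff)
    then show False using ex by (auto simp: exceptional_bases_def)
  next
    case 2
    then have "(Im a)\<^sup>2 = 1" "Re a = 0" using four Re by auto
    then have "a = \<i> \<or> a = - \<i>" by (auto simp: complex_eq_iff power2_eq_1_iff)
    then show False using ex by (auto simp: exceptional_bases_def)
  next
    case 3
    define s :: complex where "s = of_int t"
    have "(2 * Im a)\<^sup>2 = (sqrt 3)\<^sup>2" using 3 four by (auto simp: power_mult_distrib)
    then have "2 * Im a = sqrt 3 \<or> 2 * Im a = - sqrt 3" by (simp only: power2_eq_iff)
    then have "\<exists>u\<in>{1, -1 :: complex}. 2 * Im a = Re u * sqrt 3 \<and> Im u = 0" by simp
    then obtain u :: complex where u: "u \<in> {1, -1}" "2 * Im a = Re u * sqrt 3" "Im u = 0" by blast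
    have "2 * a = s + u * csqrt (-3)"
      using Re u by (auto simp: csqrt_neg_three complex_eq_iff s_def)
    then have "a = (s + u * csqrt (-3)) / 2" by (simp add: field_simps)
    moreover have "s \<in> {1, -1}" using 3 by (auto simp: s_def)
    ultimately show False using ex u(1) unfolding exceptional_bases_def by blast
  qed
qed

lemma conj_norm_le_abs_norm:
  assumes "place P" "y \<in> OK" "y \<noteq> 0" "y \<in> P"
  shows "conj_norm P \<le> abs_norm y"
proof -
  have "conj_norm P dvd rad y" unfolding rad_def
    using assms finite_primes_of by (intro dvd_prodI) (auto simp: primes_of_def)
  then have "conj_norm P \<le> rad y" using rad_pos by (rule dvd_imp_le)
  then show ?thesis using rad_le_abs_norm[OF assms(2,3)] by simp
qed

text \<open>Every place contains its norm, and only finitely many places contain a given nonzero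
  integer.\<close>

lemma finite_primes_conj_norm_le: "finite {P. place P \<and> real (conj_norm P) \<le> x}"
proof (rule finite_subset)
  show "{P. place P \<and> real (conj_norm P) \<le> x} \<subseteq> (\<Union>n\<in>{1..nat \<lfloor>x\<rfloor>}. primes_of (of_nat n))"
  proof
    fix P assume P: "P \<in> {P. place P \<and> real (conj_norm P) \<le> x}"
    then have "conj_norm P \<in> {1..nat \<lfloor>x\<rfloor>}" using conj_norm_pos[of P] by (auto simp: le_nat_floor Suc_le_eq)
    moreover have "P \<in> primes_of (of_nat (conj_norm P))" using P conj_norm_mem place_idl by (auto simp: primes_of_def)
    ultimately show "P \<in> (\<Union>n\<in>{1..nat \<lfloor>x\<rfloor>}. primes_of (of_nat n))" by blast
  qed
  show "finite (\<Union>n\<in>{1..nat \<lfloor>x\<rfloor>}. primes_of (of_nat n))"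
    using finite_primes_of by auto
qed

text \<open>The conditions before the last make \<open>m\<close> the order of \<open>b\<close>
  modulo \<open>P\<close>; the last one keeps \<open>P\<close> out of the powerful part of b^m -
  1.\<close>

definition primitive_place :: "complex \<Rightarrow> nat \<Rightarrow> complex set \<Rightarrow> bool" where
  "primitive_place b m P \<longleftrightarrow>
     place P \<and> cyclotomic m b \<in> P \<and> of_nat m \<notin> P \<and> val P (b ^ m - 1) = 1"

text \<open>Without such a place the norm of the cyclotomic value is at most m^2 times the powerful
  part. With c = |b| this norm is at least c^(m / l), while the conjecture bounds the powerful part
  by C^2 * c^(m / (2 * l)); what is left, c^(m / (2 * l)) \<le> C^2 * m^2, fails for large
  \<open>m\<close>.\<close>

lemma primitive_place_exists:
  assumes abc: "abc_conjecture K" and b: "b \<in> OK" "cmod b \<ge> 4" and l: "l > 0"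
  shows "\<exists>m0. \<forall>m\<ge>m0. m > 0 \<longrightarrow> m \<le> l * totient m \<longrightarrow> (\<exists>P. primitive_place b m P)"
proof -
  have b1: "cmod b > 1" using b by simp
  define c where "c = cmod b"
  have c: "c \<ge> 4" using b by (simp add: c_def)
  \<comment> \<open>The norm of \<open>b\<close> is c^2 and the bound on the root of the powerful
    part gets squared, so the exponent of \<open>c\<close> is 4 * m * \<epsilon>; this choice makes
    it half of the available m / l.\<close>
  define \<epsilon> :: real where "\<epsilon> = 1 / (8 * l)"
  have \<epsilon>: "\<epsilon> > 0" using l by (simp add: \<epsilon>_def)
  obtain C :: real where C: "C > 0"
    "\<And>m. m > 0 \<Longrightarrow> sqrt (pow_part (b ^ m - 1)) \<le> C * (real (abs_norm b) ^ m) powr \<epsilon>"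
    using abc_pow_part[OF abc b(1) b1 \<epsilon>] by blast
  define r where "r = c powr (1 / (2 * l))"
  have r: "r > 1" using c l by (simp add: r_def)
  obtain m0 where m0: "\<And>m. m \<ge> m0 \<Longrightarrow> C\<^sup>2 * (real m)\<^sup>2 < r ^ m"
    using exponential_dominates_square[OF r, of "C\<^sup>2"] by (auto simp: eventually_sequentially)
  have "\<exists>P. primitive_place b m P" if m: "m \<ge> m0" "m > 0" "m \<le> l * totient m" for m
  proof (rule ccontr)
    assume "\<nexists>P. primitive_place b m P"
    then have "abs_norm (cyclotomic m b) \<le> pow_part (b ^ m - 1) * m\<^sup>2"
      by (intro abs_norm_cyclotomic_le[OF b(1) b1 m(2)]) (auto simp: primitive_place_def)
    then have le: "real (abs_norm (cyclotomic m b)) \<le> pow_part (b ^ m - 1) * (real m)\<^sup>2"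
      by (metis of_nat_le_iff of_nat_mult of_nat_power)
    have "(c powr (real m / l)) \<le> c powr real (totient m)"
    proof (rule powr_mono)
      have "real m \<le> real l * real (totient m)" using m(3) by (metis of_nat_le_iff of_nat_mult)
      then show "real m / l \<le> real (totient m)" using l by (simp add: field_simps)
    qed (use c in simp)
    also have "\<dots> = c ^ totient m" using c by (simp add: powr_realpow)
    also have "\<dots> \<le> ((c - 1)\<^sup>2) ^ totient m"
    proof (rule power_mono)
      \<comment> \<open>The modulus at least 4 is used here; c - 1 appears squared because norms are
        squared moduli.\<close>
      have "c * 4 \<le> c * c" using c by (intro mult_left_mono) auto
      moreover have "(c - 1)\<^sup>2 = c * c - 2 * c + 1" by (simp add: power2_eq_square algebra_simps)
      ultimately show "c \<le> (c - 1)\<^sup>2" using c by linarith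
    qed (use c in simp)
    also have "\<dots> = ((c - 1) ^ totient m)\<^sup>2" by (simp add: mult.commute flip: power_mult)
    also have "\<dots> \<le> (cmod (cyclotomic m b))\<^sup>2"
      using norm_cyclotomic_ge[OF m(2), of b] c by (intro power_mono) (auto simp: c_def)
    also have "\<dots> = real (abs_norm (cyclotomic m b))" using real_abs_norm[OF cyclotomic_OK[OF b(1) b1 m(2)]] by simp
    also have "\<dots> \<le> pow_part (b ^ m - 1) * (real m)\<^sup>2" by (rule le)
    also have "\<dots> \<le> (C * (real (abs_norm b) ^ m) powr \<epsilon>)\<^sup>2 * (real m)\<^sup>2"
    proof (rule mult_right_mono)
      have "real (pow_part (b ^ m - 1)) = (sqrt (pow_part (b ^ m - 1)))\<^sup>2" by simp
      also have "\<dots> \<le> (C * (real (abs_norm b) ^ m) powr \<epsilon>)\<^sup>2"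
        by (rule power_mono[OF C(2)[OF m(2)]]) simp
      finally show "real (pow_part (b ^ m - 1)) \<le> (C * (real (abs_norm b) ^ m) powr \<epsilon>)\<^sup>2" .
    qed simp
    also have "real (abs_norm b) ^ m = c powr (2 * real m)"
    proof -
      have "real (abs_norm b) = c powr 2" using c real_abs_norm[OF b(1)] by (simp add: c_def)
      then have "real (abs_norm b) ^ m = (c powr 2) powr real m" using c by (subst powr_realpow) auto
      then show ?thesis by (simp only: powr_powr)
    qed
    also have "(C * (c powr (2 * real m)) powr \<epsilon>)\<^sup>2 = C\<^sup>2 * c powr (real m / (2 * l))"
    proof -
      have "2 * real m * \<epsilon> + 2 * real m * \<epsilon> = real m / (2 * l)" using l by (simp add: \<epsilon>_def field_simps)
      then have "(c powr (2 * real m * \<epsilon>))\<^sup>2 = c powr (real m / (2 * l))"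
        unfolding power2_eq_square powr_add[symmetric] by (rule arg_cong)
      then show ?thesis by (simp only: power_mult_distrib powr_powr)
    qed
    finally have "c powr (real m / l) \<le> (C\<^sup>2 * (real m)\<^sup>2) * c powr (real m / (2 * l))"
      by (simp add: mult_ac)
    also have "\<dots> < r ^ m * c powr (real m / (2 * l))"
      using m0[OF m(1)] c by (intro mult_strict_right_mono) auto
    also have "r ^ m = c powr (real m / (2 * l))"
    proof -
      have "r ^ m = r powr real m" using r by (subst powr_realpow) auto
      also have "\<dots> = c powr (1 / (2 * l) * real m)" unfolding r_def powr_powr ..
      finally show ?thesis by simp
    qed
    also have "c powr (real m / (2 * l)) * c powr (real m / (2 * l)) = c powr (real m / l)"
      unfolding powr_add[symmetric] using l by (simp add: field_simps)
    finally show False by simp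
  qed
  then show ?thesis by blast
qed

text \<open>\<open>P\<close> divides the nonzero number (a^s)^m - 1, whose norm bounds that of
  \<open>P\<close>. The order concerns the power a^s, the conclusion the base \<open>a\<close>;
  \<open>non_wieferich_if_power\<close> bridges the two.\<close>

lemma primitive_place_counted:
  assumes a: "a \<in> OK" "cmod a > 1" and s: "s > 0" and m: "m > 0"
    and P: "primitive_place (a ^ s) m P"
  shows "non_wieferich_place K a P" "[ideal_norm K P = 1] (mod m)"
    "real (ideal_norm K P) \<le> 4 * real (abs_norm (a ^ s)) ^ m"
proof -
  have place: "place P" and c: "cyclotomic m (a ^ s) \<in> P" "of_nat m \<notin> P" "val P ((a ^ s) ^ m - 1) = 1"
    using P by (auto simp: primitive_place_def)
  have b: "a ^ s \<in> OK" "cmod (a ^ s) > 1"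
    using a s by (auto simp: OK_power norm_power one_less_power)
  note props = primitive_prime_props[OF place b m c]
  show "non_wieferich_place K a P"
    by (rule non_wieferich_if_power[OF place a s props(2)])
  have "[conj_norm P = 1] (mod m)"
    using props(1) place_conj_norm_gt_1[OF place] by (simp add: cong_altdef_nat)
  then show "[ideal_norm K P = 1] (mod m)" by (simp add: ideal_norm_eq_conj_norm[OF place])
  have y: "(a ^ s) ^ m - 1 \<in> OK" "(a ^ s) ^ m - 1 \<noteq> 0"
    using b power_neq_1[OF b(2) m] by (auto intro: OK_diff OK_power)
  have "(a ^ s) ^ m - 1 \<in> P" using val_pos_iff[OF place y] c(3) by simp
  then have "conj_norm P \<le> abs_norm ((a ^ s) ^ m - 1)" by (rule conj_norm_le_abs_norm[OF place y])
  then have "real (conj_norm P) \<le> real (abs_norm ((a ^ s) ^ m - 1))" by simp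
  also have "\<dots> \<le> 4 * real (abs_norm (a ^ s)) ^ m" by (rule abs_norm_power_minus_1_le[OF b])
  finally show "real (ideal_norm K P) \<le> 4 * real (abs_norm (a ^ s)) ^ m"
    by (simp add: ideal_norm_eq_conj_norm[OF place])
qed

lemma primitive_place_unique:
  assumes b: "b \<in> OK" "cmod b > 1" and "m > 0" "n > 0"
    and P: "primitive_place b m P" "primitive_place b n P"
  shows "m = n"
proof -
  have *: "m dvd n" if "m > 0" "n > 0" "primitive_place b m P" "primitive_place b n P" for m n
  proof -
    have place: "place P" using that by (simp add: primitive_place_def)
    have y: "b ^ n - 1 \<in> OK" "b ^ n - 1 \<noteq> 0"
      using b power_neq_1[OF b(2) that(2)] by (auto intro: OK_diff OK_power)
    have "b ^ n - 1 \<in> P" using val_pos_iff[OF place y] that(4) by (simp add: primitive_place_def)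
    then show ?thesis
      using cyclotomic_mem_imp_dvd[OF place b that(1)] that(3) by (simp add: primitive_place_def)
  qed
  show ?thesis using * assms by (intro dvd_antisym) auto
qed

text \<open>Places are chosen for m = k * n with \<open>n\<close> up to \<open>N\<close> and of
  large totient. Omitting the n below m0 loses at most m0 of at least N / 16 values, and the
  hypothesis on \<open>N\<close> keeps all norms at most \<open>x\<close>.\<close>

lemma count_ge:
  assumes a: "a \<in> OK" "cmod a > 1" and s: "s > 0" and k: "k > 0"
    and ex: "\<And>m. m \<ge> m0 \<Longrightarrow> m > 0 \<Longrightarrow> m \<le> 16 * k * totient m \<Longrightarrow> \<exists>P. primitive_place (a ^ s) m P"
    and N: "4 * real (abs_norm (a ^ s)) ^ (k * N) \<le> x"
  shows "real N / 16 - real m0 \<le> real (card {P. non_wieferich_place K a P \<and>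
           real (ideal_norm K P) \<le> x \<and> [ideal_norm K P = 1] (mod k)})"
    (is "_ \<le> real (card ?T)")
proof -
  define b where "b = a ^ s"
  have b: "b \<in> OK" "cmod b > 1"
    using a s by (auto simp: b_def OK_power norm_power one_less_power)
  define G where "G = {n \<in> {1..N}. n \<le> 16 * totient n}"
  define S where "S = G - {..<m0}"
  have "\<exists>P. primitive_place b (k * n) P" if "n \<in> S" for n
  proof -
    have n: "n > 0" "n \<ge> m0" "n \<le> 16 * totient n" using that by (auto simp: S_def G_def)
    \<comment> \<open>The totient ratio passes from n to k * n at the cost of a factor
      \<open>k\<close>, whence the 16 * k in the hypothesis.\<close>
    have "totient n \<le> totient (k * n)" using k n by (intro totient_dvd_mono) auto
    then have "k * n \<le> k * (16 * totient (k * n))" using n(3) by (intro mult_left_mono) auto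
    moreover have "k * n \<ge> m0" using n k by (metis le_trans mult_le_mono1 nat_mult_1 Suc_leI One_nat_def)
    ultimately show ?thesis unfolding b_def using n k by (intro ex) (auto simp: mult_ac)
  qed
  then obtain F where F: "\<And>n. n \<in> S \<Longrightarrow> primitive_place b (k * n) (F n)" by metis
  have pos: "k * n > 0" if "n \<in> S" for n using that k by (auto simp: S_def G_def)
  have nb: "real (abs_norm b) \<ge> 1" using real_abs_norm[OF b(1)] b(2) by simp
  have "inj_on F S"
  proof (rule inj_onI)
    fix n n' assume n: "n \<in> S" "n' \<in> S" "F n = F n'"
    have "k * n = k * n'"
      using primitive_place_unique[OF b pos[OF n(1)] pos[OF n(2)] F[OF n(1)]] F[OF n(2)] n(3) by simp
    then show "n = n'" using k by simp
  qed
  moreover have "F ` S \<subseteq> ?T"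
  proof
    fix P assume "P \<in> F ` S"
    then obtain n where n: "n \<in> S" "P = F n" by auto
    have P: "primitive_place (a ^ s) (k * n) P" using F[OF n(1)] n(2) by (simp add: b_def)
    note counted = primitive_place_counted[OF a s pos[OF n(1)] P]
    have "real (abs_norm b) ^ (k * n) \<le> real (abs_norm b) ^ (k * N)"
      using n nb by (intro power_increasing) (auto simp: S_def G_def)
    then have "real (ideal_norm K P) \<le> x" using counted(3) N by (simp add: b_def)
    moreover have "[ideal_norm K P = 1] (mod k)"
      using counted(2) by (rule cong_dvd_modulus_nat) simp
    ultimately show "P \<in> ?T" using counted(1) by blast
  qed
  moreover have "finite ?T"
    by (rule finite_subset[OF _ finite_primes_conj_norm_le[of x]])
      (auto simp: non_wieferich_place_def ideal_norm_eq_conj_norm)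
  ultimately have "card S \<le> card ?T" by (rule card_inj_on_le)
  moreover have "card G \<le> card S + m0"
  proof -
    have "card G - card {..<m0} \<le> card S" unfolding S_def by (rule diff_card_le_card_Diff) simp
    then show ?thesis by simp
  qed
  ultimately have "real (card G) \<le> real (card ?T) + real m0" by linarith
  then show ?thesis using card_large_totient_ge[of N] unfolding G_def by linarith
qed

end

theorem theorem3:
  fixes K :: "complex set" and k :: nat and a :: complex
  assumes "imaginary_quadratic_field K"
    and "k > 0"
    and "abc_conjecture K"
    and "a \<in> carrier (ring_of_integers K)"
    and "a \<notin> exceptional_bases"
  shows "\<exists>c>0. \<forall>\<^sub>F x::real in at_top.
           real (card {P. non_wieferich_place K a P \<and> real (ideal_norm K P) \<le> x \<and>
                          [ideal_norm K P = 1] (mod k)}) \<ge> c * ln x"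
proof -
  interpret imag_quad K by unfold_locales (rule assms(1))
  have a: "a \<in> OK" using assms(4) by simp
  have a2: "(cmod a)\<^sup>2 \<ge> 2" by (rule cmod_square_ge_2_if_not_exceptional[OF a assms(5)])
  have a1: "cmod a > 1"
  proof (rule ccontr)
    assume "\<not> cmod a > 1"
    then have "(cmod a)\<^sup>2 \<le> 1" by (simp add: power_le_one)
    then show False using a2 by simp
  qed
  define b where "b = a ^ 4"
  have "cmod b = ((cmod a)\<^sup>2)\<^sup>2" by (simp add: b_def norm_power flip: power_mult)
  also have "\<dots> \<ge> 2\<^sup>2" using a2 by (intro power_mono) auto
  finally have b: "b \<in> OK" "cmod b \<ge> 4" using a by (auto simp: b_def OK_power)
  obtain m0 where m0: "\<And>m. m \<ge> m0 \<Longrightarrow> m > 0 \<Longrightarrow> m \<le> 16 * k * totient m \<Longrightarrow> \<exists>P. primitive_place b m P"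
    using primitive_place_exists[OF assms(3) b, of "16 * k"] assms(2) by auto
  define B where "B = real (abs_norm b)"
  have "B = (cmod b)\<^sup>2" using real_abs_norm[OF b(1)] by (simp add: B_def)
  also have "\<dots> > 1" using b(2) by (intro one_less_power) auto
  finally have B: "B > 1" .
  define D where "D = real k * ln B"
  have D: "D > 0" using B assms(2) by (simp add: D_def)
  let ?T = "\<lambda>x. {P. non_wieferich_place K a P \<and> real (ideal_norm K P) \<le> x \<and>
                          [ideal_norm K P = 1] (mod k)}"
  have lower: "(ln x - ln 4) / (16 * D) - 1 / 16 - real m0 \<le> real (card (?T x))" if x: "x \<ge> 4" for x
  proof -
    define L where "L = ln (x / 4) / D"
    \<comment> \<open>Since D = k * ln B, this is the largest N with 4 * B^(k * N) \<le> x.\<close>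
    define N where "N = nat \<lfloor>L\<rfloor>"
    have L: "L \<ge> 0" using x D by (simp add: L_def)
    have "real N \<le> L" using L by (simp add: N_def)
    then have "real N * D \<le> ln (x / 4)" using D by (simp add: L_def field_simps)
    then have "ln (B ^ (k * N)) \<le> ln (x / 4)"
      using B by (simp add: ln_realpow D_def mult_ac)
    then have "B ^ (k * N) \<le> x / 4" using B x by (subst (asm) ln_le_cancel_iff) auto
    then have "4 * real (abs_norm (a ^ 4)) ^ (k * N) \<le> x" by (simp add: B_def b_def)
    from count_ge[OF a a1 _ assms(2) m0[unfolded b_def] this]
    have "real N / 16 - real m0 \<le> real (card (?T x))" by simp
    moreover have "real N \<ge> L - 1" using L by (simp add: N_def)
    moreover have "L = (ln x - ln 4) / D" using x by (simp add: L_def ln_div)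
    then have "L / 16 = (ln x - ln 4) / (16 * D)" by simp
    ultimately show ?thesis by linarith
  qed
  show ?thesis
  proof (intro exI[of _ "1 / (32 * D)"] conjI)
    show "1 / (32 * D) > 0" using D by simp
    \<comment> \<open>The slope obtained is 1 / (16 * D); half of it is given up, and
      \<open>E\<close> is the value of ln x from which that half outweighs the constant
      terms.\<close>
    define E where "E = 32 * D * (ln 4 / (16 * D) + 1 / 16 + real m0)"
    have "\<forall>\<^sub>F x::real in at_top. ln x \<ge> E"
      using ln_at_top by (simp add: filterlim_at_top)
    then show "\<forall>\<^sub>F x::real in at_top. 1 / (32 * D) * ln x \<le> real (card (?T x))"
      using eventually_ge_at_top[of 4]
    proof eventually_elim
      case (elim x)
      have "ln 4 / (16 * D) + 1 / 16 + real m0 \<le> ln x / (32 * D)"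
        using elim(1) D by (simp add: E_def field_simps)
      moreover have "(ln x - ln 4) / (16 * D) = 2 * (ln x / (32 * D)) - ln 4 / (16 * D)"
        using D by (simp add: field_simps)
      ultimately show ?case using lower[OF elim(2)] by simp
    qed
  qed
qed

end
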